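(* Let $E$ be a $(DFN)$-space, and let $L$ be a nontrivial convolution operator on $\mathcal{H}(E)$, where $\mathcal{H}(E)$ carries the compact-open topology $\tau_0$. Then $L$ is mixing; in particular, $L$ is hypercyclic.
   Context: All locally convex spaces are complex and Hausdorff. A $(DFN)$-space is the strong dual of a Fréchet nuclear space. $\mathcal{H}(E)$ denotes the vector space of all holomorphic functions $f\colon E\to\mathbb{C}$, and $\tau_0$ is the topology of uniform convergence on compact subsets of $E$. For $a\in E$ and $f\in\mathcal{H}(E)$ put $(\tau_a f)(x)=f(x-a)$. A convolution operator on $\mathcal{H}(E)$ is a continuous linear mapping $L\colon\mathcal{H}(E)\to\mathcal{H}(E)$ such that $L(\tau_a f)=\tau_a(Lf)$ for all $f\in\mathcal{H}(E)$ and $a\in E$. It is nontrivial if it is not a scalar multiple of the identity. A continuous linear operator $T\colon X\to X$ on a topological vector space $X$ is mixing if for any two non-empty open sets $U,V\subset X$ there is $n_0\in\mathbb{N}$ such that $T^n(U)\cap V\neq\emptyset$ for all $n\geq n_0$. It is hypercyclic if there is $x\in X$ whose orbit $\{x,T(x),T^2(x),\ldots\}$ is dense in $X$. *)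

theory Defs
  imports "HOL-Analysis.Analysis"
begin

section \<open>Complex locally convex spaces\<close>

text \<open>
  Complex Hausdorff locally convex spaces as a type class. The real scalar multiplication is the
  restriction of the complex one; local convexity spells out \<open>convex\<close>, which cannot be used
  inside the class declaration. The uniformity is no
  extra datum: uniform continuity of the group operations forces it to be the translation-invariant
  uniformity of the topology, so the library's \<open>complete\<close> is completeness in the sense of
  topological vector spaces.
\<close>

class complex_lcs = real_vector + uniform_topological_group_add + t2_space +
  fixes scaleC :: "complex \<Rightarrow> 'a \<Rightarrow> 'a"
  assumes scaleC_add_right: "scaleC c (x + y) = scaleC c x + scaleC c y"
    and scaleC_add_left: "scaleC (c + d) x = scaleC c x + scaleC d x"
    and scaleC_scaleC: "scaleC c (scaleC d x) = scaleC (c * d) x"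
    and scaleC_one: "scaleC 1 x = x"
    and scaleR_scaleC: "scaleR r x = scaleC (complex_of_real r) x"
    and tendsto_scaleC_Pair:
      "((\<lambda>p. scaleC (fst p) (snd p)) \<longlongrightarrow> scaleC c x) (nhds c \<times>\<^sub>F nhds x)"
    and locally_convex:
      "\<lbrakk>open U; 0 \<in> U\<rbrakk> \<Longrightarrow> \<exists>V. open V \<and> 0 \<in> V \<and> V \<subseteq> U \<and>
        (\<forall>x\<in>V. \<forall>y\<in>V. \<forall>u\<ge>0. \<forall>v\<ge>0. u + v = 1 \<longrightarrow> scaleR u x + scaleR v y \<in> V)"

lemma locally_convex_convex:
  fixes U :: "'a::complex_lcs set"
  assumes "open U" "0 \<in> U"
  shows "\<exists>V. open V \<and> convex V \<and> 0 \<in> V \<and> V \<subseteq> U"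
  using locally_convex[OF assms] unfolding convex_def by blast

lemma vector_space_scaleC: "vector_space (scaleC :: complex \<Rightarrow> 'a::complex_lcs \<Rightarrow> 'a)"
  by unfold_locales (simp_all add: scaleC_add_right scaleC_add_left scaleC_scaleC scaleC_one)

instantiation complex :: complex_lcs
begin

definition scaleC_complex :: "complex \<Rightarrow> complex \<Rightarrow> complex"
  where "scaleC_complex = (*)"

instance
proof
  fix c x :: complex
  show "((\<lambda>p. scaleC (fst p) (snd p)) \<longlongrightarrow> scaleC c x) (nhds c \<times>\<^sub>F nhds x)"
    unfolding scaleC_complex_def using tendsto_mult_Pair .
next
  fix U :: "complex set"
  assume "open U" "0 \<in> U"
  then obtain e where "e > 0" "ball 0 e \<subseteq> U"
    using open_contains_ball by blast
  then show "\<exists>V. open V \<and> 0 \<in> V \<and> V \<subseteq> U \<and>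
      (\<forall>x\<in>V. \<forall>y\<in>V. \<forall>u\<ge>0. \<forall>v\<ge>0. u + v = 1 \<longrightarrow> scaleR u x + scaleR v y \<in> V)"
    using convex_ball[of "0::complex" e] unfolding convex_def
    by (intro exI[of _ "ball 0 e"]) auto
qed (simp_all add: scaleC_complex_def algebra_simps scaleR_conv_of_real)

end

definition linear_functional :: "('a::complex_lcs \<Rightarrow> complex) \<Rightarrow> bool"
  where "linear_functional \<phi> \<longleftrightarrow> Vector_Spaces.linear scaleC (*) \<phi>"

definition complex_seminorm :: "('a::complex_lcs \<Rightarrow> real) \<Rightarrow> bool"
  where "complex_seminorm p \<longleftrightarrow>
    (\<forall>x y. p (x + y) \<le> p x + p y) \<and> (\<forall>c x. p (scaleC c x) = cmod c * p x)"

definition bounded_lcs :: "'a::complex_lcs set \<Rightarrow> bool"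
  where "bounded_lcs B \<longleftrightarrow>
    (\<forall>U. open U \<and> 0 \<in> U \<longrightarrow> (\<exists>s>0. \<forall>c. cmod c \<ge> s \<longrightarrow> B \<subseteq> scaleC c ` U))"


section \<open>Uniform convergence on a family of sets\<close>

text \<open>
  The topology on the set \<open>X\<close> of functions of uniform convergence on the members of
  \<open>\<S>\<close>. Finite unions of members are built in, so that it is a topology for every
  \<open>\<S>\<close>; they are redundant for the families of bounded or of compact sets.
\<close>

definition uniform_convergence_topology ::
    "'a set set \<Rightarrow> ('a \<Rightarrow> complex) set \<Rightarrow> ('a \<Rightarrow> complex) topology"
  where "uniform_convergence_topology \<S> X = topology (\<lambda>U. U \<subseteq> X \<and>
    (\<forall>f\<in>U. \<exists>\<F> \<epsilon>. finite \<F> \<and> \<F> \<subseteq> \<S> \<and> \<epsilon> > 0 \<and>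
      {g \<in> X. \<forall>x\<in>\<Union>\<F>. cmod (g x - f x) < \<epsilon>} \<subseteq> U))"

lemma openin_uniform_convergence_topology:
  "openin (uniform_convergence_topology \<S> X) U \<longleftrightarrow> U \<subseteq> X \<and>
    (\<forall>f\<in>U. \<exists>\<F> \<epsilon>. finite \<F> \<and> \<F> \<subseteq> \<S> \<and> \<epsilon> > 0 \<and>
      {g \<in> X. \<forall>x\<in>\<Union>\<F>. cmod (g x - f x) < \<epsilon>} \<subseteq> U)"
proof -
  define P where "P U f \<longleftrightarrow> (\<exists>\<F> \<epsilon>. finite \<F> \<and> \<F> \<subseteq> \<S> \<and> \<epsilon> > 0 \<and>
      {g \<in> X. \<forall>x\<in>\<Union>\<F>. cmod (g x - f x) < \<epsilon>} \<subseteq> U)" for U f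
  have mono: "P V f" if "P U f" "U \<subseteq> V" for U V f
    using that unfolding P_def by (meson subset_trans)
  have int: "P (U \<inter> V) f" if U: "P U f" and V: "P V f" for U V f
  proof -
    obtain \<F> \<epsilon> where 1: "finite \<F>" "\<F> \<subseteq> \<S>" "\<epsilon> > 0"
        "{g \<in> X. \<forall>x\<in>\<Union>\<F>. cmod (g x - f x) < \<epsilon>} \<subseteq> U"
      using U unfolding P_def by blast
    obtain \<G> \<delta> where 2: "finite \<G>" "\<G> \<subseteq> \<S>" "\<delta> > 0"
        "{g \<in> X. \<forall>x\<in>\<Union>\<G>. cmod (g x - f x) < \<delta>} \<subseteq> V"
      using V unfolding P_def by blast
    have "{g \<in> X. \<forall>x\<in>\<Union>(\<F> \<union> \<G>). cmod (g x - f x) < min \<epsilon> \<delta>} \<subseteq> U \<inter> V"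
      using 1(4) 2(4) by (fastforce simp: subset_iff)
    then show ?thesis
      unfolding P_def using 1(1-3) 2(1-3)
      by (intro exI[of _ "\<F> \<union> \<G>"] exI[of _ "min \<epsilon> \<delta>"]) auto
  qed
  have "istopology (\<lambda>U. U \<subseteq> X \<and> (\<forall>f\<in>U. P U f))"
    unfolding istopology_def
  proof (intro conjI allI impI)
    fix \<K> assume *: "\<forall>K\<in>\<K>. K \<subseteq> X \<and> (\<forall>f\<in>K. P K f)"
    then show "\<Union>\<K> \<subseteq> X"
      by blast
    show "\<forall>f\<in>\<Union>\<K>. P (\<Union>\<K>) f"
      using * mono by (meson Sup_upper UnionE)
  next
    fix S T assume "S \<subseteq> X \<and> (\<forall>f\<in>S. P S f)" "T \<subseteq> X \<and> (\<forall>f\<in>T. P T f)"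
    then show "S \<inter> T \<subseteq> X" "\<forall>f\<in>S \<inter> T. P (S \<inter> T) f"
      using int by auto
  qed
  then show ?thesis
    unfolding uniform_convergence_topology_def P_def by (simp add: topology_inverse')
qed

lemma topspace_uniform_convergence_topology [simp]:
  "topspace (uniform_convergence_topology \<S> X) = X"
proof (rule antisym)
  show "topspace (uniform_convergence_topology \<S> X) \<subseteq> X"
    using openin_topspace openin_uniform_convergence_topology by blast
  have "openin (uniform_convergence_topology \<S> X) X"
    unfolding openin_uniform_convergence_topology
    by (auto intro!: exI[of _ "{}"] exI[of _ "1::real"])
  then show "X \<subseteq> topspace (uniform_convergence_topology \<S> X)"
    by (rule openin_subset)
qed


section \<open>(DFN)-spaces\<close>

definition frechet_space :: "'a::complex_lcs itself \<Rightarrow> bool"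
  where "frechet_space (_ :: 'a itself) \<longleftrightarrow>
    metrizable_space (euclidean :: 'a topology) \<and> complete (UNIV :: 'a set)"

text \<open>
  Nuclearity of a linear map \<open>T\<close> between the seminormed spaces \<open>('a, q)\<close> and
  \<open>('b, p)\<close>, i.e. of the map it induces between the normed spaces \<open>'a / ker q\<close> and
  \<open>'b / ker p\<close>: \<open>T x = (\<Sum>n. c n * \<phi> n x * y n)\<close> with absolutely summable
  coefficients, functionals of dual norm at most 1 and vectors of norm at most 1.
\<close>

definition nuclear_map ::
    "('a::complex_lcs \<Rightarrow> real) \<Rightarrow> ('b::complex_lcs \<Rightarrow> real) \<Rightarrow> ('a \<Rightarrow> 'b) \<Rightarrow> bool"
  where "nuclear_map q p T \<longleftrightarrow>
    (\<exists>(c :: nat \<Rightarrow> complex) (\<phi> :: nat \<Rightarrow> 'a \<Rightarrow> complex) (y :: nat \<Rightarrow> 'b).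
      summable (\<lambda>n. cmod (c n)) \<and>
      (\<forall>n. linear_functional (\<phi> n) \<and> (\<forall>x. cmod (\<phi> n x) \<le> q x)) \<and>
      (\<forall>n. p (y n) \<le> 1) \<and>
      (\<forall>x. (\<lambda>N. p (T x - (\<Sum>n<N. scaleC (c n * \<phi> n x) (y n)))) \<longlonglongrightarrow> 0))"

text \<open>
  For \<open>p \<le> q\<close> the identity induces the canonical map from the local space of \<open>q\<close> to
  that of \<open>p\<close>. Passing to the completed local spaces gives the same notion: expand each
  vector of the completion into an absolutely convergent series of vectors of the space.
\<close>

definition nuclear_space :: "'a::complex_lcs itself \<Rightarrow> bool"
  where "nuclear_space (_ :: 'a itself) \<longleftrightarrow>
    (\<forall>p :: 'a \<Rightarrow> real. complex_seminorm p \<and> continuous_on UNIV p \<longrightarrow>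
      (\<exists>q. complex_seminorm q \<and> continuous_on UNIV q \<and> (\<forall>x. p x \<le> q x) \<and>
        nuclear_map q p (\<lambda>x. x)))"

definition strong_dual :: "('a::complex_lcs \<Rightarrow> complex) topology"
  where "strong_dual = uniform_convergence_topology {B. bounded_lcs B}
    {\<phi>. linear_functional \<phi> \<and> continuous_on UNIV \<phi>}"

text \<open>\<open>'e\<close> is, up to a topological isomorphism, the strong dual of the Frechet nuclear
  space \<open>'f\<close>.\<close>

definition DFN_space :: "'e::complex_lcs itself \<Rightarrow> 'f::complex_lcs itself \<Rightarrow> bool"
  where "DFN_space (_ :: 'e itself) (_ :: 'f itself) \<longleftrightarrow>
    frechet_space TYPE('f) \<and> nuclear_space TYPE('f) \<and>
    (\<exists>J :: 'e \<Rightarrow> 'f \<Rightarrow> complex.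
      (\<forall>x y. J (x + y) = (\<lambda>v. J x v + J y v)) \<and>
      (\<forall>c x. J (scaleC c x) = (\<lambda>v. c * J x v)) \<and>
      homeomorphic_map euclidean strong_dual J)"


section \<open>Convolution operators on spaces of entire functions\<close>

text \<open>Holomorphic on a locally convex space: continuous and holomorphic along complex lines.\<close>

definition holomorphic_functions :: "('e::complex_lcs \<Rightarrow> complex) set"
  where "holomorphic_functions = {f. continuous_on UNIV f \<and>
    (\<forall>a b. (\<lambda>z. f (a + scaleC z b)) holomorphic_on UNIV)}"

definition compact_open_topology :: "('e::complex_lcs \<Rightarrow> complex) topology"
  where "compact_open_topology = uniform_convergence_topology {K. compact K} holomorphic_functions"

definition translation :: "'e::complex_lcs \<Rightarrow> ('e \<Rightarrow> complex) \<Rightarrow> 'e \<Rightarrow> complex"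
  where "translation a f = (\<lambda>x. f (x - a))"

text \<open>Only the values of \<open>L\<close> on \<open>holomorphic_functions\<close> matter, here and below.\<close>

definition convolution_operator :: "(('e::complex_lcs \<Rightarrow> complex) \<Rightarrow> 'e \<Rightarrow> complex) \<Rightarrow> bool"
  where "convolution_operator L \<longleftrightarrow>
    continuous_map compact_open_topology compact_open_topology L \<and>
    (\<forall>f\<in>holomorphic_functions. \<forall>g\<in>holomorphic_functions.
      L (\<lambda>x. f x + g x) = (\<lambda>x. L f x + L g x)) \<and>
    (\<forall>c. \<forall>f\<in>holomorphic_functions. L (\<lambda>x. c * f x) = (\<lambda>x. c * L f x)) \<and>
    (\<forall>f\<in>holomorphic_functions. \<forall>a. L (translation a f) = translation a (L f))"

definition nontrivial_operator :: "(('e::complex_lcs \<Rightarrow> complex) \<Rightarrow> 'e \<Rightarrow> complex) \<Rightarrow> bool"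
  where "nontrivial_operator L \<longleftrightarrow>
    \<not> (\<exists>c. \<forall>f\<in>holomorphic_functions. L f = (\<lambda>x. c * f x))"


section \<open>Mixing and hypercyclic operators\<close>

definition mixing :: "'x topology \<Rightarrow> ('x \<Rightarrow> 'x) \<Rightarrow> bool"
  where "mixing X T \<longleftrightarrow>
    (\<forall>U V. openin X U \<and> U \<noteq> {} \<and> openin X V \<and> V \<noteq> {} \<longrightarrow>
      (\<exists>n\<^sub>0. \<forall>n\<ge>n\<^sub>0. (T ^^ n) ` U \<inter> V \<noteq> {}))"

definition hypercyclic :: "'x topology \<Rightarrow> ('x \<Rightarrow> 'x) \<Rightarrow> bool"
  where "hypercyclic X T \<longleftrightarrow>
    (\<exists>x\<in>topspace X. X closure_of (range (\<lambda>n. (T ^^ n) x)) = topspace X)"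

end

theory Submission
  imports Defs "HOL-Complex_Analysis.Complex_Analysis"
begin

text \<open>
  Let \<open>E\<close> be a (DFN)-space and \<open>L\<close> a convolution operator. If \<open>\<eta>\<close> is a continuous linear
  functional, then \<open>exp \<eta>\<close> is an eigenvector of \<open>L\<close>, because translations multiply it by scalars
  and \<open>L\<close> commutes with translations (\<open>convolution_operator_exp\<close>). The eigenvalue \<open>symbol L \<eta>\<close> is
  an entire function on each complex line of functionals, and if \<open>L\<close> is nontrivial, Liouville's
  theorem shows that its modulus takes values below 1 and values above 1
  (\<open>symbol_small_and_large\<close>). The exponentials whose eigenvalues have modulus below 1 span a dense
  subspace, and so do those whose eigenvalues have modulus above 1 (\<open>exponentials_dense\<close>). On the
  first subspace the iterates of \<open>L\<close> tend to 0, on the second one they have right inverses that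
  tend to 0. Perturbing a function of the first kind by such a preimage of a function of the second
  kind gives mixing (\<open>convolution_operator_mixing_quantitative\<close>).

  The density of the exponentials needs an approximation of the identity of \<open>E\<close> by operators of
  finite rank, uniformly on compact sets. It reduces a holomorphic function to functions of
  finitely many functionals, which are approximated by polynomials one variable at a time
  (\<open>polynomial_density\<close>); polynomials are limits of combinations of exponentials, by
  differentiating exponentials along lines. The same theorem shows that countably many polynomials
  are dense (\<open>countable_dense_polynomials\<close>).

  For hypercyclicity, Birkhoff's transitivity argument requires the space of holomorphic functions
  to be a Baire space, which follows from completeness (\<open>compact_open_baire\<close>). Here \<open>E\<close> has to be the
  union of a sequence of compact sets that absorbs every compact set and determines continuity.

  These properties of \<open>E\<close> come from the space \<open>F\<close> of which it is the strong dual. Choose an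
  increasing fundamental sequence of seminorms on \<open>F\<close>; the polars of their balls exhaust \<open>E\<close>.
  Nuclearity of \<open>F\<close> expands the functionals in a polar into a uniformly convergent series of rank
  one terms (\<open>nuclear_expansion\<close>). This yields the approximation of the identity
  (\<open>countable_finite_rank_approximation\<close>), and with Tychonoff's theorem the compactness of the polars
  (\<open>polar_compact\<close>). The Banach-Dieudonne theorem (\<open>closed_if_closed_in_polars\<close>) shows that sets whose
  intersections with all polars are closed are themselves closed, from which both remaining
  properties of the exhaustion follow (\<open>polar_compact_exhaustion\<close>).
\<close>

section \<open>Continuous functionals and holomorphic functions\<close>

subclass (in complex_lcs) topological_ab_group_add ..

abbreviation \<H> :: "('e::complex_lcs \<Rightarrow> complex) set"
  where "\<H> \<equiv> holomorphic_functions"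

lemma continuous_on_scaleC:
  fixes g :: "'a::topological_space \<Rightarrow> 'e::complex_lcs"
  assumes "continuous_on S f" "continuous_on S g"
  shows "continuous_on S (\<lambda>x. scaleC (f x) (g x))"
  unfolding continuous_on_def
proof
  fix x assume x: "x \<in> S"
  have "((\<lambda>y. (f y, g y)) \<longlongrightarrow> (f x, g x)) (at x within S)"
    using assms x by (auto simp: continuous_on_def intro!: tendsto_Pair)
  then have "filterlim (\<lambda>y. (f y, g y)) (nhds (f x) \<times>\<^sub>F nhds (g x)) (at x within S)"
    by (simp add: nhds_prod)
  from filterlim_compose[OF tendsto_scaleC_Pair this]
  show "((\<lambda>y. scaleC (f y) (g y)) \<longlongrightarrow> scaleC (f x) (g x)) (at x within S)"
    by simp
qed

interpretation scaleC: vector_space "scaleC :: complex \<Rightarrow> 'a::complex_lcs \<Rightarrow> 'a"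
  by (rule vector_space_scaleC)

definition continuous_dual :: "('e::complex_lcs \<Rightarrow> complex) set"
  where "continuous_dual = {\<psi>. linear_functional \<psi> \<and> continuous_on UNIV \<psi>}"

lemma linear_functional_iff:
  "linear_functional \<psi> \<longleftrightarrow> (\<forall>x y. \<psi> (x + y) = \<psi> x + \<psi> y) \<and> (\<forall>c x. \<psi> (scaleC c x) = c * \<psi> x)"
proof
  assume "linear_functional \<psi>"
  then interpret Vector_Spaces.linear scaleC "(*)" \<psi> by (simp add: linear_functional_def)
  show "(\<forall>x y. \<psi> (x + y) = \<psi> x + \<psi> y) \<and> (\<forall>c x. \<psi> (scaleC c x) = c * \<psi> x)"
    by (simp add: add scale)
next
  assume *: "(\<forall>x y. \<psi> (x + y) = \<psi> x + \<psi> y) \<and> (\<forall>c x. \<psi> (scaleC c x) = c * \<psi> x)"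
  show "linear_functional \<psi>"
    unfolding linear_functional_def
    by unfold_locales (use * in \<open>auto simp: algebra_simps\<close>)
qed

lemma continuous_dual_iff:
  "\<psi> \<in> continuous_dual \<longleftrightarrow> continuous_on UNIV \<psi> \<and> (\<forall>x y. \<psi> (x + y) = \<psi> x + \<psi> y) \<and>
     (\<forall>c x. \<psi> (scaleC c x) = c * \<psi> x)"
  by (auto simp: continuous_dual_def linear_functional_iff)

lemma continuous_dual_combination:
  assumes "\<psi> \<in> continuous_dual" "\<eta> \<in> continuous_dual"
  shows "(\<lambda>x. \<psi> x + t * \<eta> x) \<in> continuous_dual"
  using assms by (auto simp: continuous_dual_iff algebra_simps intro!: continuous_intros)

lemma holomorphic_functions_continuous:
  "f \<in> \<H> \<Longrightarrow> continuous_on S f"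
  by (auto simp: holomorphic_functions_def intro: continuous_on_subset)

lemma holomorphic_functions_on_line:
  "f \<in> \<H> \<Longrightarrow> (\<lambda>z. f (a + scaleC z b)) holomorphic_on S"
  by (auto simp: holomorphic_functions_def intro: holomorphic_on_subset)

lemma holomorphic_functions_const: "(\<lambda>x. c) \<in> \<H>"
  by (auto simp: holomorphic_functions_def)

lemma holomorphic_functions_add:
  "f \<in> \<H> \<Longrightarrow> g \<in> \<H> \<Longrightarrow> (\<lambda>x. f x + g x) \<in> \<H>"
  by (auto simp: holomorphic_functions_def intro!: continuous_intros holomorphic_intros)

lemma holomorphic_functions_mult:
  "f \<in> \<H> \<Longrightarrow> g \<in> \<H> \<Longrightarrow> (\<lambda>x. f x * g x) \<in> \<H>"
  by (auto simp: holomorphic_functions_def intro!: continuous_intros holomorphic_intros)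

lemma holomorphic_functions_cmult:
  "f \<in> \<H> \<Longrightarrow> (\<lambda>x. c * f x) \<in> \<H>"
  by (intro holomorphic_functions_mult holomorphic_functions_const)

lemma holomorphic_functions_power:
  "f \<in> \<H> \<Longrightarrow> (\<lambda>x. f x ^ n) \<in> \<H>"
  by (auto simp: holomorphic_functions_def intro!: continuous_intros holomorphic_intros)

lemma holomorphic_functions_exp:
  "f \<in> \<H> \<Longrightarrow> (\<lambda>x. exp (f x)) \<in> \<H>"
  by (auto simp: holomorphic_functions_def intro!: continuous_intros holomorphic_intros)

lemma continuous_dual_imp_holomorphic:
  "\<psi> \<in> continuous_dual \<Longrightarrow> \<psi> \<in> \<H>"
  by (auto simp: holomorphic_functions_def continuous_dual_iff intro!: holomorphic_intros)

text \<open>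
  Affine changes of variable preserve holomorphy because they map complex lines to complex lines
  (or to points).
\<close>

lemma holomorphic_functions_affine:
  assumes g: "g \<in> \<H>" and T: "continuous_on UNIV T"
    and aff: "\<And>a b. \<exists>b'. \<forall>z. T (a + scaleC z b) = T a + scaleC z b'"
  shows "(\<lambda>x. g (T x)) \<in> \<H>"
proof -
  have "(\<lambda>z. g (T (a + scaleC z b))) holomorphic_on UNIV" for a b
    using aff[of a b] holomorphic_functions_on_line[OF g] by auto
  moreover have "continuous_on UNIV (\<lambda>x. g (T x))"
    by (rule continuous_on_compose2[OF holomorphic_functions_continuous[OF g, of UNIV] T]) auto
  ultimately show ?thesis
    by (simp add: holomorphic_functions_def)
qed

lemma holomorphic_functions_bounded_on_compact:
  assumes "f \<in> \<H>" "compact K"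
  obtains C where "C > 0" "\<And>x. x \<in> K \<Longrightarrow> cmod (f x) \<le> C"
proof -
  have "bounded (f ` K)"
    by (intro compact_imp_bounded compact_continuous_image holomorphic_functions_continuous assms)
  then show ?thesis
    using that by (auto simp: bounded_pos)
qed

section \<open>Interpolation at roots of unity\<close>

text \<open>
  On a disc, entire functions with a common bound on a disc four times as large are approximated
  by polynomials whose coefficients are fixed linear combinations of finitely many values of the
  function, with nodes and weights that do not depend on the function. This independence is the
  point: when \<open>u\<close> is the restriction of \<open>g\<close> to a line through \<open>x\<close>, the approximant is a sum of
  powers of the line parameter times translates \<open>g (x + \<zeta> j e)\<close>, which again depend
  holomorphically on \<open>x\<close>.
  
  The interpolation at the \<open>M\<close> points of modulus \<open>2 R\<close> with \<open>M\<close>-th power \<open>(2 R)\<^sup>M\<close> reproduces the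
  monomials of degree below \<open>M\<close>, by orthogonality of the characters of a cyclic group. On a
  monomial of degree \<open>m \<ge> M\<close> its error is at most \<open>3 (2 R)\<^sup>m\<close>, while Cauchy's inequality bounds
  the \<open>m\<close>-th Taylor coefficient by \<open>C / (4 R)\<^sup>m\<close>; the sum of the errors is at most
  \<open>6 C / 2\<^sup>M\<close>.
\<close>

lemma interpolation_at_roots_of_unity:
  fixes C R \<epsilon> :: real
  assumes R: "R > 0" and eps: "\<epsilon> > 0"
  obtains M :: nat and \<zeta> :: "nat \<Rightarrow> complex" and c :: "nat \<Rightarrow> nat \<Rightarrow> complex"
  where "\<And>u z. u holomorphic_on UNIV \<Longrightarrow> (\<And>w. cmod w \<le> 4 * R \<Longrightarrow> cmod (u w) \<le> C) \<Longrightarrow> cmod z \<le> R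
     \<Longrightarrow> cmod (u z - (\<Sum>j<M. (\<Sum>i<M. c j i * z ^ i) * u (\<zeta> j))) < \<epsilon>"
proof -
  have "(\<lambda>M. 6 * C * (1/2) ^ M) \<longlonglongrightarrow> 6 * C * 0"
    by (intro tendsto_intros LIMSEQ_power_zero) auto
  then have "\<forall>\<^sub>F M in sequentially. 6 * C * (1/2) ^ M < \<epsilon> \<and> M > 0"
    using eps by (intro eventually_conj eventually_gt_at_top) (auto simp: order_tendsto_iff)
  then obtain M :: nat where M: "6 * C * (1/2) ^ M < \<epsilon>" "M > 0"
    using eventually_happens'[OF sequentially_bot] by blast
  define r where "r = 2 * R"
  have r: "r > 0" using R by (simp add: r_def)
  (* The nodes are \<open>r * \<omega> j\<close>; \<open>E u z\<close> is the interpolation error at \<open>z\<close>. *)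
  define \<omega> where "\<omega> j = exp (2 * of_real pi * \<i> * of_nat j / of_nat M)" for j :: nat
  have \<omega>_pow: "\<omega> j ^ m = \<omega> m ^ j" for j m
    unfolding \<omega>_def exp_of_nat_mult[symmetric] by (simp add: field_simps)
  have \<omega>_norm [simp]: "cmod (\<omega> j) = 1" for j
    by (simp add: \<omega>_def)
  have \<omega>_M: "\<omega> j ^ M = 1" for j
    using complex_root_unity[of M j] M by (simp add: \<omega>_def)
  have \<omega>_1: "\<omega> m = \<omega> i \<longleftrightarrow> m = i" if "m < M" "i < M" for m i
    using complex_root_unity_eq[of M m i] M that by (simp add: \<omega>_def cong_def)
  define c where "c j i = 1 / (of_nat M * (of_real r * \<omega> j) ^ i)" for j i
  define \<zeta> where "\<zeta> j = of_real r * \<omega> j" for j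
  define E where "E u z = u z - (\<Sum>j<M. (\<Sum>i<M. c j i * z ^ i) * u (\<zeta> j))" for u :: "complex \<Rightarrow> complex" and z
  have Emono: "E (\<lambda>w. w ^ m) z = z ^ m - (\<Sum>i<M. of_real r ^ m * (z / of_real r) ^ i * ((\<Sum>j<M. (\<omega> m / \<omega> i) ^ j) / of_nat M))" for m z
  proof -
    have "(\<Sum>j<M. (\<Sum>i<M. c j i * z ^ i) * \<zeta> j ^ m) = (\<Sum>j<M. \<Sum>i<M. c j i * z ^ i * \<zeta> j ^ m)"
      by (simp add: sum_distrib_right)
    also have "\<dots> = (\<Sum>i<M. \<Sum>j<M. c j i * z ^ i * \<zeta> j ^ m)"
      by (rule sum.swap)
    also have "\<dots> = (\<Sum>i<M. \<Sum>j<M. of_real r ^ m * (z / of_real r) ^ i * ((\<omega> m / \<omega> i) ^ j / of_nat M))"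
    proof (intro sum.cong refl)
      fix i j
      have "\<omega> i ^ j = \<omega> j ^ i" "\<omega> m ^ j = \<omega> j ^ m" by (rule \<omega>_pow)+
      then show "c j i * z ^ i * \<zeta> j ^ m = of_real r ^ m * (z / of_real r) ^ i * ((\<omega> m / \<omega> i) ^ j / of_nat M)"
        by (simp add: c_def \<zeta>_def power_divide power_mult_distrib field_simps)
    qed
    finally show ?thesis
      by (simp add: E_def sum_distrib_left sum_divide_distrib)
  qed
  have low: "E (\<lambda>w. w ^ m) z = 0" if m: "m < M" for m z
  proof -
    have "(\<Sum>j<M. (\<omega> m / \<omega> i) ^ j) / of_nat M = (if i = m then 1 else 0)" if "i < M" for i
    proof (cases "i = m")
      case True
      have "\<omega> m \<noteq> 0" using \<omega>_norm[of m] by (metis norm_zero zero_neq_one)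
      then show ?thesis using True M by simp
    next
      case False
      have "\<omega> i \<noteq> 0" using \<omega>_norm[of i] by (metis norm_zero zero_neq_one)
      then have "\<omega> m / \<omega> i \<noteq> 1" using \<omega>_1[OF m that] False by auto
      then have "(\<Sum>j<M. (\<omega> m / \<omega> i) ^ j) = ((\<omega> m / \<omega> i) ^ M - 1) / (\<omega> m / \<omega> i - 1)"
        by (rule geometric_sum)
      also have "\<dots> = 0"
        by (simp add: power_divide \<omega>_M)
      finally show ?thesis using False by simp
    qed
    then have "E (\<lambda>w. w ^ m) z = z ^ m - (\<Sum>i<M. of_real r ^ m * (z / of_real r) ^ i * (if i = m then 1 else 0))"
      unfolding Emono by (intro arg_cong2[of _ _ _ _ "(-)"] sum.cong) auto
    also have "\<dots> = 0"
      using m r by (simp add: if_distrib cong: if_cong) (simp add: power_divide)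
    finally show ?thesis .
  qed
  have high: "cmod (E (\<lambda>w. w ^ m) z) \<le> 3 * r ^ m" if z: "cmod z \<le> R" for m z
  proof -
    have "cmod ((\<Sum>j<M. (\<omega> m / \<omega> i) ^ j) / of_nat M) \<le> 1" for i
    proof -
      have "cmod (\<Sum>j<M. (\<omega> m / \<omega> i) ^ j) \<le> (\<Sum>j<M. 1)"
        by (rule sum_norm_le) (simp add: norm_power norm_divide)
      then show ?thesis using M by (simp add: norm_divide)
    qed
    moreover have "cmod (z / of_real r) ^ i \<le> (1/2) ^ i" for i
      using z r by (intro power_mono) (auto simp: norm_divide r_def field_simps)
    ultimately have "cmod (of_real r ^ m * (z / of_real r) ^ i * ((\<Sum>j<M. (\<omega> m / \<omega> i) ^ j) / of_nat M))
        \<le> r ^ m * (1/2) ^ i * 1" for i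
      unfolding norm_mult norm_power using r by (intro mult_mono) auto
    then have "cmod (\<Sum>i<M. of_real r ^ m * (z / of_real r) ^ i * ((\<Sum>j<M. (\<omega> m / \<omega> i) ^ j) / of_nat M))
        \<le> (\<Sum>i<M. r ^ m * (1/2) ^ i * 1)"
      by (intro sum_norm_le) auto
    also have "\<dots> = r ^ m * (\<Sum>i<M. (1/2) ^ i)"
      by (simp add: sum_distrib_left)
    also have "\<dots> \<le> r ^ m * 2"
      using r by (intro mult_left_mono) (auto simp: geometric_sum)
    finally have "cmod (E (\<lambda>w. w ^ m) z) \<le> cmod (z ^ m) + r ^ m * 2"
      unfolding Emono by (intro order.trans[OF norm_triangle_ineq4] add_left_mono)
    moreover have "cmod (z ^ m) \<le> r ^ m"
      unfolding norm_power using z R by (intro power_mono) (auto simp: r_def)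
    ultimately show ?thesis by simp
  qed
  show thesis
  proof (rule that[where M=M and c=c and \<zeta>=\<zeta>])
    fix u z
    assume u: "u holomorphic_on UNIV" and C: "\<And>w. cmod w \<le> 4 * R \<Longrightarrow> cmod (u w) \<le> C" and z: "cmod z \<le> R"
    define a where "a m = (deriv ^^ m) u 0 / fact m" for m
    have sums: "(\<lambda>m. a m * w ^ m) sums u w" for w
      using holomorphic_power_series[of u 0 "cmod w + 1" w] holomorphic_on_subset[OF u]
      by (simp add: a_def)
    have a: "cmod (a m) \<le> C / (4 * R) ^ m" for m
    proof -
      have "cmod ((deriv ^^ m) u 0) \<le> fact m * C / (4 * R) ^ m"
        using R C holomorphic_on_subset[OF u] 
        by (intro Cauchy_inequality[where \<xi>=0]) (auto intro: holomorphic_on_imp_continuous_on)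
      then show ?thesis
        by (simp add: a_def norm_divide field_simps)
    qed
    have "(\<lambda>m. a m * z ^ m - (\<Sum>j<M. (\<Sum>i<M. c j i * z ^ i) * (a m * \<zeta> j ^ m))) sums E u z"
      unfolding E_def by (intro sums_diff sums_sum sums_mult sums)
    moreover have "a m * z ^ m - (\<Sum>j<M. (\<Sum>i<M. c j i * z ^ i) * (a m * \<zeta> j ^ m)) = a m * E (\<lambda>w. w ^ m) z" for m
      by (simp add: E_def algebra_simps sum_distrib_left)
    ultimately have sE: "(\<lambda>m. a m * E (\<lambda>w. w ^ m) z) sums E u z"
      by simp
    have "(\<lambda>m. a (m + M) * E (\<lambda>w. w ^ (m + M)) z) sums E u z"
      using sums_iff_shift[of "\<lambda>m. a m * E (\<lambda>w. w ^ m) z" M "E u z"] sE low by simp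
    moreover have bd: "cmod (a (m + M) * E (\<lambda>w. w ^ (m + M)) z) \<le> 3 * C * (1/2) ^ M * (1/2) ^ m" for m
    proof -
      have "cmod (a (m + M) * E (\<lambda>w. w ^ (m + M)) z) \<le> (C / (4 * R) ^ (m + M)) * (3 * r ^ (m + M))"
        unfolding norm_mult using a high[OF z] R C[of 0] by (intro mult_mono) (auto intro: order.trans[OF norm_ge_zero])
      also have "\<dots> = 3 * C * (r / (4 * R)) ^ (m + M)"
        by (simp add: power_divide)
      also have "r / (4 * R) = 1/2" using R by (simp add: r_def)
      finally show ?thesis by (simp add: power_add mult_ac)
    qed
    moreover have "(\<lambda>m. 3 * C * (1/2) ^ M * (1/2) ^ m) sums (3 * C * (1/2) ^ M * 2)"
      by (intro sums_mult) (use geometric_sums[of "1/2::real"] in simp)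
    ultimately have "cmod (E u z) \<le> 3 * C * (1/2) ^ M * 2"
      using norm_suminf_le[of "\<lambda>m. a (m + M) * E (\<lambda>w. w ^ (m + M)) z" "\<lambda>m. 3 * C * (1/2) ^ M * (1/2) ^ m"]
      by (auto simp: sums_iff)
    also have "\<dots> < \<epsilon>" using M by simp
    finally show "cmod (u z - (\<Sum>j<M. (\<Sum>i<M. c j i * z ^ i) * u (\<zeta> j))) < \<epsilon>"
      by (simp add: E_def)
  qed
qed

section \<open>Density of polynomials in continuous functionals\<close>

definition approximable :: "('e::complex_lcs \<Rightarrow> complex) set \<Rightarrow> ('e \<Rightarrow> complex) \<Rightarrow> bool"
  where "approximable A f \<longleftrightarrow> (\<forall>K \<epsilon>. compact K \<longrightarrow> \<epsilon> > 0 \<longrightarrow> (\<exists>g\<in>A. \<forall>x\<in>K. cmod (g x - f x) < \<epsilon>))"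

definition compact_open_closed :: "('e::complex_lcs \<Rightarrow> complex) set \<Rightarrow> bool"
  where "compact_open_closed A \<longleftrightarrow> A \<subseteq> \<H> \<and>
    (\<forall>f\<in>\<H>. approximable A f \<longrightarrow> f \<in> A)"

definition compact_open_closure :: "('e::complex_lcs \<Rightarrow> complex) set \<Rightarrow> ('e \<Rightarrow> complex) set"
  where "compact_open_closure A = {f\<in>\<H>. approximable A f}"

lemma approximableD:
  assumes "approximable A f" "compact K" "\<epsilon> > 0"
  obtains g where "g \<in> A" "\<And>x. x \<in> K \<Longrightarrow> cmod (g x - f x) < \<epsilon>"
proof -
  from assms have "\<exists>g\<in>A. \<forall>x\<in>K. cmod (g x - f x) < \<epsilon>"
    by (simp add: approximable_def)
  then show thesis using that by auto
qed

lemma compact_open_closureD: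
  assumes "f \<in> compact_open_closure A"
  shows "f \<in> \<H>" "approximable A f"
  using assms by (auto simp: compact_open_closure_def)

lemma approximable_member: "f \<in> A \<Longrightarrow> approximable A f"
  by (force simp: approximable_def)

lemma compact_open_closure_superset:
  "A \<subseteq> \<H> \<Longrightarrow> A \<subseteq> compact_open_closure A"
  by (auto simp: compact_open_closure_def approximable_member)

lemma compact_open_closed_closure:
  fixes A :: "('e::complex_lcs \<Rightarrow> complex) set"
  shows "compact_open_closed (compact_open_closure A)"
  unfolding compact_open_closed_def
proof (intro conjI ballI impI)
  show "compact_open_closure A \<subseteq> \<H>"
    by (auto simp: compact_open_closure_def)
next
  fix f :: "'e \<Rightarrow> complex" assume f: "f \<in> \<H>" "approximable (compact_open_closure A) f"
  have "approximable A f"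
    unfolding approximable_def
  proof (intro allI impI)
    fix K :: "'e set" and \<epsilon> :: real assume K: "compact K" "\<epsilon> > 0"
    obtain g where g: "g \<in> compact_open_closure A" "\<And>x. x \<in> K \<Longrightarrow> cmod (g x - f x) < \<epsilon>/2"
      by (rule approximableD[OF f(2), of K "\<epsilon>/2"]) (use K in auto)
    obtain h where h: "h \<in> A" "\<And>x. x \<in> K \<Longrightarrow> cmod (h x - g x) < \<epsilon>/2"
      by (rule approximableD[OF compact_open_closureD(2)[OF g(1)], of K "\<epsilon>/2"]) (use K in auto)
    have "cmod (h x - f x) < \<epsilon>" if "x \<in> K" for x
      using g(2)[OF that] h(2)[OF that] norm_triangle_ineq[of "h x - g x" "g x - f x"] by simp
    then show "\<exists>g\<in>A. \<forall>x\<in>K. cmod (g x - f x) < \<epsilon>" using h(1) by blast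
  qed
  then show "f \<in> compact_open_closure A"
    using f by (simp add: compact_open_closure_def)
qed

lemma compact_open_closure_add:
  fixes A :: "('e::complex_lcs \<Rightarrow> complex) set"
  assumes add: "\<And>f g. f \<in> A \<Longrightarrow> g \<in> A \<Longrightarrow> (\<lambda>x. f x + g x) \<in> A"
    and f: "f \<in> compact_open_closure A" and g: "g \<in> compact_open_closure A"
  shows "(\<lambda>x. f x + g x) \<in> compact_open_closure A"
proof -
  have "approximable A (\<lambda>x. f x + g x)"
    unfolding approximable_def
  proof (intro allI impI)
    fix K :: "'e set" and \<epsilon> :: real assume K: "compact K" "\<epsilon> > 0"
    obtain f' where f': "f' \<in> A" "\<And>x. x \<in> K \<Longrightarrow> cmod (f' x - f x) < \<epsilon>/2"
      by (rule approximableD[OF compact_open_closureD(2)[OF f], of K "\<epsilon>/2"]) (use K in auto)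
    obtain g' where g': "g' \<in> A" "\<And>x. x \<in> K \<Longrightarrow> cmod (g' x - g x) < \<epsilon>/2"
      by (rule approximableD[OF compact_open_closureD(2)[OF g], of K "\<epsilon>/2"]) (use K in auto)
    have "cmod ((f' x + g' x) - (f x + g x)) < \<epsilon>" if "x \<in> K" for x
      using f'(2)[OF that] g'(2)[OF that] norm_triangle_ineq[of "f' x - f x" "g' x - g x"]
      by (simp add: algebra_simps)
    then show "\<exists>h\<in>A. \<forall>x\<in>K. cmod (h x - (f x + g x)) < \<epsilon>"
      using add[OF f'(1) g'(1)] by (intro bexI[of _ "\<lambda>x. f' x + g' x"]) auto
  qed
  then show ?thesis using f g by (simp add: compact_open_closure_def holomorphic_functions_add)
qed

text \<open>
  Multiplication by a fixed holomorphic function is continuous, since that function is bounded on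
  each compact set; so a closed set that contains the products with all members of \<open>A\<close> also
  contains the products with the limits of \<open>A\<close>.
\<close>

lemma compact_open_closed_mult:
  fixes A :: "('e::complex_lcs \<Rightarrow> complex) set"
  assumes S: "compact_open_closed S" and f: "f \<in> \<H>" "approximable A f"
    and h: "h \<in> \<H>" and mult: "\<And>g. g \<in> A \<Longrightarrow> (\<lambda>x. h x * g x) \<in> S"
  shows "(\<lambda>x. h x * f x) \<in> S"
proof -
  have "approximable S (\<lambda>x. h x * f x)"
    unfolding approximable_def
  proof (intro allI impI)
    fix K :: "'e set" and \<epsilon> :: real assume K: "compact K" "\<epsilon> > 0"
    obtain C where C: "C > 0" "\<And>x. x \<in> K \<Longrightarrow> cmod (h x) \<le> C"
      using holomorphic_functions_bounded_on_compact[OF h K(1)] by blast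
    obtain g where g: "g \<in> A" "\<And>x. x \<in> K \<Longrightarrow> cmod (g x - f x) < \<epsilon> / C"
      by (rule approximableD[OF f(2), of K "\<epsilon> / C"]) (use K C(1) in auto)
    have "cmod (h x * g x - h x * f x) < \<epsilon>" if "x \<in> K" for x
    proof -
      have "cmod (h x * g x - h x * f x) = cmod (h x) * cmod (g x - f x)"
        by (simp flip: norm_mult add: algebra_simps)
      also have "\<dots> \<le> C * cmod (g x - f x)"
        using C(2) that by (intro mult_right_mono) auto
      also have "\<dots> < \<epsilon>"
        using g(2)[OF that] C(1) by (simp add: field_simps)
      finally show ?thesis .
    qed
    then show "\<exists>g\<in>S. \<forall>x\<in>K. cmod (g x - h x * f x) < \<epsilon>"
      using mult[OF g(1)] by (intro bexI[of _ "\<lambda>x. h x * g x"]) auto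
  qed
  then show ?thesis
    using S holomorphic_functions_mult[OF h f(1)] by (simp add: compact_open_closed_def)
qed

text \<open>
  The identity is a limit, uniformly on compact sets, of operators of finite rank with
  coefficient functionals from \<open>\<Psi>\<close>. This is the only trace of nuclearity in the density
  theorems below. The choice of the approximating operator may depend on the compact set.
\<close>

definition finite_rank_approximation :: "('e::complex_lcs \<Rightarrow> complex) set \<Rightarrow> bool"
  where "finite_rank_approximation \<Psi> \<longleftrightarrow> \<Psi> \<subseteq> continuous_dual \<and>
    (\<forall>K U. compact K \<longrightarrow> open U \<longrightarrow> 0 \<in> U \<longrightarrow>
      (\<exists>(N::nat) \<psi> e. (\<forall>k. \<psi> k \<in> \<Psi>) \<and> (\<forall>x\<in>K. (\<Sum>k<N. scaleC (\<psi> k x) (e k)) - x \<in> U)))"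

text \<open>
  A continuous function is uniformly continuous at the points of a compact set, even with
  respect to increments that leave this set: apply the tube lemma to \<open>{0} \<times> K\<close>.
\<close>

lemma uniformly_continuous_near_compact:
  fixes f :: "'e::complex_lcs \<Rightarrow> complex"
  assumes f: "continuous_on UNIV f" and K: "compact K" and eps: "\<epsilon> > 0"
  obtains U where "open U" "0 \<in> U" "\<And>x y. x \<in> K \<Longrightarrow> y - x \<in> U \<Longrightarrow> cmod (f y - f x) < \<epsilon>"
proof -
  define W where "W = {p::'e\<times>'e. cmod (f (snd p + fst p) - f (snd p)) < \<epsilon>}"
  have "open W"
    unfolding W_def
    by (intro open_Collect_less continuous_intros continuous_on_compose2[OF f]) auto
  moreover have "{0} \<times> K \<subseteq> W" using eps by (auto simp: W_def)
  ultimately have "\<exists>U. 0 \<in> U \<and> open U \<and> U \<times> K \<subseteq> W"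
    by (rule Elementary_Topology.tube_lemma[OF K])
  then obtain U where U: "open U" "0 \<in> U" "U \<times> K \<subseteq> W"
    by blast
  show thesis
  proof (rule that[OF U(1,2)])
    fix x y assume "x \<in> K" "y - x \<in> U"
    then have "(y - x, x) \<in> W" using U(3) by blast
    then show "cmod (f y - f x) < \<epsilon>" by (simp add: W_def)
  qed
qed

text \<open>
  A closed set of holomorphic functions with the closure properties of the algebra generated by
  \<open>\<Psi>\<close> contains every holomorphic function. By the approximation property it suffices to treat
  functions \<open>g (\<Sum>k<N. \<psi> k x \<cdot> e k)\<close> of finitely many functionals. These are handled by induction
  on \<open>N\<close>, one variable at a time: interpolation in the last variable writes such a function, up to
  a small error on a compact set, as a sum of powers of \<open>\<psi> N\<close> times functions of the same form with
  one functional fewer and another base point. The base point \<open>b\<close> is therefore part of the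
  induction.
\<close>

theorem polynomial_density:
  fixes A :: "('e::complex_lcs \<Rightarrow> complex) set"
  assumes appr: "finite_rank_approximation \<Psi>" and A: "compact_open_closed A"
    and const: "\<And>c. (\<lambda>x. c) \<in> A"
    and add: "\<And>f g. f \<in> A \<Longrightarrow> g \<in> A \<Longrightarrow> (\<lambda>x. f x + g x) \<in> A"
    and cmult: "\<And>c f. f \<in> A \<Longrightarrow> (\<lambda>x. c * f x) \<in> A"
    and mult: "\<And>\<psi> f. \<psi> \<in> \<Psi> \<Longrightarrow> f \<in> A \<Longrightarrow> (\<lambda>x. \<psi> x * f x) \<in> A"
  shows "A = \<H>"
proof
  show "A \<subseteq> \<H>" using A by (simp add: compact_open_closed_def)
next
  have sum: "(\<lambda>x. \<Sum>i\<in>I. f i x) \<in> A" if "finite I" "\<And>i. i \<in> I \<Longrightarrow> f i \<in> A" for I :: "nat set" and f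
    using that by (induction I rule: finite_induct) (simp_all add: const add)
  have poly: "(\<lambda>x. (\<Sum>i<M. c i * \<psi> x ^ i) * f x) \<in> A" if "\<psi> \<in> \<Psi>" "f \<in> A" for \<psi> f c and M :: nat
  proof -
    have "(\<lambda>x. \<psi> x ^ i * f x) \<in> A" for i
      by (induction i) (use that mult in \<open>auto simp: mult.assoc\<close>)
    then have "(\<lambda>x. \<Sum>i<M. c i * (\<psi> x ^ i * f x)) \<in> A"
      by (intro sum cmult) auto
    then show ?thesis by (simp add: sum_distrib_right mult.assoc)
  qed
  have approx: "f \<in> A" if "f \<in> \<H>" "approximable A f" for f
    using A that by (auto simp: compact_open_closed_def)
  have dual: "\<psi> \<in> continuous_dual" if "\<psi> \<in> \<Psi>" for \<psi>
    using appr that by (auto simp: finite_rank_approximation_def)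
  have fin: "(\<lambda>x. g (b + (\<Sum>k<N. scaleC (\<psi> k x) (e k)))) \<in> A"
    if g: "g \<in> \<H>" and \<psi>: "\<And>k. \<psi> k \<in> \<Psi>" for g \<psi> e b and N :: nat
  proof (induction N arbitrary: b)
    case 0
    then show ?case by (simp add: const)
  next
    case (Suc N)
    define s where "s x = b + (\<Sum>k<N. scaleC (\<psi> k x) (e k))" for x
    have cont\<psi>: "continuous_on S (\<psi> k)" for k S
      using dual[OF \<psi>] continuous_on_subset[of UNIV "\<psi> k" S] by (auto simp: continuous_dual_iff)
    have lin\<psi>: "\<psi> k (x + y) = \<psi> k x + \<psi> k y" "\<psi> k (scaleC c x) = c * \<psi> k x" for k x y c
      using dual[OF \<psi>] by (auto simp: continuous_dual_iff)
    have conts: "continuous_on S s" for S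
      unfolding s_def by (intro continuous_intros continuous_on_scaleC cont\<psi>)
    have hol: "(\<lambda>x. g (b + (\<Sum>k<Suc N. scaleC (\<psi> k x) (e k)))) \<in> \<H>"
    proof (rule holomorphic_functions_affine[OF g])
      show "continuous_on UNIV (\<lambda>x. b + (\<Sum>k<Suc N. scaleC (\<psi> k x) (e k)))"
        by (intro continuous_intros continuous_on_scaleC cont\<psi>)
      fix a c
      show "\<exists>b'. \<forall>z. b + (\<Sum>k<Suc N. scaleC (\<psi> k (a + scaleC z c)) (e k)) =
          b + (\<Sum>k<Suc N. scaleC (\<psi> k a) (e k)) + scaleC z b'"
        by (intro exI[of _ "\<Sum>k<Suc N. scaleC (\<psi> k c) (e k)"])
          (simp add: lin\<psi> scaleC_add_left scaleC.scale_sum_right sum.distrib scaleC_scaleC scaleC_add_right)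
    qed
    have "approximable A (\<lambda>x. g (b + (\<Sum>k<Suc N. scaleC (\<psi> k x) (e k))))"
      unfolding approximable_def
    proof (intro allI impI)
      fix K :: "'e set" and \<epsilon> :: real
      assume K: "compact K" and eps: "\<epsilon> > 0"
      obtain R where R: "R > 0" "\<And>x. x \<in> K \<Longrightarrow> cmod (\<psi> N x) \<le> R"
        using holomorphic_functions_bounded_on_compact[OF continuous_dual_imp_holomorphic[OF dual[OF \<psi>]] K] by blast
      define Q where "Q = (\<lambda>p. s (fst p) + scaleC (snd p) (e N)) ` (K \<times> cball 0 (4 * R))"
      have "compact Q"
        unfolding Q_def
        by (intro compact_continuous_image compact_Times K compact_cball continuous_intros
            continuous_on_scaleC continuous_on_compose2[OF conts]) auto
      then obtain C where C: "\<And>y. y \<in> Q \<Longrightarrow> cmod (g y) \<le> C"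
        using holomorphic_functions_bounded_on_compact[OF g] by blast
      obtain M :: nat and \<zeta> c where
        *: "\<And>u z. u holomorphic_on UNIV \<Longrightarrow> (\<And>w. cmod w \<le> 4 * R \<Longrightarrow> cmod (u w) \<le> C) \<Longrightarrow> cmod z \<le> R
          \<Longrightarrow> cmod (u z - (\<Sum>j<M. (\<Sum>i<M. c j i * z ^ i) * u (\<zeta> j))) < \<epsilon>"
        by (rule interpolation_at_roots_of_unity[OF R(1) eps, of C]) blast
      define h where "h x = (\<Sum>j<M. (\<Sum>i<M. c j i * \<psi> N x ^ i) * g (s x + scaleC (\<zeta> j) (e N)))" for x
      have "(\<lambda>x. g (s x + scaleC (\<zeta> j) (e N))) \<in> A" for j
      proof -
        have "s x + scaleC (\<zeta> j) (e N) = b + scaleC (\<zeta> j) (e N) + (\<Sum>k<N. scaleC (\<psi> k x) (e k))" for x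
          by (simp add: s_def algebra_simps)
        then show ?thesis using Suc.IH by presburger
      qed
      then have "h \<in> A"
        unfolding h_def by (intro sum poly \<psi>) auto
      moreover have "cmod (h x - g (b + (\<Sum>k<Suc N. scaleC (\<psi> k x) (e k)))) < \<epsilon>" if x: "x \<in> K" for x
      proof -
        have "s x + scaleC w (e N) \<in> Q" if "cmod w \<le> 4 * R" for w
          unfolding Q_def using x that by (intro image_eqI[of _ _ "(x, w)"]) auto
        then have "cmod (g (s x + scaleC (\<psi> N x) (e N)) - h x) < \<epsilon>"
          unfolding h_def by (intro * C R(2) x holomorphic_functions_on_line g)
        moreover have "s x + scaleC (\<psi> N x) (e N) = b + (\<Sum>k<Suc N. scaleC (\<psi> k x) (e k))"
          by (simp add: s_def add.assoc)
        ultimately show ?thesis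
          by (simp add: norm_minus_commute)
      qed
      ultimately show "\<exists>h\<in>A. \<forall>x\<in>K. cmod (h x - g (b + (\<Sum>k<Suc N. scaleC (\<psi> k x) (e k)))) < \<epsilon>"
        by blast
    qed
    with hol show ?case by (rule approx)
  qed
  show "\<H> \<subseteq> A"
  proof
    fix g :: "'e \<Rightarrow> complex" assume g: "g \<in> \<H>"
    have "approximable A g"
      unfolding approximable_def
    proof (intro allI impI)
      fix K :: "'e set" and \<epsilon> :: real
      assume K: "compact K" and eps: "\<epsilon> > 0"
      obtain U where U: "open U" "0 \<in> U" "\<And>x y. x \<in> K \<Longrightarrow> y - x \<in> U \<Longrightarrow> cmod (g y - g x) < \<epsilon>"
        by (rule uniformly_continuous_near_compact[OF holomorphic_functions_continuous[OF g] K eps]) (rule that)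
      have "\<exists>(N::nat) \<psi> e. (\<forall>k. \<psi> k \<in> \<Psi>) \<and> (\<forall>x\<in>K. (\<Sum>k<N. scaleC (\<psi> k x) (e k)) - x \<in> U)"
        using appr K U(1,2) by (simp add: finite_rank_approximation_def)
      then obtain N :: nat and \<psi> e where N: "\<forall>k. \<psi> k \<in> \<Psi>" "\<forall>x\<in>K. (\<Sum>k<N. scaleC (\<psi> k x) (e k)) - x \<in> U"
        by (elim exE conjE)
      show "\<exists>h\<in>A. \<forall>x\<in>K. cmod (h x - g x) < \<epsilon>"
      proof (rule bexI)
        show "(\<lambda>x. g (0 + (\<Sum>k<N. scaleC (\<psi> k x) (e k)))) \<in> A"
          using N(1) by (intro fin g) simp
        show "\<forall>x\<in>K. cmod (g (0 + (\<Sum>k<N. scaleC (\<psi> k x) (e k))) - g x) < \<epsilon>"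
          using U(3) N(2) by simp
      qed
    qed
    with g show "g \<in> A" by (rule approx)
  qed
qed

section \<open>Density of exponentials\<close>

lemma exp_remainder:
  assumes "cmod w \<le> N"
  shows "cmod (exp w - (\<Sum>i\<le>n. w ^ i / fact i)) \<le> exp N * N ^ Suc n / fact n"
proof -
  have "cmod (exp w - (\<Sum>i\<le>n. w ^ i / fact i)) \<le> exp (cmod w) * cmod w ^ Suc n / fact n"
    by (rule Taylor_exp_field[THEN order.trans]) simp
  also have "\<dots> \<le> exp N * N ^ Suc n / fact n"
    using assms by (intro divide_right_mono mult_mono power_mono) auto
  finally show ?thesis .
qed

lemma exp_remainder_tendsto_0: "(\<lambda>n. exp N * N ^ Suc n / fact n) \<longlonglongrightarrow> (0::real)"
proof -
  have "(\<lambda>n. N ^ n /\<^sub>R fact n) \<longlonglongrightarrow> 0"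
    using summable_exp_generic[of N] by (rule summable_LIMSEQ_zero)
  then have "(\<lambda>n. exp N * N * (N ^ n /\<^sub>R fact n)) \<longlonglongrightarrow> exp N * N * 0"
    by (intro tendsto_intros)
  then show ?thesis by (simp add: field_simps)
qed

text \<open>
  The Taylor coefficients at \<open>t = 0\<close> of the curve \<open>t \<mapsto> g \<cdot> exp (t \<theta>)\<close> lie in each closed
  subspace that contains the curve for small \<open>t\<close>. Indeed, once the coefficients of order less than
  \<open>k\<close> are known to lie there, the \<open>k\<close>-th one is the limit of the curve minus its Taylor polynomial of
  degree \<open>k - 1\<close>, divided by \<open>t ^ k\<close>.
\<close>

lemma exp_line_taylor_coeff:
  fixes S :: "('e::complex_lcs \<Rightarrow> complex) set"
  assumes S: "compact_open_closed S"
    and add: "\<And>f g. f \<in> S \<Longrightarrow> g \<in> S \<Longrightarrow> (\<lambda>x. f x + g x) \<in> S"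
    and cmult: "\<And>c f. f \<in> S \<Longrightarrow> (\<lambda>x. c * f x) \<in> S"
    and g: "g \<in> \<H>" and \<theta>: "\<theta> \<in> continuous_dual"
    and \<delta>: "\<delta> > 0" "\<And>t. cmod t < \<delta> \<Longrightarrow> (\<lambda>x. g x * exp (t * \<theta> x)) \<in> S"
  shows "(\<lambda>x. g x * \<theta> x ^ k) \<in> S"
proof (induction k rule: less_induct)
  case (less k)
  have g0: "g \<in> S" using \<delta>(2)[of 0] \<delta>(1) by simp
  have zero: "(\<lambda>x. 0) \<in> S" using cmult[OF g0, of 0] by simp
  have sum: "(\<lambda>x. \<Sum>i\<in>I. f i x) \<in> S" if "finite I" "\<And>i. i \<in> I \<Longrightarrow> f i \<in> S" for I :: "nat set" and f
    using that by (induction I rule: finite_induct) (simp_all add: zero add)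
  have "approximable S (\<lambda>x. g x * \<theta> x ^ k / fact k)"
    unfolding approximable_def
  proof (intro allI impI)
    fix K :: "'e set" and \<epsilon> :: real
    assume K: "compact K" and eps: "\<epsilon> > 0"
    obtain C where C: "C > 0" "\<And>x. x \<in> K \<Longrightarrow> cmod (g x) \<le> C"
      by (rule holomorphic_functions_bounded_on_compact[OF g K]) (rule that)
    obtain N where N: "N > 0" "\<And>x. x \<in> K \<Longrightarrow> cmod (\<theta> x) \<le> N"
      by (rule holomorphic_functions_bounded_on_compact[OF continuous_dual_imp_holomorphic[OF \<theta>] K]) (rule that)
    define D where "D = C * (exp N * N ^ Suc k)"
    have D: "D > 0" using C(1) N(1) by (simp add: D_def)
    (* The remainder of the exponential series gives an error of at most \<open>t * D\<close> for \<open>t \<le> 1\<close>. *)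
    define t where "t = min (min 1 (\<delta> / 2)) (\<epsilon> / (2 * D))"
    have t: "t > 0" "t \<le> 1" "t < \<delta>" "t * D < \<epsilon>"
    proof -
      show "t > 0" "t \<le> 1" "t < \<delta>" using \<delta>(1) eps D by (auto simp: t_def)
      have "t * D \<le> \<epsilon> / (2 * D) * D" using D by (intro mult_right_mono) (auto simp: t_def)
      also have "\<dots> < \<epsilon>" using D eps by simp
      finally show "t * D < \<epsilon>" .
    qed
    define T where "T = complex_of_real t"
    have T: "T \<noteq> 0" "cmod T = t" using t(1) by (auto simp: T_def)
    (* The curve minus its Taylor polynomial of degree \<open>k - 1\<close>, divided by \<open>T ^ k\<close>. *)
    define r where "r x = inverse (T ^ k) * (g x * exp (T * \<theta> x) + (\<Sum>i<k. (- (T ^ i) / fact i) * (g x * \<theta> x ^ i)))" for x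
    have "r \<in> S"
      unfolding r_def using t T less by (intro cmult add sum \<delta>(2)) auto
    moreover have "cmod (r x - g x * \<theta> x ^ k / fact k) < \<epsilon>" if x: "x \<in> K" for x
    proof -
      define s where "s = (\<Sum>i<k. (T * \<theta> x) ^ i / fact i)"
      have s1: "(\<Sum>i\<le>k. (T * \<theta> x) ^ i / fact i) = s + T ^ k * \<theta> x ^ k / fact k"
        by (simp add: lessThan_Suc_atMost[symmetric] s_def power_mult_distrib)
      have s2: "(\<Sum>i<k. (- (T ^ i) / fact i) * (g x * \<theta> x ^ i)) = - (g x * s)"
        unfolding s_def sum_distrib_left sum_negf[symmetric]
        by (intro sum.cong) (auto simp: power_mult_distrib)
      have "r x - g x * \<theta> x ^ k / fact k = g x * (exp (T * \<theta> x) - (\<Sum>i\<le>k. (T * \<theta> x) ^ i / fact i)) / T ^ k"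
        unfolding r_def s1 s2 using T(1) by (simp add: field_simps)
      also have "cmod \<dots> = cmod (g x) * cmod (exp (T * \<theta> x) - (\<Sum>i\<le>k. (T * \<theta> x) ^ i / fact i)) / t ^ k"
        by (simp add: norm_mult norm_divide norm_power T)
      also have "\<dots> \<le> C * (exp (t * N) * (t * N) ^ Suc k / fact k) / t ^ k"
        using t C N(1) N(2)[OF x] C(2)[OF x]
        by (intro divide_right_mono mult_mono exp_remainder) (auto simp: norm_mult T)
      also have "\<dots> = t * (C * (exp (t * N) * N ^ Suc k)) / fact k"
        using t(1) by (simp add: power_mult_distrib field_simps)
      also have "\<dots> \<le> t * (C * (exp (t * N) * N ^ Suc k)) / 1"
        using t(1) C(1) N(1) by (intro divide_left_mono) (auto simp: fact_ge_1)
      also have "\<dots> \<le> t * D"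
        unfolding D_def div_by_1 using t C(1) N(1)
        by (intro mult_left_mono mult_right_mono) (auto simp: mult_le_cancel_right1)
      also have "\<dots> < \<epsilon>" by (rule t(4))
      finally show ?thesis .
    qed
    ultimately show "\<exists>h\<in>S. \<forall>x\<in>K. cmod (h x - g x * \<theta> x ^ k / fact k) < \<epsilon>" by blast
  qed
  moreover have "(\<lambda>x. g x * \<theta> x ^ k / fact k) \<in> \<H>"
    using holomorphic_functions_cmult[OF holomorphic_functions_mult[OF g
      holomorphic_functions_power[OF continuous_dual_imp_holomorphic[OF \<theta>]]], of "1 / fact k" k] by simp
  ultimately have "(\<lambda>x. g x * \<theta> x ^ k / fact k) \<in> S"
    using S by (simp add: compact_open_closed_def)
  from cmult[OF this, of "fact k"] show ?case by simp
qed

text \<open>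
  A principle of analytic continuation: the exponential series converges for every \<open>t\<close>, uniformly
  on compact sets, so the whole curve lies in the closed subspace generated by its Taylor
  coefficients.
\<close>

lemma exp_line_closed:
  fixes S :: "('e::complex_lcs \<Rightarrow> complex) set"
  assumes S: "compact_open_closed S"
    and add: "\<And>f g. f \<in> S \<Longrightarrow> g \<in> S \<Longrightarrow> (\<lambda>x. f x + g x) \<in> S"
    and cmult: "\<And>c f. f \<in> S \<Longrightarrow> (\<lambda>x. c * f x) \<in> S"
    and g: "g \<in> \<H>" and \<theta>: "\<theta> \<in> continuous_dual"
    and \<delta>: "\<delta> > 0" "\<And>t. cmod t < \<delta> \<Longrightarrow> (\<lambda>x. g x * exp (t * \<theta> x)) \<in> S"
  shows "(\<lambda>x. g x * exp (t * \<theta> x)) \<in> S"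
proof -
  have coeff: "(\<lambda>x. g x * \<theta> x ^ k) \<in> S" for k
    by (rule exp_line_taylor_coeff[OF assms])
  have zero: "(\<lambda>x. 0) \<in> S" using cmult[OF coeff, of 0] by simp
  have sum: "(\<lambda>x. \<Sum>i\<in>I. f i x) \<in> S" if "finite I" "\<And>i. i \<in> I \<Longrightarrow> f i \<in> S" for I :: "nat set" and f
    using that by (induction I rule: finite_induct) (simp_all add: zero add)
  have "approximable S (\<lambda>x. g x * exp (t * \<theta> x))"
    unfolding approximable_def
  proof (intro allI impI)
    fix K :: "'e set" and \<epsilon> :: real
    assume K: "compact K" and eps: "\<epsilon> > 0"
    obtain C where C: "C > 0" "\<And>x. x \<in> K \<Longrightarrow> cmod (g x) \<le> C"
      by (rule holomorphic_functions_bounded_on_compact[OF g K]) (rule that)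
    obtain N where N: "N > 0" "\<And>x. x \<in> K \<Longrightarrow> cmod (t * \<theta> x) \<le> N"
      by (rule holomorphic_functions_bounded_on_compact[OF
            holomorphic_functions_cmult[OF continuous_dual_imp_holomorphic[OF \<theta>], of t] K]) (rule that)
    have "(\<lambda>n. C * (exp N * N ^ Suc n / fact n)) \<longlonglongrightarrow> C * 0"
      by (intro tendsto_mult tendsto_const exp_remainder_tendsto_0)
    then have "\<forall>\<^sub>F n in sequentially. C * (exp N * N ^ Suc n / fact n) < \<epsilon>"
      using eps by (intro order_tendstoD) auto
    then obtain n where n: "C * (exp N * N ^ Suc n / fact n) < \<epsilon>"
      by (auto simp: eventually_sequentially)
    have "(\<lambda>x. \<Sum>i\<le>n. (t ^ i / fact i) * (g x * \<theta> x ^ i)) \<in> S"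
      by (intro sum cmult coeff) auto
    moreover have "cmod ((\<Sum>i\<le>n. (t ^ i / fact i) * (g x * \<theta> x ^ i)) - g x * exp (t * \<theta> x)) < \<epsilon>" if x: "x \<in> K" for x
    proof -
      have "(\<Sum>i\<le>n. (t ^ i / fact i) * (g x * \<theta> x ^ i)) = g x * (\<Sum>i\<le>n. (t * \<theta> x) ^ i / fact i)"
        unfolding sum_distrib_left by (intro sum.cong) (auto simp: power_mult_distrib)
      then have "cmod ((\<Sum>i\<le>n. (t ^ i / fact i) * (g x * \<theta> x ^ i)) - g x * exp (t * \<theta> x))
          = cmod (g x) * cmod (exp (t * \<theta> x) - (\<Sum>i\<le>n. (t * \<theta> x) ^ i / fact i))"
        by (simp flip: right_diff_distrib add: norm_mult norm_minus_commute)
      also have "\<dots> \<le> C * (exp N * N ^ Suc n / fact n)"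
        using C N x by (intro mult_mono exp_remainder) auto
      finally show ?thesis using n by simp
    qed
    ultimately show "\<exists>h\<in>S. \<forall>x\<in>K. cmod (h x - g x * exp (t * \<theta> x)) < \<epsilon>"
      by (intro bexI) auto
  qed
  moreover have "(\<lambda>x. g x * exp (t * \<theta> x)) \<in> \<H>"
    by (intro holomorphic_functions_mult g holomorphic_functions_exp holomorphic_functions_cmult
        continuous_dual_imp_holomorphic \<theta>)
  ultimately show ?thesis
    using S by (simp add: compact_open_closed_def)
qed

inductive_set exp_span :: "('e \<Rightarrow> complex) set \<Rightarrow> ('e \<Rightarrow> complex) set" for W where
  zero: "(\<lambda>x. 0) \<in> exp_span W"
| step: "\<eta> \<in> W \<Longrightarrow> f \<in> exp_span W \<Longrightarrow> (\<lambda>x. c * exp (\<eta> x) + f x) \<in> exp_span W"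

lemma exp_span_holomorphic:
  assumes "W \<subseteq> continuous_dual" "f \<in> exp_span W"
  shows "f \<in> \<H>"
  using assms(2)
proof induction
  case zero
  show ?case by (rule holomorphic_functions_const)
next
  case (step \<eta> f c)
  then have "\<eta> \<in> \<H>"
    using assms(1) continuous_dual_imp_holomorphic by blast
  then show ?case
    by (intro holomorphic_functions_add holomorphic_functions_cmult holomorphic_functions_exp step)
qed

lemma exp_span_add:
  assumes "f \<in> exp_span W" "g \<in> exp_span W"
  shows "(\<lambda>x. f x + g x) \<in> exp_span W"
  using assms(1)
proof induction
  case zero
  then show ?case using assms(2) by simp
next
  case (step \<eta> f c)
  from exp_span.step[OF step(1,3)] show ?case by (simp add: add.assoc)
qed

lemma exp_span_cmult:
  assumes "f \<in> exp_span W"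
  shows "(\<lambda>x. c * f x) \<in> exp_span W"
  using assms
proof induction
  case zero
  then show ?case using exp_span.zero by simp
next
  case (step \<eta> f d)
  from exp_span.step[OF step(1,3)] show ?case by (simp add: distrib_left mult.assoc[symmetric])
qed

text \<open>
  The exponentials of a set of functionals that is open along lines at one of its points span a
  dense subspace. Let \<open>S\<close> be the closure of the span. Continuation along the lines through \<open>\<eta>\<close>
  puts \<open>exp \<psi>\<close> into \<open>S\<close> for every continuous functional \<open>\<psi>\<close>. Differentiation of \<open>exp (\<psi> + t \<theta>)\<close> at
  \<open>t = 0\<close> shows that the set of all \<open>g\<close> with \<open>g \<cdot> exp \<psi> \<in> S\<close> for every \<open>\<psi>\<close> is stable under
  multiplication by \<open>\<theta>\<close>, so it consists of all holomorphic functions by polynomial density; take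
  \<open>\<psi> = 0\<close>. This replaces the usual argument with a functional that annihilates the exponentials,
  and avoids the Hahn-Banach theorem.
\<close>

theorem exponentials_dense:
  fixes W :: "('e::complex_lcs \<Rightarrow> complex) set"
  assumes appr: "finite_rank_approximation (continuous_dual :: ('e \<Rightarrow> complex) set)"
    and W: "W \<subseteq> continuous_dual" and \<eta>: "\<eta> \<in> W"
    and line: "\<And>\<theta>. \<theta> \<in> continuous_dual \<Longrightarrow> \<exists>\<delta>>0. \<forall>t. cmod t < \<delta> \<longrightarrow> (\<lambda>x. \<eta> x + t * \<theta> x) \<in> W"
  shows "compact_open_closure (exp_span W) = \<H>"
proof
  define S where "S = compact_open_closure (exp_span W)"
  show "compact_open_closure (exp_span W) \<subseteq> \<H>"
    by (auto simp: compact_open_closure_def)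
  have S: "compact_open_closed S"
    unfolding S_def by (rule compact_open_closed_closure)
  have span: "exp_span W \<subseteq> S"
    unfolding S_def by (intro compact_open_closure_superset subsetI exp_span_holomorphic[OF W])
  have add: "(\<lambda>x. f x + g x) \<in> S" if "f \<in> S" "g \<in> S" for f g
    using that unfolding S_def by (intro compact_open_closure_add exp_span_add)
  have cmult: "(\<lambda>x. c * f x) \<in> S" if "f \<in> S" for c f
  proof (rule compact_open_closed_mult[OF S compact_open_closureD[OF that[unfolded S_def]] holomorphic_functions_const])
    show "(\<lambda>x. c * g x) \<in> S" if "g \<in> exp_span W" for g
      by (rule subsetD[OF span exp_span_cmult[OF that]])
  qed
  have dH: "\<psi> \<in> \<H>" if "\<psi> \<in> continuous_dual" for \<psi> :: "'e \<Rightarrow> complex"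
    using that by (rule continuous_dual_imp_holomorphic)
  have expS: "(\<lambda>x. exp (\<psi> x)) \<in> S" if \<psi>: "\<psi> \<in> continuous_dual" for \<psi>
  proof -
    (* The line from \<open>\<eta>\<close> at \<open>t = 0\<close> to \<open>\<psi>\<close> at \<open>t = 1\<close>. *)
    define \<theta> where "\<theta> = (\<lambda>x. \<psi> x + (-1) * \<eta> x)"
    have \<theta>: "\<theta> \<in> continuous_dual"
      unfolding \<theta>_def using \<eta> W by (intro continuous_dual_combination \<psi>) auto
    obtain \<delta> where \<delta>: "\<delta> > 0" "\<And>t. cmod t < \<delta> \<Longrightarrow> (\<lambda>x. \<eta> x + t * \<theta> x) \<in> W"
      using line[OF \<theta>] by auto
    have "(\<lambda>x. exp (\<eta> x) * exp (1 * \<theta> x)) \<in> S"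
    proof (rule exp_line_closed[OF S add cmult _ \<theta> \<delta>(1)])
      show "(\<lambda>x. exp (\<eta> x)) \<in> \<H>"
        using \<eta> W by (intro holomorphic_functions_exp dH) auto
      fix t assume "cmod t < \<delta>"
      from subsetD[OF span exp_span.step[OF \<delta>(2)[OF this] exp_span.zero, of 1]]
      show "(\<lambda>x. exp (\<eta> x) * exp (t * \<theta> x)) \<in> S"
        by (simp add: exp_add)
    qed
    then show ?thesis by (simp add: \<theta>_def flip: exp_add)
  qed
  define A where "A = {g \<in> \<H>. \<forall>\<psi>\<in>continuous_dual. (\<lambda>x. g x * exp (\<psi> x)) \<in> S}"
  have "A = \<H>"
  proof (rule polynomial_density[OF appr])
    show "compact_open_closed A"
      unfolding compact_open_closed_def
    proof (intro conjI ballI impI)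
      show "A \<subseteq> \<H>" by (auto simp: A_def)
      fix f assume f: "f \<in> \<H>" "approximable A f"
      have "(\<lambda>x. exp (\<psi> x) * f x) \<in> S" if \<psi>: "\<psi> \<in> continuous_dual" for \<psi>
        by (rule compact_open_closed_mult[OF S f holomorphic_functions_exp[OF dH[OF \<psi>]]])
          (use \<psi> in \<open>simp add: A_def mult.commute\<close>)
      then show "f \<in> A" using f(1) by (simp add: A_def mult.commute)
    qed
    show "(\<lambda>x. c) \<in> A" for c
      using cmult[OF expS, of _ c] by (auto simp: A_def intro: holomorphic_functions_const)
    show "(\<lambda>x. f x + g x) \<in> A" if "f \<in> A" "g \<in> A" for f g
      using that add by (auto simp: A_def distrib_right intro: holomorphic_functions_add)
    show "(\<lambda>x. c * f x) \<in> A" if "f \<in> A" for c f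
      using that cmult by (auto simp: A_def mult.assoc intro: holomorphic_functions_cmult)
    show "(\<lambda>x. \<theta> x * f x) \<in> A" if \<theta>: "\<theta> \<in> continuous_dual" and f: "f \<in> A" for \<theta> f
    proof -
      have "(\<lambda>x. \<theta> x * f x * exp (\<psi> x)) \<in> S" if \<psi>: "\<psi> \<in> continuous_dual" for \<psi>
      proof -
        have "(\<lambda>x. (f x * exp (\<psi> x)) * \<theta> x ^ 1) \<in> S"
        proof (rule exp_line_taylor_coeff[OF S add cmult _ \<theta> zero_less_one])
          show "(\<lambda>x. f x * exp (\<psi> x)) \<in> \<H>"
            using f holomorphic_functions_mult[OF _ holomorphic_functions_exp[OF dH[OF \<psi>]], of f]
            by (simp add: A_def)
          fix t
          have "(\<lambda>x. f x * exp (\<psi> x + t * \<theta> x)) \<in> S"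
            using f continuous_dual_combination[OF \<psi> \<theta>, of t] by (simp add: A_def)
          then show "(\<lambda>x. f x * exp (\<psi> x) * exp (t * \<theta> x)) \<in> S"
            by (simp add: exp_add mult.assoc)
        qed
        then show ?thesis by (simp add: mult_ac)
      qed
      then show ?thesis
        using f \<theta> by (simp add: A_def holomorphic_functions_mult dH)
    qed
  qed
  moreover have "(\<lambda>x. 0) \<in> (continuous_dual :: ('e \<Rightarrow> complex) set)"
    by (simp add: continuous_dual_iff)
  ultimately have "f \<in> S" if "f \<in> \<H>" for f
  proof -
    from that \<open>A = \<H>\<close> have "f \<in> A" by simp
    then have "(\<lambda>x. f x * exp 0) \<in> S"
      using bspec[of continuous_dual "\<lambda>\<psi>. (\<lambda>x. f x * exp (\<psi> x)) \<in> S" "\<lambda>x. 0"]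
        \<open>(\<lambda>x. 0) \<in> continuous_dual\<close> unfolding A_def by simp
    then show ?thesis by simp
  qed
  then show "\<H> \<subseteq> compact_open_closure (exp_span W)"
    by (auto simp: S_def)
qed

section \<open>The compact-open topology and continuous linear operators\<close>

lemma openin_compact_open_topology:
  fixes U :: "('e::complex_lcs \<Rightarrow> complex) set"
  shows "openin compact_open_topology U \<longleftrightarrow> U \<subseteq> \<H> \<and>
    (\<forall>f\<in>U. \<exists>K \<epsilon>. compact K \<and> \<epsilon> > 0 \<and> {g \<in> \<H>. \<forall>x\<in>K. cmod (g x - f x) < \<epsilon>} \<subseteq> U)"
  unfolding compact_open_topology_def openin_uniform_convergence_topology
proof (intro conj_cong ball_cong refl iffI)
  fix f assume "\<exists>\<F> \<epsilon>. finite \<F> \<and> \<F> \<subseteq> {K. compact K} \<and> \<epsilon> > 0 \<and>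
      {g \<in> \<H>. \<forall>x\<in>\<Union>\<F>. cmod (g x - f x) < \<epsilon>} \<subseteq> U"
  then obtain \<F> \<epsilon> where \<F>: "finite \<F>" "\<F> \<subseteq> {K. compact K}" "\<epsilon> > 0"
      "{g \<in> \<H>. \<forall>x\<in>\<Union>\<F>. cmod (g x - f x) < \<epsilon>} \<subseteq> U"
    by (elim exE conjE)
  from \<F>(1,2) have "compact (\<Union>\<F>)" by (intro compact_Union) auto
  with \<F>(3,4) show "\<exists>K \<epsilon>. compact K \<and> \<epsilon> > 0 \<and> {g \<in> \<H>. \<forall>x\<in>K. cmod (g x - f x) < \<epsilon>} \<subseteq> U"
    by (intro exI[of _ "\<Union>\<F>"] exI[of _ \<epsilon>] conjI)
next
  fix f assume "\<exists>K \<epsilon>. compact K \<and> \<epsilon> > 0 \<and> {g \<in> \<H>. \<forall>x\<in>K. cmod (g x - f x) < \<epsilon>} \<subseteq> U"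
  then obtain K \<epsilon> where "compact K" "\<epsilon> > 0" "{g \<in> \<H>. \<forall>x\<in>K. cmod (g x - f x) < \<epsilon>} \<subseteq> U"
    by (elim exE conjE)
  then show "\<exists>\<F> \<epsilon>. finite \<F> \<and> \<F> \<subseteq> {K. compact K} \<and> \<epsilon> > 0 \<and>
      {g \<in> \<H>. \<forall>x\<in>\<Union>\<F>. cmod (g x - f x) < \<epsilon>} \<subseteq> U"
    by (intro exI[of _ "{K}"] exI[of _ \<epsilon>]) auto
qed

lemma topspace_compact_open_topology [simp]: "topspace compact_open_topology = \<H>"
  by (simp add: compact_open_topology_def)

lemma compact_open_nbhd:
  fixes f :: "'e::complex_lcs \<Rightarrow> complex"
  assumes "openin compact_open_topology U" "f \<in> U"
  obtains K \<epsilon> where "compact K" "\<epsilon> > 0"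
    "\<And>g. g \<in> \<H> \<Longrightarrow> \<forall>x\<in>K. cmod (g x - f x) < \<epsilon> \<Longrightarrow> g \<in> U"
proof -
  from assms have "\<exists>K \<epsilon>. compact K \<and> \<epsilon> > 0 \<and> {g \<in> \<H>. \<forall>x\<in>K. cmod (g x - f x) < \<epsilon>} \<subseteq> U"
    by (simp add: openin_compact_open_topology)
  then obtain K \<epsilon> where K: "compact K" "\<epsilon> > 0" "{g \<in> \<H>. \<forall>x\<in>K. cmod (g x - f x) < \<epsilon>} \<subseteq> U"
    by (elim exE conjE)
  show thesis
    by (rule that[OF K(1,2)]) (use K(3) in auto)
qed

text \<open>
  The strict slack \<open>s < \<epsilon>\<close> makes the set open without a discussion of whether the supremum over
  \<open>K\<close> is attained.
\<close>

lemma openin_uniformly_close: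
  fixes f :: "'e::complex_lcs \<Rightarrow> complex"
  assumes K: "compact K"
  shows "openin compact_open_topology
    {g \<in> \<H>. \<exists>s<\<epsilon>. \<forall>x\<in>K. cmod (g x - f x) \<le> s}"
  unfolding openin_compact_open_topology
proof (intro conjI ballI)
  fix g :: "'e \<Rightarrow> complex" assume "g \<in> {g \<in> \<H>. \<exists>s<\<epsilon>. \<forall>x\<in>K. cmod (g x - f x) \<le> s}"
  then obtain s where s: "s < \<epsilon>" "\<And>x. x \<in> K \<Longrightarrow> cmod (g x - f x) \<le> s" by auto
  have "\<exists>s<\<epsilon>. \<forall>x\<in>K. cmod (h x - f x) \<le> s"
    if h: "\<forall>x\<in>K. cmod (h x - g x) < (\<epsilon> - s) / 2" for h
  proof (intro exI[of _ "(\<epsilon> + s) / 2"] conjI ballI)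
    show "(\<epsilon> + s) / 2 < \<epsilon>" using s(1) by simp
    fix x assume x: "x \<in> K"
    have "cmod (h x - f x) \<le> cmod (h x - g x) + cmod (g x - f x)"
      using norm_triangle_ineq[of "h x - g x" "g x - f x"] by simp
    also have "\<dots> \<le> (\<epsilon> - s) / 2 + s"
      using h x s(2)[OF x] by (intro add_mono) (auto intro: less_imp_le)
    finally show "cmod (h x - f x) \<le> (\<epsilon> + s) / 2" by (simp add: field_simps)
  qed
  then show "\<exists>K' \<epsilon>'. compact K' \<and> \<epsilon>' > 0 \<and> {h \<in> \<H>. \<forall>x\<in>K'. cmod (h x - g x) < \<epsilon>'}
      \<subseteq> {g \<in> \<H>. \<exists>s<\<epsilon>. \<forall>x\<in>K. cmod (g x - f x) \<le> s}"
    using K s(1) by (intro exI[of _ K] exI[of _ "(\<epsilon> - s) / 2"]) auto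
qed auto

text \<open>
  Continuity is expressed by the seminorm estimates that characterise it for linear maps; in this
  form it passes directly to the iterates and to limits of series.
\<close>

definition continuous_linear_operator :: "(('e::complex_lcs \<Rightarrow> complex) \<Rightarrow> 'e \<Rightarrow> complex) \<Rightarrow> bool"
  where "continuous_linear_operator T \<longleftrightarrow>
    (\<forall>f\<in>\<H>. T f \<in> \<H>) \<and>
    (\<forall>f\<in>\<H>. \<forall>g\<in>\<H>. T (\<lambda>x. f x + g x) = (\<lambda>x. T f x + T g x)) \<and>
    (\<forall>c. \<forall>f\<in>\<H>. T (\<lambda>x. c * f x) = (\<lambda>x. c * T f x)) \<and>
    (\<forall>K. compact K \<longrightarrow> (\<exists>K' C. compact K' \<and> C > 0 \<and> (\<forall>f\<in>\<H>. \<forall>s>0.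
       (\<forall>x\<in>K'. cmod (f x) \<le> s) \<longrightarrow> (\<forall>x\<in>K. cmod (T f x) \<le> C * s))))"

lemma continuous_linear_operatorD:
  assumes "continuous_linear_operator T"
  shows "f \<in> \<H> \<Longrightarrow> T f \<in> \<H>"
    and "f \<in> \<H> \<Longrightarrow> g \<in> \<H> \<Longrightarrow> T (\<lambda>x. f x + g x) = (\<lambda>x. T f x + T g x)"
    and "f \<in> \<H> \<Longrightarrow> T (\<lambda>x. c * f x) = (\<lambda>x. c * T f x)"
  using assms by (auto simp: continuous_linear_operator_def)

lemma continuous_linear_operator_bound:
  assumes "continuous_linear_operator T" "compact K"
  obtains K' C where "compact K'" "C > 0"
    "\<And>f s x. f \<in> \<H> \<Longrightarrow> s > 0 \<Longrightarrow> \<forall>x\<in>K'. cmod (f x) \<le> s \<Longrightarrow> x \<in> K \<Longrightarrow> cmod (T f x) \<le> C * s"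
proof -
  from assms have "\<exists>K' C. compact K' \<and> C > 0 \<and> (\<forall>f\<in>\<H>. \<forall>s>0.
       (\<forall>x\<in>K'. cmod (f x) \<le> s) \<longrightarrow> (\<forall>x\<in>K. cmod (T f x) \<le> C * s))"
    unfolding continuous_linear_operator_def by (elim conjE allE[where x=K]) simp
  then obtain K' C where *: "compact K'" "C > 0" "\<forall>f\<in>\<H>. \<forall>s>0.
       (\<forall>x\<in>K'. cmod (f x) \<le> s) \<longrightarrow> (\<forall>x\<in>K. cmod (T f x) \<le> C * s)"
    by (elim exE conjE)
  show thesis
    by (rule that[OF *(1,2)]) (use *(3) in auto)
qed

lemma continuous_linear_operator_diff:
  assumes T: "continuous_linear_operator T" and f: "f \<in> \<H>" and g: "g \<in> \<H>"
  shows "T (\<lambda>x. f x - g x) = (\<lambda>x. T f x - T g x)"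
proof -
  have "T (\<lambda>x. f x + (-1) * g x) = (\<lambda>x. T f x + T (\<lambda>x. (-1) * g x) x)"
    by (rule continuous_linear_operatorD(2)[OF T f holomorphic_functions_cmult[OF g]])
  also have "T (\<lambda>x. (-1) * g x) = (\<lambda>x. (-1) * T g x)"
    by (rule continuous_linear_operatorD(3)[OF T g])
  finally show ?thesis by simp
qed

lemma holomorphic_functions_diff:
  assumes "f \<in> \<H>" "g \<in> \<H>"
  shows "(\<lambda>x. f x - g x) \<in> \<H>"
  using holomorphic_functions_add[OF assms(1) holomorphic_functions_cmult[OF assms(2), of "-1"]] by simp

lemma convolution_operator_continuous_linear:
  fixes L :: "('e::complex_lcs \<Rightarrow> complex) \<Rightarrow> 'e \<Rightarrow> complex"
  assumes L: "convolution_operator L"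
  shows "continuous_linear_operator L"
  unfolding continuous_linear_operator_def
proof (intro conjI allI impI ballI)
  have cont: "continuous_map compact_open_topology compact_open_topology L"
    using L by (simp add: convolution_operator_def)
  show "L f \<in> \<H>" if "f \<in> \<H>" for f
    using continuous_map_image_subset_topspace[OF cont] that by auto
  show "L (\<lambda>x. f x + g x) = (\<lambda>x. L f x + L g x)" if "f \<in> \<H>" "g \<in> \<H>" for f g
    using L that by (simp add: convolution_operator_def)
  have cmult: "L (\<lambda>x. c * f x) = (\<lambda>x. c * L f x)" if "f \<in> \<H>" for f c
    using L that by (simp add: convolution_operator_def)
  then show "L (\<lambda>x. c * f x) = (\<lambda>x. c * L f x)" if "f \<in> \<H>" for f c
    using that .
  fix K :: "'e set" assume K: "compact K"
  have L0: "L (\<lambda>x. 0) = (\<lambda>x. 0)"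
    using cmult[of "\<lambda>x. 0" 0] holomorphic_functions_const[of 0] by simp
  define V :: "('e \<Rightarrow> complex) set" where "V = {g \<in> \<H>. \<exists>s<1. \<forall>x\<in>K. cmod (g x - 0) \<le> s}"
  have "openin compact_open_topology {f \<in> \<H>. L f \<in> V}"
    using openin_continuous_map_preimage[OF cont openin_uniformly_close[OF K, of 1 "\<lambda>x. 0"]]
    by (simp add: V_def)
  moreover have "(\<lambda>x. 0) \<in> {f \<in> \<H>. L f \<in> V}"
    by (auto simp: L0 V_def holomorphic_functions_const intro!: exI[of _ 0])
  ultimately obtain K' \<epsilon> where K': "compact K'" "\<epsilon> > 0"
    "\<And>g. g \<in> \<H> \<Longrightarrow> \<forall>x\<in>K'. cmod (g x - 0) < \<epsilon> \<Longrightarrow> g \<in> {f \<in> \<H>. L f \<in> V}"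
    by (rule compact_open_nbhd) (rule that)
  have "cmod (L f x) \<le> (2 / \<epsilon>) * s"
    if f: "f \<in> \<H>" and s: "s > 0" "\<forall>x\<in>K'. cmod (f x) \<le> s" and x: "x \<in> K" for f s x
  proof -
    (* Rescaling brings \<open>f\<close> below \<open>\<epsilon>\<close> on \<open>K'\<close>; the factor 2 makes the inequality strict. *)
    define c where "c = complex_of_real (\<epsilon> / (2 * s))"
    have c: "cmod c = \<epsilon> / (2 * s)" using s K'(2) by (simp add: c_def norm_divide norm_mult)
    have "\<forall>x\<in>K'. cmod (c * f x - 0) < \<epsilon>"
    proof
      fix x assume that: "x \<in> K'" 
      have "cmod (c * f x - 0) \<le> \<epsilon> / (2 * s) * s"
        unfolding diff_zero norm_mult c using s that K'(2) by (intro mult_left_mono) auto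
      also have "\<dots> < \<epsilon>" using s K'(2) by simp
      finally show "cmod (c * f x - 0) < \<epsilon>" .
    qed
    from K'(3)[OF holomorphic_functions_cmult[OF f] this]
    have "L (\<lambda>x. c * f x) \<in> V" by blast
    then have "cmod (c * L f x) < 1"
      using x by (force simp: V_def cmult[OF f])
    then show ?thesis
      unfolding norm_mult c using s K'(2) by (simp add: field_simps)
  qed
  then show "\<exists>K' C. compact K' \<and> C > 0 \<and> (\<forall>f\<in>\<H>. \<forall>s>0.
       (\<forall>x\<in>K'. cmod (f x) \<le> s) \<longrightarrow> (\<forall>x\<in>K. cmod (L f x) \<le> C * s))"
    using K'(1,2) by (intro exI[of _ K'] exI[of _ "2 / \<epsilon>"]) auto
qed

lemma continuous_linear_operator_funpow:
  fixes T :: "('e::complex_lcs \<Rightarrow> complex) \<Rightarrow> 'e \<Rightarrow> complex"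
  assumes T: "continuous_linear_operator T"
  shows "continuous_linear_operator (T ^^ n)"
proof (induction n)
  case 0
  have "\<exists>K' C. compact K' \<and> C > 0 \<and> (\<forall>f\<in>\<H>. \<forall>s>0.
       (\<forall>x\<in>K'. cmod (f x) \<le> s) \<longrightarrow> (\<forall>x\<in>K. cmod (f x) \<le> C * s))" if "compact K" for K :: "'e set"
    using that by (intro exI[of _ K] exI[of _ 1]) auto
  then show ?case by (simp add: continuous_linear_operator_def)
next
  case (Suc n)
  note D = continuous_linear_operatorD[OF T] and Dn = continuous_linear_operatorD[OF Suc]
  show ?case
    unfolding continuous_linear_operator_def funpow.simps o_def
  proof (intro conjI allI impI ballI)
    show "T ((T ^^ n) f) \<in> \<H>" if "f \<in> \<H>" for f
      using D(1)[OF Dn(1)] that by simp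
    show "T ((T ^^ n) (\<lambda>x. f x + g x)) = (\<lambda>x. T ((T ^^ n) f) x + T ((T ^^ n) g) x)"
      if "f \<in> \<H>" "g \<in> \<H>" for f g
      using that by (simp add: Dn D)
    show "T ((T ^^ n) (\<lambda>x. c * f x)) = (\<lambda>x. c * T ((T ^^ n) f) x)"
      if "f \<in> \<H>" for f c
      using that by (simp add: Dn D)
    fix K :: "'e set" assume K: "compact K"
    obtain K' C where K': "compact K'" "C > 0"
      "\<And>f s x. f \<in> \<H> \<Longrightarrow> s > 0 \<Longrightarrow> \<forall>x\<in>K'. cmod (f x) \<le> s \<Longrightarrow> x \<in> K \<Longrightarrow> cmod (T f x) \<le> C * s"
      by (rule continuous_linear_operator_bound[OF T K]) (rule that)
    obtain K'' C' where K'': "compact K''" "C' > 0"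
      "\<And>f s x. f \<in> \<H> \<Longrightarrow> s > 0 \<Longrightarrow> \<forall>x\<in>K''. cmod (f x) \<le> s \<Longrightarrow> x \<in> K' \<Longrightarrow> cmod ((T ^^ n) f x) \<le> C' * s"
      by (rule continuous_linear_operator_bound[OF Suc K'(1)]) (rule that)
    have "cmod (T ((T ^^ n) f) x) \<le> C * C' * s"
      if f: "f \<in> \<H>" and s: "s > 0" "\<forall>x\<in>K''. cmod (f x) \<le> s" and x: "x \<in> K" for f s x
    proof -
      have "\<forall>y\<in>K'. cmod ((T ^^ n) f y) \<le> C' * s"
        using K''(3)[OF f s] by blast
      then show ?thesis
        using K'(3)[OF Dn(1)[OF f], of "C' * s" x] K''(2) s(1) x by (simp add: mult.assoc)
    qed
    then show "\<exists>K' C. compact K' \<and> C > 0 \<and> (\<forall>f\<in>\<H>. \<forall>s>0.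
       (\<forall>x\<in>K'. cmod (f x) \<le> s) \<longrightarrow> (\<forall>x\<in>K. cmod (T ((T ^^ n) f) x) \<le> C * s))"
      using K''(1,2) K'(2) by (intro exI[of _ K''] exI[of _ "C * C'"]) auto
  qed
qed

lemmas convolution_operator_iterate =
  continuous_linear_operator_funpow[OF convolution_operator_continuous_linear]

section \<open>Convolution operators on exponentials\<close>

text \<open>
  The eigenvalue belonging to the exponential of \<open>\<eta>\<close>; it is the Borel transform of the
  analytic functional \<open>f \<mapsto> L f 0\<close>.
\<close>

definition symbol :: "(('e::complex_lcs \<Rightarrow> complex) \<Rightarrow> 'e \<Rightarrow> complex) \<Rightarrow> ('e \<Rightarrow> complex) \<Rightarrow> complex"
  where "symbol L \<eta> = L (\<lambda>x. exp (\<eta> x)) 0"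

lemma exp_dual_holomorphic: "\<eta> \<in> continuous_dual \<Longrightarrow> (\<lambda>x. exp (\<eta> x)) \<in> \<H>"
  by (rule holomorphic_functions_exp[OF continuous_dual_imp_holomorphic])

text \<open>
  An exponential is multiplied by a scalar under each translation, and the operator commutes with
  translations, so its image is multiplied by the same scalars. A function with this property is
  determined by its value at the origin.
\<close>

lemma convolution_operator_exp:
  fixes L :: "('e::complex_lcs \<Rightarrow> complex) \<Rightarrow> 'e \<Rightarrow> complex"
  assumes L: "convolution_operator L" and \<eta>: "\<eta> \<in> continuous_dual"
  shows "L (\<lambda>x. exp (\<eta> x)) = (\<lambda>x. symbol L \<eta> * exp (\<eta> x))"
proof
  fix x
  have add: "\<eta> (y + z) = \<eta> y + \<eta> z" for y z using \<eta> by (simp add: continuous_dual_iff)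
  have "translation (- x) (\<lambda>y. exp (\<eta> y)) = (\<lambda>y. exp (\<eta> x) * exp (\<eta> y))"
    by (simp add: translation_def add exp_add mult.commute)
  moreover have "L (translation (- x) (\<lambda>y. exp (\<eta> y))) = translation (- x) (L (\<lambda>y. exp (\<eta> y)))"
    using L exp_dual_holomorphic[OF \<eta>] unfolding convolution_operator_def by blast
  ultimately have "translation (- x) (L (\<lambda>y. exp (\<eta> y))) = L (\<lambda>y. exp (\<eta> x) * exp (\<eta> y))"
    by simp
  also have "\<dots> = (\<lambda>y. exp (\<eta> x) * L (\<lambda>y. exp (\<eta> y)) y)"
    by (rule continuous_linear_operatorD(3)[OF convolution_operator_continuous_linear[OF L] exp_dual_holomorphic[OF \<eta>]])
  finally show "L (\<lambda>x. exp (\<eta> x)) x = symbol L \<eta> * exp (\<eta> x)"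
    by (auto simp: fun_eq_iff translation_def symbol_def mult.commute dest: spec[of _ 0])
qed

text \<open>
  The operator may be applied termwise to the series of \<open>exp (\<eta> + t \<theta>)\<close> in powers of \<open>t\<close>, which
  exhibits the symbol on the line as an everywhere convergent power series.
\<close>

lemma symbol_holomorphic_on_lines:
  fixes L :: "('e::complex_lcs \<Rightarrow> complex) \<Rightarrow> 'e \<Rightarrow> complex"
  assumes L: "convolution_operator L" and \<eta>: "\<eta> \<in> continuous_dual" and \<theta>: "\<theta> \<in> continuous_dual"
  shows "(\<lambda>t. symbol L (\<lambda>x. \<eta> x + t * \<theta> x)) holomorphic_on UNIV"
proof -
  note CL = convolution_operator_continuous_linear[OF L]
  define m where "m i x = exp (\<eta> x) * \<theta> x ^ i" for i x
  have mH: "m i \<in> \<H>" for i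
    unfolding m_def
    by (rule holomorphic_functions_mult[OF exp_dual_holomorphic[OF \<eta>]
          holomorphic_functions_power[OF continuous_dual_imp_holomorphic[OF \<theta>]]])
  define a where "a i = L (m i) 0 / fact i" for i
  define s where "s t n x = (\<Sum>i<n. t ^ i / fact i * m i x)" for t :: complex and n :: nat and x
  have s: "s t n \<in> \<H> \<and> L (s t n) 0 = (\<Sum>i<n. a i * t ^ i)" for t n
  proof (induction n)
    case 0
    have "L (\<lambda>x. 0 * m 0 x) = (\<lambda>x. 0 * L (m 0) x)"
      by (rule continuous_linear_operatorD(3)[OF CL mH])
    then show ?case by (simp add: s_def[abs_def] holomorphic_functions_const)
  next
    case (Suc n)
    have eq: "s t (Suc n) = (\<lambda>x. s t n x + t ^ n / fact n * m n x)"
      by (simp add: s_def[abs_def])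
    have H: "(\<lambda>x. t ^ n / fact n * m n x) \<in> \<H>"
      by (rule holomorphic_functions_cmult[OF mH])
    have "L (s t (Suc n)) = (\<lambda>x. L (s t n) x + L (\<lambda>x. t ^ n / fact n * m n x) x)"
      unfolding eq using Suc H by (intro continuous_linear_operatorD(2)[OF CL]) auto
    also have "L (\<lambda>x. t ^ n / fact n * m n x) = (\<lambda>x. t ^ n / fact n * L (m n) x)"
      by (rule continuous_linear_operatorD(3)[OF CL mH])
    finally show ?case
      using Suc holomorphic_functions_add[OF _ H, of "s t n"] by (simp add: eq a_def)
  qed
  obtain K C where K: "compact K" "C > 0"
    "\<And>f s x. f \<in> \<H> \<Longrightarrow> s > 0 \<Longrightarrow> \<forall>x\<in>K. cmod (f x) \<le> s \<Longrightarrow> x \<in> {0} \<Longrightarrow> cmod (L f x) \<le> C * s"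
    by (rule continuous_linear_operator_bound[OF CL, of "{0}"]) (use that in auto)
  obtain D where D: "D > 0" "\<And>x. x \<in> K \<Longrightarrow> cmod (exp (\<eta> x)) \<le> D"
    by (rule holomorphic_functions_bounded_on_compact[OF exp_dual_holomorphic[OF \<eta>] K(1)]) (rule that)
  have "(\<lambda>i. a i * (t - 0) ^ i) sums symbol L (\<lambda>x. \<eta> x + t * \<theta> x)" for t
  proof -
    define E where "E x = exp (\<eta> x + t * \<theta> x)" for x
    have EH: "E \<in> \<H>"
      unfolding E_def by (rule exp_dual_holomorphic[OF continuous_dual_combination[OF \<eta> \<theta>]])
    obtain N where N: "N > 0" "\<And>x. x \<in> K \<Longrightarrow> cmod (t * \<theta> x) \<le> N"
      by (rule holomorphic_functions_bounded_on_compact[OF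
            holomorphic_functions_cmult[OF continuous_dual_imp_holomorphic[OF \<theta>], of t] K(1)]) (rule that)
    define q where "q n = exp N * N ^ Suc n / fact n" for n
    have q: "q n > 0" for n using N(1) by (simp add: q_def)
    have "(\<lambda>n. C * (D * q n)) \<longlonglongrightarrow> C * (D * 0)"
      unfolding q_def by (intro tendsto_mult tendsto_const exp_remainder_tendsto_0)
    then have lim: "(\<lambda>n. C * (D * q n)) \<longlonglongrightarrow> 0" by simp
    have le: "cmod ((\<Sum>i<Suc n. a i * t ^ i) - symbol L (\<lambda>x. \<eta> x + t * \<theta> x)) \<le> C * (D * q n)" for n
    proof -
      have bd: "cmod (E x - s t (Suc n) x) \<le> D * q n" if x: "x \<in> K" for x
      proof -
        have "s t (Suc n) x = exp (\<eta> x) * (\<Sum>i\<le>n. (t * \<theta> x) ^ i / fact i)"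
          unfolding s_def m_def sum_distrib_left lessThan_Suc_atMost
          by (intro sum.cong) (auto simp: power_mult_distrib)
        then have "cmod (E x - s t (Suc n) x)
            = cmod (exp (\<eta> x)) * cmod (exp (t * \<theta> x) - (\<Sum>i\<le>n. (t * \<theta> x) ^ i / fact i))"
          unfolding E_def exp_add by (simp only: norm_mult[symmetric] right_diff_distrib)
        also have "\<dots> \<le> D * q n"
          unfolding q_def using D N x by (intro mult_mono exp_remainder) auto
        finally show ?thesis .
      qed
      have "(\<lambda>x. E x - s t (Suc n) x) \<in> \<H>"
        using holomorphic_functions_diff[OF EH] s by blast
      then have "cmod (L (\<lambda>x. E x - s t (Suc n) x) 0) \<le> C * (D * q n)"
        using bd D(1) q[of n] by (intro K(3)) auto
      also have "L (\<lambda>x. E x - s t (Suc n) x) = (\<lambda>x. L E x - L (s t (Suc n)) x)"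
        using s by (intro continuous_linear_operator_diff[OF CL EH]) auto
      finally show ?thesis
        using s[of t "Suc n"] by (simp only: symbol_def E_def[symmetric] norm_minus_commute)
    qed
    have "(\<lambda>n. (\<Sum>i<Suc n. a i * t ^ i) - symbol L (\<lambda>x. \<eta> x + t * \<theta> x)) \<longlonglongrightarrow> 0"
      by (rule Lim_null_comparison[OF always_eventually[OF allI[OF le]] lim])
    then have "(\<lambda>n. \<Sum>i<Suc n. a i * t ^ i) \<longlonglongrightarrow> symbol L (\<lambda>x. \<eta> x + t * \<theta> x)"
      by (rule LIM_zero_cancel)
    then have "(\<lambda>n. \<Sum>i<n. a i * t ^ i) \<longlonglongrightarrow> symbol L (\<lambda>x. \<eta> x + t * \<theta> x)"
      by (rule LIMSEQ_imp_Suc)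
    then show ?thesis by (simp add: sums_def)
  qed
  then have "(\<lambda>t. symbol L (\<lambda>x. \<eta> x + t * \<theta> x)) holomorphic_on ball 0 r" for r
    by (intro power_series_holomorphic[where a = a]) auto
  then have "(\<lambda>t. symbol L (\<lambda>x. \<eta> x + t * \<theta> x)) field_differentiable at z" for z
    by (rule holomorphic_on_imp_differentiable_at[where s = "ball 0 (cmod z + 1)"]) auto
  then show ?thesis
    by (simp add: holomorphic_on_def)
qed

section \<open>Mixing of convolution operators\<close>

lemma convolution_operator_scalar_if_symbol_constant:
  fixes L :: "('e::complex_lcs \<Rightarrow> complex) \<Rightarrow> 'e \<Rightarrow> complex"
  assumes appr: "finite_rank_approximation (continuous_dual :: ('e \<Rightarrow> complex) set)"
    and L: "convolution_operator L"
    and c: "\<And>\<eta>. \<eta> \<in> continuous_dual \<Longrightarrow> symbol L \<eta> = c"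
    and f: "f \<in> \<H>"
  shows "L f = (\<lambda>x. c * f x)"
proof -
  note CL = convolution_operator_continuous_linear[OF L]
  have span: "L h = (\<lambda>x. c * h x)" if "h \<in> exp_span continuous_dual" for h
    using that
  proof induction
    case zero
    show ?case
      using continuous_linear_operatorD(3)[OF CL holomorphic_functions_const[of 0], of 0] by simp
  next
    case (step \<eta> f d)
    have "L (\<lambda>x. d * exp (\<eta> x) + f x) = (\<lambda>x. L (\<lambda>x. d * exp (\<eta> x)) x + L f x)"
      by (rule continuous_linear_operatorD(2)[OF CL holomorphic_functions_cmult[OF exp_dual_holomorphic[OF step(1)]]
            exp_span_holomorphic[OF order.refl step(2)]])
    also have "L (\<lambda>x. d * exp (\<eta> x)) = (\<lambda>x. d * L (\<lambda>x. exp (\<eta> x)) x)"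
      by (rule continuous_linear_operatorD(3)[OF CL exp_dual_holomorphic[OF step(1)]])
    also have "L (\<lambda>x. exp (\<eta> x)) = (\<lambda>x. c * exp (\<eta> x))"
      by (simp add: convolution_operator_exp[OF L step(1)] c[OF step(1)])
    finally show ?case by (simp add: step(3) algebra_simps)
  qed
  have zero: "(\<lambda>x. 0) \<in> (continuous_dual :: ('e \<Rightarrow> complex) set)"
    by (simp add: continuous_dual_iff)
  have "compact_open_closure (exp_span continuous_dual) = (\<H> :: ('e \<Rightarrow> complex) set)"
  proof (rule exponentials_dense[OF appr order.refl zero])
    fix \<theta> :: "'e \<Rightarrow> complex" assume "\<theta> \<in> continuous_dual"
    then show "\<exists>\<delta>>0. \<forall>t. cmod t < \<delta> \<longrightarrow> (\<lambda>x. 0 + t * \<theta> x) \<in> continuous_dual"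
      using continuous_dual_combination[OF zero] by (intro exI[of _ 1]) auto
  qed
  then have f': "approximable (exp_span continuous_dual) f"
    using f by (auto simp: compact_open_closure_def)
  show ?thesis
  proof
    fix x
    obtain K C where K: "compact K" "C > 0"
      "\<And>f s y. f \<in> \<H> \<Longrightarrow> s > 0 \<Longrightarrow> \<forall>x\<in>K. cmod (f x) \<le> s \<Longrightarrow> y \<in> {x} \<Longrightarrow> cmod (L f y) \<le> C * s"
      by (rule continuous_linear_operator_bound[OF CL, of "{x}"]) (use that in auto)
    have "cmod (L f x - c * f x) \<le> \<epsilon> * (C + cmod c)" if eps: "\<epsilon> > 0" for \<epsilon>
    proof -
      have "compact (insert x K)" using K(1) by (rule compact_insert)
      then obtain g where g: "g \<in> exp_span continuous_dual" "\<And>y. y \<in> insert x K \<Longrightarrow> cmod (g y - f y) < \<epsilon>"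
        by (rule approximableD[OF f' _ eps]) (rule that)
      have gH: "g \<in> \<H>" by (rule exp_span_holomorphic[OF order.refl g(1)])
      have "cmod (L (\<lambda>y. g y - f y) x) \<le> C * \<epsilon>"
        using g(2) by (intro K(3) holomorphic_functions_diff gH f eps) (auto intro: less_imp_le)
      also have "L (\<lambda>y. g y - f y) = (\<lambda>y. c * g y - L f y)"
        unfolding continuous_linear_operator_diff[OF CL gH f] span[OF g(1)] ..
      finally have "cmod (c * g x - L f x) \<le> C * \<epsilon>" .
      moreover have "cmod (c * (g x - f x)) \<le> cmod c * \<epsilon>"
        unfolding norm_mult using g(2)[of x] by (intro mult_left_mono) auto
      moreover have "L f x - c * f x = c * (g x - f x) - (c * g x - L f x)"
        by (simp add: algebra_simps)
      ultimately show ?thesis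
        using norm_triangle_ineq4[of "c * (g x - f x)" "c * g x - L f x"] by (simp add: algebra_simps)
    qed
    then have *: "cmod (L f x - c * f x) / (C + cmod c) \<le> \<epsilon>" if "\<epsilon> > 0" for \<epsilon>
      using that K(2) by (simp add: pos_divide_le_eq add_pos_nonneg)
    have "cmod (L f x - c * f x) / (C + cmod c) \<le> 0"
      by (rule field_le_epsilon) (use * in auto)
    moreover have "C + cmod c > 0"
      using K(2) by (simp add: add_pos_nonneg)
    ultimately show "L f x = c * f x"
      by (auto simp: divide_le_0_iff)
  qed
qed

text \<open>
  The symbol of a nontrivial operator is not constant, because otherwise the operator would be
  scalar on the dense span of the exponentials. Hence it is not constant on some complex line, and
  there Liouville's theorem, applied to the symbol and to its reciprocal, excludes that the modulus
  stays at most 1 or at least 1.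
\<close>

lemma symbol_small_and_large:
  fixes L :: "('e::complex_lcs \<Rightarrow> complex) \<Rightarrow> 'e \<Rightarrow> complex"
  assumes appr: "finite_rank_approximation (continuous_dual :: ('e \<Rightarrow> complex) set)"
    and L: "convolution_operator L" and nontriv: "nontrivial_operator L"
  obtains \<eta> \<eta>' where "\<eta> \<in> continuous_dual" "cmod (symbol L \<eta>) < 1"
    "\<eta>' \<in> continuous_dual" "cmod (symbol L \<eta>') > 1"
proof -
  have zero: "(\<lambda>x. 0) \<in> (continuous_dual :: ('e \<Rightarrow> complex) set)"
    by (simp add: continuous_dual_iff)
  have "\<exists>\<theta>\<in>continuous_dual. symbol L \<theta> \<noteq> symbol L (\<lambda>x. 0)"
  proof (rule ccontr)
    assume "\<not> ?thesis"
    then have "\<And>\<eta>. \<eta> \<in> continuous_dual \<Longrightarrow> symbol L \<eta> = symbol L (\<lambda>x. 0)" by blast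
    from convolution_operator_scalar_if_symbol_constant[OF appr L this]
    show False using nontriv unfolding nontrivial_operator_def by blast
  qed
  then obtain \<theta> where \<theta>: "\<theta> \<in> continuous_dual" "symbol L \<theta> \<noteq> symbol L (\<lambda>x. 0)" by blast
  define u where "u t = symbol L (\<lambda>x. 0 + t * \<theta> x)" for t
  have u: "u holomorphic_on UNIV"
    unfolding u_def by (rule symbol_holomorphic_on_lines[OF L zero \<theta>(1)])
  have nc: "\<not> u constant_on UNIV"
  proof
    assume "u constant_on UNIV"
    then have "u 1 = u 0" by (auto simp: constant_on_def)
    then show False using \<theta>(2) by (simp add: u_def)
  qed
  have dual: "(\<lambda>x. 0 + t * \<theta> x) \<in> continuous_dual" for t
    by (rule continuous_dual_combination[OF zero \<theta>(1)])
  have "\<exists>t. cmod (u t) > 1"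
  proof (rule ccontr)
    assume "\<not> ?thesis"
    then have "bounded (range u)" by (intro boundedI[of _ 1]) (auto simp: not_less)
    then show False using Liouville_theorem[OF u] nc by blast
  qed
  moreover have "\<exists>t. cmod (u t) < 1"
  proof (rule ccontr)
    assume "\<not> ?thesis"
    then have ge: "cmod (u t) \<ge> 1" for t by (simp add: not_less)
    then have nz: "u t \<noteq> 0" for t by (metis norm_zero not_one_le_zero)
    have "(\<lambda>t. inverse (u t)) holomorphic_on UNIV"
      using u nz by (intro holomorphic_intros) auto
    moreover have "bounded (range (\<lambda>t. inverse (u t)))"
      using ge by (intro boundedI[of _ 1]) (auto simp: norm_inverse inverse_le_1_iff)
    ultimately have "(\<lambda>t. inverse (u t)) constant_on UNIV" by (rule Liouville_theorem)
    then have "u constant_on UNIV"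
      unfolding constant_on_def by (metis inverse_inverse_eq)
    then show False using nc by blast
  qed
  ultimately show thesis
    using that dual unfolding u_def by blast
qed

definition tends_compactly_to_0 :: "(nat \<Rightarrow> 'e::complex_lcs \<Rightarrow> complex) \<Rightarrow> bool"
  where "tends_compactly_to_0 u \<longleftrightarrow>
    (\<forall>K \<epsilon>. compact K \<longrightarrow> \<epsilon> > 0 \<longrightarrow> (\<forall>\<^sub>F n in sequentially. \<forall>x\<in>K. cmod (u n x) < \<epsilon>))"

lemma tends_compactly_to_0D:
  "tends_compactly_to_0 u \<Longrightarrow> compact K \<Longrightarrow> \<epsilon> > 0 \<Longrightarrow> \<forall>\<^sub>F n in sequentially. \<forall>x\<in>K. cmod (u n x) < \<epsilon>"
  by (simp add: tends_compactly_to_0_def)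

lemma tends_compactly_to_0_add:
  fixes u v :: "nat \<Rightarrow> 'e::complex_lcs \<Rightarrow> complex"
  assumes "tends_compactly_to_0 u" "tends_compactly_to_0 v"
  shows "tends_compactly_to_0 (\<lambda>n x. u n x + v n x)"
  unfolding tends_compactly_to_0_def
proof (intro allI impI)
  fix K :: "'e set" and \<epsilon> :: real assume K: "compact K" "\<epsilon> > 0"
  then have "\<epsilon> / 2 > 0" by simp
  from tends_compactly_to_0D[OF assms(1) K(1) this] tends_compactly_to_0D[OF assms(2) K(1) this]
  show "\<forall>\<^sub>F n in sequentially. \<forall>x\<in>K. cmod (u n x + v n x) < \<epsilon>"
  proof eventually_elim
    case (elim n)
    show ?case
    proof
      fix x assume "x \<in> K"
      then have "cmod (u n x) < \<epsilon> / 2" "cmod (v n x) < \<epsilon> / 2" using elim by auto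
      then show "cmod (u n x + v n x) < \<epsilon>"
        using norm_triangle_ineq[of "u n x" "v n x"] by simp
    qed
  qed
qed

lemma tends_compactly_to_0_geometric:
  fixes g :: "'e::complex_lcs \<Rightarrow> complex"
  assumes q: "cmod q < 1" and g: "g \<in> \<H>"
  shows "tends_compactly_to_0 (\<lambda>n x. c * q ^ n * g x)"
  unfolding tends_compactly_to_0_def
proof (intro allI impI)
  fix K :: "'e set" and \<epsilon> :: real assume K: "compact K" "\<epsilon> > 0"
  obtain C where C: "C > 0" "\<And>x. x \<in> K \<Longrightarrow> cmod (g x) \<le> C"
    by (rule holomorphic_functions_bounded_on_compact[OF g K(1)]) (rule that)
  have "(\<lambda>n. cmod c * cmod q ^ n * C) \<longlonglongrightarrow> cmod c * 0 * C"
    using q by (intro tendsto_intros LIMSEQ_realpow_zero) auto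
  then have "\<forall>\<^sub>F n in sequentially. cmod c * cmod q ^ n * C < \<epsilon>"
    using K(2) by (intro order_tendstoD) auto
  then show "\<forall>\<^sub>F n in sequentially. \<forall>x\<in>K. cmod (c * q ^ n * g x) < \<epsilon>"
  proof eventually_elim
    case (elim n)
    show ?case
    proof
      fix x assume "x \<in> K"
      have "cmod (c * q ^ n * g x) \<le> cmod c * cmod q ^ n * C"
        unfolding norm_mult norm_power using C(2)[OF \<open>x \<in> K\<close>] by (intro mult_left_mono) auto
      then show "cmod (c * q ^ n * g x) < \<epsilon>" using elim by linarith
    qed
  qed
qed

lemma convolution_operator_funpow_step:
  fixes L :: "('e::complex_lcs \<Rightarrow> complex) \<Rightarrow> 'e \<Rightarrow> complex"
  assumes L: "convolution_operator L" and \<eta>: "\<eta> \<in> continuous_dual" and f: "f \<in> \<H>"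
  shows "(L ^^ n) (\<lambda>x. c * exp (\<eta> x) + f x) = (\<lambda>x. c * symbol L \<eta> ^ n * exp (\<eta> x) + (L ^^ n) f x)"
proof -
  note CL = convolution_operator_continuous_linear[OF L]
  note CLn = continuous_linear_operator_funpow[OF CL, of n]
  have exp: "(L ^^ n) (\<lambda>x. exp (\<eta> x)) = (\<lambda>x. symbol L \<eta> ^ n * exp (\<eta> x))" for n
  proof (induction n)
    case (Suc n)
    have "L (\<lambda>x. symbol L \<eta> ^ n * exp (\<eta> x)) = (\<lambda>x. symbol L \<eta> ^ n * L (\<lambda>x. exp (\<eta> x)) x)"
      by (rule continuous_linear_operatorD(3)[OF CL exp_dual_holomorphic[OF \<eta>]])
    then show ?case
      by (simp add: Suc convolution_operator_exp[OF L \<eta>] mult_ac)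
  qed simp
  have "(L ^^ n) (\<lambda>x. c * exp (\<eta> x) + f x) = (\<lambda>x. (L ^^ n) (\<lambda>x. c * exp (\<eta> x)) x + (L ^^ n) f x)"
    by (rule continuous_linear_operatorD(2)[OF CLn holomorphic_functions_cmult[OF exp_dual_holomorphic[OF \<eta>]] f])
  also have "(L ^^ n) (\<lambda>x. c * exp (\<eta> x)) = (\<lambda>x. c * (L ^^ n) (\<lambda>x. exp (\<eta> x)) x)"
    by (rule continuous_linear_operatorD(3)[OF CLn exp_dual_holomorphic[OF \<eta>]])
  finally show ?thesis by (simp add: exp mult.assoc)
qed

lemma exp_span_contracted:
  fixes L :: "('e::complex_lcs \<Rightarrow> complex) \<Rightarrow> 'e \<Rightarrow> complex"
  assumes L: "convolution_operator L"
    and f: "f \<in> exp_span {\<eta> \<in> continuous_dual. cmod (symbol L \<eta>) < 1}"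
  shows "tends_compactly_to_0 (\<lambda>n. (L ^^ n) f)"
  using f
proof induction
  case zero
  have "(L ^^ n) (\<lambda>x. 0) = (\<lambda>x. 0)" for n
    using continuous_linear_operatorD(3)[OF convolution_operator_iterate[OF L] holomorphic_functions_const[of 0], of n 0] by simp
  then show ?case by (simp add: tends_compactly_to_0_def)
next
  case (step \<eta> f c)
  have "f \<in> \<H>" by (rule exp_span_holomorphic[OF _ step(2)]) auto
  then have "(\<lambda>n. (L ^^ n) (\<lambda>x. c * exp (\<eta> x) + f x)) = (\<lambda>n x. c * symbol L \<eta> ^ n * exp (\<eta> x) + (L ^^ n) f x)"
    using step(1) by (simp add: convolution_operator_funpow_step[OF L])
  moreover have "tends_compactly_to_0 (\<lambda>n x. c * symbol L \<eta> ^ n * exp (\<eta> x) + (L ^^ n) f x)"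
    using step(1) by (intro tends_compactly_to_0_add tends_compactly_to_0_geometric exp_dual_holomorphic step(3)) auto
  ultimately show ?case by simp
qed

text \<open>
  On the span of eigenvectors with eigenvalues of modulus greater than 1 the iterates have right
  inverses, and these tend to 0.
\<close>

lemma exp_span_expanded:
  fixes L :: "('e::complex_lcs \<Rightarrow> complex) \<Rightarrow> 'e \<Rightarrow> complex"
  assumes L: "convolution_operator L"
    and g: "g \<in> exp_span {\<eta> \<in> continuous_dual. cmod (symbol L \<eta>) > 1}"
  shows "\<exists>v. (\<forall>n. v n \<in> \<H> \<and> (L ^^ n) (v n) = g) \<and> tends_compactly_to_0 v"
  using g
proof induction
  case zero
  have "(L ^^ n) (\<lambda>x. 0) = (\<lambda>x. 0)" for n
    using continuous_linear_operatorD(3)[OF convolution_operator_iterate[OF L] holomorphic_functions_const[of 0], of n 0] by simp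
  then show ?case
    by (intro exI[of _ "\<lambda>n x. 0"]) (auto simp: tends_compactly_to_0_def holomorphic_functions_const)
next
  case (step \<eta> g c)
  then obtain v where v: "\<And>n. v n \<in> \<H>" "\<And>n. (L ^^ n) (v n) = g" "tends_compactly_to_0 v"
    by blast
  have \<eta>: "\<eta> \<in> continuous_dual" "cmod (symbol L \<eta>) > 1" using step(1) by auto
  then have nz: "symbol L \<eta> \<noteq> 0" by auto
  define w where "w n x = c * inverse (symbol L \<eta>) ^ n * exp (\<eta> x) + v n x" for n x
  have "w n \<in> \<H>" for n
    unfolding w_def by (rule holomorphic_functions_add[OF holomorphic_functions_cmult[OF exp_dual_holomorphic[OF \<eta>(1)]] v(1)])
  moreover have "(L ^^ n) (w n) = (\<lambda>x. c * exp (\<eta> x) + g x)" for n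
    unfolding w_def convolution_operator_funpow_step[OF L \<eta>(1) v(1)] v(2)
    using nz by (simp add: power_inverse mult.assoc)
  moreover have "tends_compactly_to_0 w"
    unfolding w_def
    by (intro tends_compactly_to_0_add tends_compactly_to_0_geometric exp_dual_holomorphic \<eta>(1) v(3))
      (use \<eta>(2) nz in \<open>simp add: norm_inverse inverse_less_1_iff\<close>)
  ultimately show ?case by blast
qed

lemma exp_span_dense_at_symbol:
  fixes L :: "('e::complex_lcs \<Rightarrow> complex) \<Rightarrow> 'e \<Rightarrow> complex"
  assumes appr: "finite_rank_approximation (continuous_dual :: ('e \<Rightarrow> complex) set)"
    and L: "convolution_operator L" and \<eta>: "\<eta> \<in> continuous_dual"
    and B: "open B" "symbol L \<eta> \<in> B"
    and f: "f \<in> \<H>"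
  shows "approximable (exp_span {\<eta> \<in> continuous_dual. symbol L \<eta> \<in> B}) f"
proof -
  have "compact_open_closure (exp_span {\<eta> \<in> continuous_dual. symbol L \<eta> \<in> B}) = \<H>"
  proof (rule exponentials_dense[OF appr])
    show "\<eta> \<in> {\<eta> \<in> continuous_dual. symbol L \<eta> \<in> B}" using \<eta> B by simp
    fix \<theta> :: "'e \<Rightarrow> complex" assume \<theta>: "\<theta> \<in> continuous_dual"
    have "continuous_on UNIV (\<lambda>t. symbol L (\<lambda>x. \<eta> x + t * \<theta> x))"
      by (intro holomorphic_on_imp_continuous_on symbol_holomorphic_on_lines L \<eta> \<theta>)
    then have "open ((\<lambda>t. symbol L (\<lambda>x. \<eta> x + t * \<theta> x)) -` B)"
      using B(1) by (rule open_vimage[rotated])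
    moreover have "0 \<in> (\<lambda>t. symbol L (\<lambda>x. \<eta> x + t * \<theta> x)) -` B"
      using B(2) by simp
    ultimately obtain \<delta> where "\<delta> > 0" "ball 0 \<delta> \<subseteq> (\<lambda>t. symbol L (\<lambda>x. \<eta> x + t * \<theta> x)) -` B"
      using open_contains_ball by blast
    then show "\<exists>\<delta>>0. \<forall>t. cmod t < \<delta> \<longrightarrow> (\<lambda>x. \<eta> x + t * \<theta> x) \<in> {\<eta> \<in> continuous_dual. symbol L \<eta> \<in> B}"
      using continuous_dual_combination[OF \<eta> \<theta>] by (intro exI[of _ \<delta>]) (auto simp: subset_iff)
  qed auto
  with f show ?thesis by (auto simp: compact_open_closure_def)
qed

text \<open>
  The eigenvector criterion of Godefroy and Shapiro. Approximate \<open>f\<close> by a combination \<open>f'\<close> of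
  eigenvectors with eigenvalues of modulus less than 1, and \<open>g\<close> by a combination \<open>g'\<close> of eigenvectors
  with eigenvalues of modulus greater than 1. If \<open>v n\<close> is the preimage of \<open>g'\<close> under the \<open>n\<close>-th
  iterate, then \<open>f' + v n\<close> tends to \<open>f'\<close>, and its image under this iterate tends to \<open>g'\<close>.
\<close>

theorem convolution_operator_mixing_quantitative:
  fixes L :: "('e::complex_lcs \<Rightarrow> complex) \<Rightarrow> 'e \<Rightarrow> complex"
  assumes appr: "finite_rank_approximation (continuous_dual :: ('e \<Rightarrow> complex) set)"
    and L: "convolution_operator L" and nontriv: "nontrivial_operator L"
    and f: "f \<in> \<H>" and g: "g \<in> \<H>"
    and K: "compact K" and eps: "\<epsilon> > 0"
  shows "\<forall>\<^sub>F n in sequentially. \<exists>u\<in>\<H>.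
    (\<forall>x\<in>K. cmod (u x - f x) < \<epsilon>) \<and> (\<forall>x\<in>K. cmod ((L ^^ n) u x - g x) < \<epsilon>)"
proof -
  obtain \<eta> \<eta>' where \<eta>: "\<eta> \<in> continuous_dual" "cmod (symbol L \<eta>) < 1"
    "\<eta>' \<in> continuous_dual" "cmod (symbol L \<eta>') > 1"
    by (rule symbol_small_and_large[OF appr L nontriv]) (rule that)
  define W where "W = {\<eta> \<in> continuous_dual. cmod (symbol L \<eta>) < 1}"
  define W' where "W' = {\<eta> \<in> continuous_dual. cmod (symbol L \<eta>) > 1}"
  have "open {z. cmod z < 1}" "open {z::complex. cmod z > 1}"
    by (intro open_Collect_less continuous_intros)+
  then have "approximable (exp_span W) f" "approximable (exp_span W') g"
    using exp_span_dense_at_symbol[OF appr L \<eta>(1) _ _ f, of "{z. cmod z < 1}"]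
      exp_span_dense_at_symbol[OF appr L \<eta>(3) _ _ g, of "{z. cmod z > 1}"] \<eta>(2,4)
    by (auto simp: W_def W'_def)
  note appr_f = this(1) and appr_g = this(2)
  have eps2: "\<epsilon> / 2 > 0" using eps by simp
  obtain f' where f': "f' \<in> exp_span W" "\<And>x. x \<in> K \<Longrightarrow> cmod (f' x - f x) < \<epsilon> / 2"
    by (rule approximableD[OF appr_f K eps2]) (rule that)
  obtain g' where g': "g' \<in> exp_span W'" "\<And>x. x \<in> K \<Longrightarrow> cmod (g' x - g x) < \<epsilon> / 2"
    by (rule approximableD[OF appr_g K eps2]) (rule that)
  obtain v where v: "\<And>n. v n \<in> \<H>" "\<And>n. (L ^^ n) (v n) = g'" "tends_compactly_to_0 v"
    using exp_span_expanded[OF L g'(1)[unfolded W'_def]] by blast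
  have f'H: "f' \<in> \<H>"
    by (rule exp_span_holomorphic[OF _ f'(1)]) (auto simp: W_def)
  have "tends_compactly_to_0 (\<lambda>n. (L ^^ n) f')"
    by (rule exp_span_contracted[OF L f'(1)[unfolded W_def]])
  from tends_compactly_to_0D[OF this K eps2] tends_compactly_to_0D[OF v(3) K eps2]
  show ?thesis
  proof eventually_elim
    case (elim n)
    have "(L ^^ n) (\<lambda>x. f' x + v n x) = (\<lambda>x. (L ^^ n) f' x + g' x)"
      using continuous_linear_operatorD(2)[OF convolution_operator_iterate[OF L] f'H v(1)] v(2) by simp
    moreover have "cmod (f' x + v n x - f x) < \<epsilon>" if "x \<in> K" for x
      using norm_triangle_ineq[of "f' x - f x" "v n x"] f'(2)[OF that] bspec[OF elim(2) that]
      by (simp add: algebra_simps)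
    moreover have "cmod ((L ^^ n) f' x + g' x - g x) < \<epsilon>" if "x \<in> K" for x
      using norm_triangle_ineq[of "(L ^^ n) f' x" "g' x - g x"] g'(2)[OF that] bspec[OF elim(1) that]
      by (simp add: algebra_simps)
    ultimately show ?case
      using holomorphic_functions_add[OF f'H v(1)] by (intro bexI[of _ "\<lambda>x. f' x + v n x"]) auto
  qed
qed

theorem convolution_operator_mixing:
  fixes L :: "('e::complex_lcs \<Rightarrow> complex) \<Rightarrow> 'e \<Rightarrow> complex"
  assumes appr: "finite_rank_approximation (continuous_dual :: ('e \<Rightarrow> complex) set)"
    and L: "convolution_operator L" and nontriv: "nontrivial_operator L"
  shows "mixing compact_open_topology L"
  unfolding mixing_def
proof (intro allI impI)
  fix U V :: "('e \<Rightarrow> complex) set"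
  assume UV: "openin compact_open_topology U \<and> U \<noteq> {} \<and> openin compact_open_topology V \<and> V \<noteq> {}"
  then obtain f g where fg: "f \<in> U" "g \<in> V" by blast
  have U: "openin compact_open_topology U" and V: "openin compact_open_topology V" using UV by auto
  have fgH: "f \<in> \<H>" "g \<in> \<H>"
    using fg openin_subset[OF U] openin_subset[OF V] by auto
  obtain K \<epsilon> where K: "compact K" "\<epsilon> > 0"
    "\<And>h. h \<in> \<H> \<Longrightarrow> \<forall>x\<in>K. cmod (h x - f x) < \<epsilon> \<Longrightarrow> h \<in> U"
    by (rule compact_open_nbhd[OF U fg(1)]) (rule that)
  obtain K' \<epsilon>' where K': "compact K'" "\<epsilon>' > 0"
    "\<And>h. h \<in> \<H> \<Longrightarrow> \<forall>x\<in>K'. cmod (h x - g x) < \<epsilon>' \<Longrightarrow> h \<in> V"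
    by (rule compact_open_nbhd[OF V fg(2)]) (rule that)
  have "compact (K \<union> K')" "min \<epsilon> \<epsilon>' > 0" using K K' by auto
  from convolution_operator_mixing_quantitative[OF appr L nontriv fgH this]
  obtain n0 where n0: "\<And>n. n \<ge> n0 \<Longrightarrow> \<exists>u\<in>\<H>.
    (\<forall>x\<in>K \<union> K'. cmod (u x - f x) < min \<epsilon> \<epsilon>') \<and> (\<forall>x\<in>K \<union> K'. cmod ((L ^^ n) u x - g x) < min \<epsilon> \<epsilon>')"
    unfolding eventually_sequentially by blast
  show "\<exists>n\<^sub>0. \<forall>n\<ge>n\<^sub>0. (L ^^ n) ` U \<inter> V \<noteq> {}"
  proof (intro exI allI impI)
    fix n assume "n \<ge> n0"
    from n0[OF this] obtain u where u: "u \<in> \<H>"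
      "\<forall>x\<in>K \<union> K'. cmod (u x - f x) < min \<epsilon> \<epsilon>'" "\<forall>x\<in>K \<union> K'. cmod ((L ^^ n) u x - g x) < min \<epsilon> \<epsilon>'"
      by blast
    have "u \<in> U" using u(2) by (intro K(3) u(1)) auto
    moreover have "(L ^^ n) u \<in> V"
      using u(3) by (intro K'(3) continuous_linear_operatorD(1)[OF convolution_operator_iterate[OF L] u(1)]) auto
    ultimately show "(L ^^ n) ` U \<inter> V \<noteq> {}" by blast
  qed
qed

section \<open>Completeness and the Baire property\<close>

text \<open>
  The sequence makes the space hemicompact, and the last condition makes it a k-space as far as
  scalar functions are concerned. Together they make the holomorphic functions a Frechet space in the
  compact-open topology.
\<close>

definition compact_exhaustion :: "(nat \<Rightarrow> 'e::complex_lcs set) \<Rightarrow> bool"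
  where "compact_exhaustion K \<longleftrightarrow>
    (\<forall>n. compact (K n)) \<and> (\<forall>n. K n \<subseteq> K (Suc n)) \<and> (\<forall>C. compact C \<longrightarrow> (\<exists>n. C \<subseteq> K n)) \<and>
    (\<forall>f::'e \<Rightarrow> complex. (\<forall>n. continuous_on (K n) f) \<longrightarrow> continuous_on UNIV f)"

lemma compact_exhaustion_mono: "compact_exhaustion K \<Longrightarrow> m \<le> n \<Longrightarrow> K m \<subseteq> K n"
  by (rule lift_Suc_mono_le) (auto simp: compact_exhaustion_def)

lemma compact_exhaustion_absorbs:
  assumes "compact_exhaustion K" "compact C"
  obtains n where "C \<subseteq> K n"
proof -
  have "\<exists>n. C \<subseteq> K n" using assms by (simp add: compact_exhaustion_def)
  then show thesis using that by (elim exE)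
qed

text \<open>
  A locally uniform limit on complex lines is holomorphic by Weierstrass's theorem. The limit is
  continuous on each member of the exhaustion only; passing to the whole space is the one place
  where the k-space condition is needed.
\<close>

lemma holomorphic_functions_complete:
  fixes f :: "nat \<Rightarrow> 'e::complex_lcs \<Rightarrow> complex"
  assumes K: "compact_exhaustion (K :: nat \<Rightarrow> 'e set)" and f: "\<And>i. f i \<in> \<H>"
    and cauchy: "\<And>n. uniformly_Cauchy_on (K n) f"
  obtains g where "g \<in> \<H>" "\<And>n. uniform_limit (K n) f g sequentially"
proof -
  define g where "g x = lim (\<lambda>i. f i x)" for x
  have lim: "uniform_limit (K n) f g sequentially" for n
    using Cauchy_uniformly_convergent[OF cauchy[of n]]
    by (simp add: uniformly_convergent_uniform_limit_iff g_def[abs_def])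
  have "continuous_on (K n) g" for n
    by (rule uniform_limit_theorem[OF always_eventually[OF allI[OF holomorphic_functions_continuous[OF f]]] lim]) simp
  then have "continuous_on UNIV g"
    using K by (simp add: compact_exhaustion_def)
  moreover have "(\<lambda>z. g (a + scaleC z b)) holomorphic_on UNIV" for a b
  proof (rule holomorphic_uniform_sequence[where f = "\<lambda>i z. f i (a + scaleC z b)"])
    show "(\<lambda>z. f i (a + scaleC z b)) holomorphic_on UNIV" for i
      by (rule holomorphic_functions_on_line[OF f])
    fix z :: complex
    have "compact ((\<lambda>z. a + scaleC z b) ` cball z 1)"
      by (intro compact_continuous_image continuous_on_add continuous_on_const continuous_on_scaleC
          continuous_on_id compact_cball)
    then obtain n where n: "(\<lambda>z. a + scaleC z b) ` cball z 1 \<subseteq> K n"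
      by (rule compact_exhaustion_absorbs[OF K])
    have "uniform_limit (cball z 1) (\<lambda>i z. f i (a + scaleC z b)) (\<lambda>z. g (a + scaleC z b)) sequentially"
      unfolding uniform_limit_iff
    proof (intro allI impI)
      fix e :: real assume "e > 0"
      then have "\<forall>\<^sub>F i in sequentially. \<forall>x\<in>K n. dist (f i x) (g x) < e"
        using lim[of n] unfolding uniform_limit_iff by blast
      then show "\<forall>\<^sub>F i in sequentially. \<forall>x\<in>cball z 1. dist (f i (a + scaleC x b)) (g (a + scaleC x b)) < e"
        by eventually_elim (use n in blast)
    qed
    then show "\<exists>d>0. cball z d \<subseteq> UNIV \<and>
        uniform_limit (cball z d) (\<lambda>i z. f i (a + scaleC z b)) (\<lambda>z. g (a + scaleC z b)) sequentially"
      by (intro exI[of _ 1]) auto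
  qed auto
  ultimately show thesis
    using that[of g] lim by (simp add: holomorphic_functions_def)
qed

text \<open>
  Baire's theorem, by the usual nested closed balls. A triple \<open>(f, m, \<epsilon>)\<close> stands for the ball with
  centre \<open>f\<close> and radius \<open>\<epsilon>\<close> with respect to the supremum over the \<open>m\<close>-th compact set.
\<close>

lemma compact_open_baire:
  fixes G :: "nat \<Rightarrow> ('e::complex_lcs \<Rightarrow> complex) set"
  assumes K: "compact_exhaustion (K :: nat \<Rightarrow> 'e set)"
    and op: "\<And>j. openin compact_open_topology (G j)"
    and dense: "\<And>j f. f \<in> \<H> \<Longrightarrow> approximable (G j) f"
  shows "\<exists>f. \<forall>j. f \<in> G j"
proof -
  define B where "B s = {g \<in> \<H>. \<forall>x\<in>K (fst (snd s)). cmod (g x - fst s x) \<le> snd (snd s)}"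
    for s :: "('e \<Rightarrow> complex) \<times> nat \<times> real"
  (* The index of the compact set must grow and the radii must tend to 0, so that the centres
     form a Cauchy sequence on every compact set. *)
  define P where "P j s \<longleftrightarrow> fst s \<in> \<H> \<and> fst (snd s) \<ge> j \<and> snd (snd s) > 0 \<and> snd (snd s) \<le> (1/2) ^ j"
    for j and s :: "('e \<Rightarrow> complex) \<times> nat \<times> real"
  have "\<exists>s. \<forall>j. P j (s j) \<and> B (s (Suc j)) \<subseteq> B (s j) \<inter> G j"
  proof (rule dependent_nat_choice)
    show "\<exists>s. P 0 s"
      by (intro exI[of _ "(\<lambda>x. 0, 0, 1)"]) (simp add: P_def holomorphic_functions_const)
  next
    fix s j assume s: "P j s"
    obtain f m \<epsilon> where s_eq: "s = (f, m, \<epsilon>)" by (cases s) auto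
    have f: "f \<in> \<H>" "\<epsilon> > 0" using s by (auto simp: P_def s_eq)
    have cK: "compact (K m)" using K by (simp add: compact_exhaustion_def)
    obtain g where g: "g \<in> G j" "\<And>x. x \<in> K m \<Longrightarrow> cmod (g x - f x) < \<epsilon> / 2"
      by (rule approximableD[OF dense[OF f(1), of j] cK, of "\<epsilon> / 2"]) (use f(2) in auto)
    have gH: "g \<in> \<H>" using g(1) openin_subset[OF op] by auto
    obtain C \<delta> where C: "compact C" "\<delta> > 0"
      "\<And>h. h \<in> \<H> \<Longrightarrow> \<forall>x\<in>C. cmod (h x - g x) < \<delta> \<Longrightarrow> h \<in> G j"
      by (rule compact_open_nbhd[OF op g(1)]) (rule that)
    obtain n where n: "C \<subseteq> K n" by (rule compact_exhaustion_absorbs[OF K C(1)])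
    define m' where "m' = max (max m (Suc j)) n"
    define \<epsilon>' where "\<epsilon>' = min (min (\<epsilon> / 2) (\<delta> / 2)) ((1/2) ^ Suc j)"
    have \<epsilon>': "\<epsilon>' > 0" "\<epsilon>' \<le> \<epsilon> / 2" "\<epsilon>' < \<delta>" "\<epsilon>' \<le> (1/2) ^ Suc j"
      using f(2) C(2) by (auto simp: \<epsilon>'_def)
    have sub: "K m \<subseteq> K m'" "K n \<subseteq> K m'"
      by (intro compact_exhaustion_mono[OF K]; simp add: m'_def)+
    have "B (g, m', \<epsilon>') \<subseteq> B s \<inter> G j"
    proof
      fix h assume "h \<in> B (g, m', \<epsilon>')"
      then have h: "h \<in> \<H>" "\<And>x. x \<in> K m' \<Longrightarrow> cmod (h x - g x) \<le> \<epsilon>'"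
        by (auto simp: B_def)
      have "cmod (h x - f x) \<le> \<epsilon>" if "x \<in> K m" for x
        using h(2)[of x] g(2)[OF that] sub(1) that \<epsilon>'(2) norm_triangle_ineq[of "h x - g x" "g x - f x"]
        by (auto simp: subset_iff)
      moreover have "h \<in> G j"
        by (intro C(3) h(1) ballI order.strict_trans1[OF h(2) \<epsilon>'(3)]) (use n sub(2) in auto)
      ultimately show "h \<in> B s \<inter> G j" using h(1) by (simp add: B_def s_eq)
    qed
    moreover have "P (Suc j) (g, m', \<epsilon>')"
      using gH \<epsilon>' by (simp add: P_def m'_def)
    ultimately show "\<exists>s'. P (Suc j) s' \<and> B s' \<subseteq> B s \<inter> G j" by blast
  qed
  then obtain s where s: "\<And>j. P j (s j)" "\<And>j. B (s (Suc j)) \<subseteq> B (s j) \<inter> G j" by blast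
  define f where "f j = fst (s j)" for j
  have fH: "f j \<in> \<H>" for j using s(1)[of j] by (simp add: P_def f_def)
  have Bmono: "B (s i) \<subseteq> B (s j)" if "j \<le> i" for i j
    by (rule lift_Suc_antimono_le[of "\<lambda>j. B (s j)", OF _ that]) (use s(2) in blast)
  have fB: "f i \<in> B (s j)" if "j \<le> i" for i j
  proof -
    have "f i \<in> B (s i)" using s(1)[of i] fH[of i] by (simp add: B_def f_def P_def)
    then show ?thesis using Bmono[OF that] by blast
  qed
  have fB': "cmod (f i x - f j x) \<le> snd (snd (s j))" if "j \<le> i" "x \<in> K (fst (snd (s j)))" for i j x
    using fB[OF that(1)] that(2) by (simp add: B_def f_def)
  have "uniformly_Cauchy_on (K n) f" for n
    unfolding uniformly_Cauchy_on_def
  proof (intro allI impI)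
    fix e :: real assume e: "e > 0"
    have "(\<lambda>j. 2 * (1/2::real) ^ j) \<longlonglongrightarrow> 2 * 0"
      by (intro tendsto_intros LIMSEQ_realpow_zero) auto
    then have "\<forall>\<^sub>F j in sequentially. 2 * (1/2::real) ^ j < e \<and> j \<ge> n"
      using e by (intro eventually_conj eventually_ge_at_top order_tendstoD) auto
    then obtain j where j: "2 * (1/2::real) ^ j < e" "j \<ge> n"
      unfolding eventually_sequentially by blast
    have "dist (f i x) (f i' x) < e" if "x \<in> K n" "i \<ge> j" "i' \<ge> j" for x i i'
    proof -
      have "K n \<subseteq> K (fst (snd (s j)))"
        using s(1)[of j] j(2) by (intro compact_exhaustion_mono[OF K]) (simp add: P_def)
      then have x: "x \<in> K (fst (snd (s j)))" using that by blast
      have "dist (f i x) (f i' x) \<le> snd (snd (s j)) + snd (snd (s j))"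
        using fB'[OF that(2) x] fB'[OF that(3) x] dist_triangle2[of "f i x" "f i' x" "f j x"]
        by (simp add: dist_norm)
      also have "\<dots> \<le> 2 * (1/2) ^ j"
        using s(1)[of j] by (simp add: P_def)
      finally show ?thesis using j(1) by simp
    qed
    then show "\<exists>M. \<forall>x\<in>K n. \<forall>m\<ge>M. \<forall>n\<ge>M. dist (f m x) (f n x) < e" by blast
  qed
  then obtain g where g: "g \<in> \<H>" "\<And>n. uniform_limit (K n) f g sequentially"
    using holomorphic_functions_complete[of K f, OF K fH] by blast
  have "g \<in> B (s j)" for j
  proof -
    have "cmod (g x - f j x) \<le> snd (snd (s j))" if x: "x \<in> K (fst (snd (s j)))" for x
    proof (rule tendsto_upperbound)
      show "(\<lambda>i. cmod (f i x - f j x)) \<longlonglongrightarrow> cmod (g x - f j x)"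
        by (intro tendsto_intros tendsto_uniform_limitI[OF g(2) x])
      show "\<forall>\<^sub>F i in sequentially. cmod (f i x - f j x) \<le> snd (snd (s j))"
        using eventually_ge_at_top[of j] by eventually_elim (rule fB'[OF _ x])
    qed simp
    then show ?thesis using g(1) by (simp add: B_def f_def)
  qed
  then have "g \<in> G j" for j using s(2)[of j] by blast
  then show ?thesis by blast
qed

section \<open>Separability of the space of holomorphic functions\<close>

text \<open>
  The polynomials in the functionals of \<open>\<Psi>\<close> with coefficients in the Gaussian rationals. A
  polynomial is coded as a list of monomials, each of them a coefficient with a list of functionals,
  so that there are only countably many of them.
\<close>

lemma countable_dense_polynomials:
  assumes appr: "finite_rank_approximation (\<Psi> :: ('e::complex_lcs \<Rightarrow> complex) set)" and \<Psi>: "countable \<Psi>"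
  obtains D :: "('e::complex_lcs \<Rightarrow> complex) set"
  where "countable D" "D \<subseteq> \<H>"
    "\<And>f. f \<in> \<H> \<Longrightarrow> approximable D f"
proof -
  define Q where "Q = (\<lambda>(a, b). Complex (of_rat a) (of_rat b)) ` UNIV"
  have Q: "\<exists>q\<in>Q. cmod (q - c) < \<epsilon>" if eps: "\<epsilon> > 0" for c \<epsilon>
  proof -
    obtain a where a: "Re c - \<epsilon> / 2 < of_rat a" "of_rat a < Re c + \<epsilon> / 2"
      using of_rat_dense[of "Re c - \<epsilon> / 2" "Re c + \<epsilon> / 2"] eps by auto
    obtain b where b: "Im c - \<epsilon> / 2 < of_rat b" "of_rat b < Im c + \<epsilon> / 2"
      using of_rat_dense[of "Im c - \<epsilon> / 2" "Im c + \<epsilon> / 2"] eps by auto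
    have "cmod (Complex (of_rat a) (of_rat b) - c) \<le> \<bar>of_rat a - Re c\<bar> + \<bar>of_rat b - Im c\<bar>"
      using cmod_le[of "Complex (of_rat a) (of_rat b) - c"] by simp
    also have "\<dots> < \<epsilon>" using a b by (auto simp: abs_if)
    finally show ?thesis by (auto simp: Q_def intro!: bexI[of _ "Complex (of_rat a) (of_rat b)"])
  qed
  define ev where "ev ts x = (\<Sum>(q, \<psi>s)\<leftarrow>ts. q * (\<Prod>\<psi>\<leftarrow>\<psi>s. \<psi> x))"
    for ts :: "(complex \<times> ('e \<Rightarrow> complex) list) list" and x :: 'e
  define D where "D = ev ` lists (Q \<times> lists \<Psi>)"
  have "countable Q" unfolding Q_def by (intro countable_image countableI_type)
  then have D1: "countable D"
    unfolding D_def by (intro countable_image countable_lists countable_SIGMA \<Psi>)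
  have \<Psi>H: "\<psi> \<in> \<H>" if "\<psi> \<in> \<Psi>" for \<psi>
    using appr that continuous_dual_imp_holomorphic by (auto simp: finite_rank_approximation_def)
  have prodH: "(\<lambda>x. \<Prod>\<psi>\<leftarrow>\<psi>s. \<psi> x) \<in> \<H>" if "\<psi>s \<in> lists \<Psi>" for \<psi>s
    using that
  proof (induction \<psi>s)
    case Nil
    show ?case by (simp add: holomorphic_functions_const)
  next
    case (Cons \<psi> \<psi>s)
    show ?case using holomorphic_functions_mult[OF \<Psi>H[OF Cons(1)] Cons(3)] by simp
  qed
  have evH: "ev ts \<in> \<H>" if "ts \<in> lists (Q \<times> lists \<Psi>)" for ts
    using that
  proof (induction ts)
    case Nil
    show ?case by (simp add: holomorphic_functions_const ev_def[abs_def])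
  next
    case (Cons t ts)
    obtain q \<psi>s where t: "t = (q, \<psi>s)" "\<psi>s \<in> lists \<Psi>" using Cons(1) by auto
    show ?case
      using holomorphic_functions_add[OF holomorphic_functions_cmult[OF prodH[OF t(2)], of q] Cons(3)]
      by (simp add: ev_def[abs_def] t)
  qed
  then have D2: "D \<subseteq> \<H>" by (auto simp: D_def)
  have D_add: "(\<lambda>x. f x + g x) \<in> D" if fD: "f \<in> D" "g \<in> D" for f g
  proof -
    obtain ts us where "f = ev ts" "g = ev us" "ts \<in> lists (Q \<times> lists \<Psi>)" "us \<in> lists (Q \<times> lists \<Psi>)"
      using fD unfolding D_def by blast
    then show ?thesis
      unfolding D_def by (intro image_eqI[of _ _ "ts @ us"]) (auto simp: ev_def)
  qed
  have D_mult: "(\<lambda>x. \<psi> x * f x) \<in> D" if \<psi>: "\<psi> \<in> \<Psi>" and fD: "f \<in> D" for f \<psi>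
  proof -
    obtain ts where ts: "f = ev ts" "ts \<in> lists (Q \<times> lists \<Psi>)"
      using fD unfolding D_def by blast
    have "(\<lambda>x. \<psi> x * ev ts x) = ev (map (\<lambda>(q, \<psi>s). (q, \<psi> # \<psi>s)) ts)"
    proof
      fix x show "\<psi> x * ev ts x = ev (map (\<lambda>(q, \<psi>s). (q, \<psi> # \<psi>s)) ts) x"
        by (induction ts) (auto simp: ev_def algebra_simps)
    qed
    moreover have "map (\<lambda>(q, \<psi>s). (q, \<psi> # \<psi>s)) ts \<in> lists (Q \<times> lists \<Psi>)"
      using ts(2) \<psi> by (induction ts) auto
    ultimately show ?thesis
      unfolding D_def ts(1) by (rule image_eqI)
  qed
  have Q1: "1 \<in> Q" by (auto simp: Q_def complex_eq_iff intro!: image_eqI[of _ _ "(1, 0)"])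
  have Q_mult: "q * r \<in> Q" if qr: "q \<in> Q" "r \<in> Q" for q r
  proof -
    obtain a b c d where "q = Complex (of_rat a) (of_rat b)" "r = Complex (of_rat c) (of_rat d)"
      using qr by (auto simp: Q_def)
    then show ?thesis
      unfolding Q_def by (intro image_eqI[of _ _ "(a * c - b * d, a * d + b * c)"])
        (auto simp: complex_eq_iff of_rat_add of_rat_mult of_rat_diff)
  qed
  have D_cmult: "(\<lambda>x. q * f x) \<in> D" if q: "q \<in> Q" and fD: "f \<in> D" for f q
  proof -
    obtain ts where ts: "f = ev ts" "ts \<in> lists (Q \<times> lists \<Psi>)"
      using fD unfolding D_def by blast
    have "(\<lambda>x. q * ev ts x) = ev (map (\<lambda>(r, \<psi>s). (q * r, \<psi>s)) ts)"
    proof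
      fix x show "q * ev ts x = ev (map (\<lambda>(r, \<psi>s). (q * r, \<psi>s)) ts) x"
        by (induction ts) (auto simp: ev_def algebra_simps)
    qed
    moreover have "map (\<lambda>(r, \<psi>s). (q * r, \<psi>s)) ts \<in> lists (Q \<times> lists \<Psi>)"
      using ts(2) q by (induction ts) (auto simp: Q_mult)
    ultimately show ?thesis
      unfolding D_def ts(1) by (rule image_eqI)
  qed
  have D_const: "(\<lambda>x. q) \<in> D" if "q \<in> Q" for q
    unfolding D_def using that by (intro image_eqI[of _ _ "[(q, [])]"]) (auto simp: ev_def)
  define A where "A = compact_open_closure D"
  have DA: "D \<subseteq> A" unfolding A_def by (rule compact_open_closure_superset[OF D2])
  have A: "compact_open_closed A" unfolding A_def by (rule compact_open_closed_closure)
  have scaled: "(\<lambda>x. c * g x) \<in> A" if g: "g \<in> D" for c g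
  proof -
    have appr_c: "approximable ((\<lambda>q x. q) ` Q) (\<lambda>x::'e. c)"
      unfolding approximable_def
    proof (intro allI impI)
      fix K :: "'e set" and \<epsilon> :: real assume "\<epsilon> > 0"
      from Q[OF this, of c] obtain q where "q \<in> Q" "cmod (q - c) < \<epsilon>" by (elim bexE)
      then show "\<exists>h\<in>(\<lambda>q x. q) ` Q. \<forall>x\<in>K. cmod (h x - c) < \<epsilon>" by auto
    qed
    have gH: "g \<in> \<H>" using g D2 by (rule subsetD[rotated])
    have "(\<lambda>x. g x * c) \<in> A"
    proof (rule compact_open_closed_mult[OF A holomorphic_functions_const appr_c gH])
      show "(\<lambda>x. g x * h x) \<in> A" if "h \<in> (\<lambda>q x. q) ` Q" for h
        using that subsetD[OF DA D_cmult[OF _ g]] by (auto simp: mult.commute)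
    qed
    then show ?thesis by (simp add: mult.commute)
  qed
  have "A = \<H>"
  proof (rule polynomial_density[OF appr A])
    show "(\<lambda>x. c) \<in> A" for c
      using scaled[of "\<lambda>x. 1" c] D_const[of 1] Q1 by simp
    show "(\<lambda>x. f x + g x) \<in> A" if "f \<in> A" "g \<in> A" for f g
      unfolding A_def by (rule compact_open_closure_add[OF D_add that[unfolded A_def]])
    show "(\<lambda>x. \<psi> x * f x) \<in> A" if "\<psi> \<in> \<Psi>" "f \<in> A" for \<psi> f
    proof (rule compact_open_closed_mult[OF A compact_open_closureD[OF that(2)[unfolded A_def]] \<Psi>H[OF that(1)]])
      show "(\<lambda>x. \<psi> x * g x) \<in> A" if "g \<in> D" for g
        by (rule subsetD[OF DA D_mult[OF \<open>\<psi> \<in> \<Psi>\<close> that]])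
    qed
    show "(\<lambda>x. c * f x) \<in> A" if "f \<in> A" for c f
      by (rule compact_open_closed_mult[OF A compact_open_closureD[OF that[unfolded A_def]]
            holomorphic_functions_const scaled])
  qed
  then have "approximable D f" if "f \<in> \<H>" for f
    using that unfolding A_def compact_open_closure_def by blast
  then show thesis by (rule that[OF D1 D2])
qed

section \<open>Hypercyclicity of convolution operators\<close>

text \<open>
  Birkhoff's transitivity theorem. Density of the orbit of \<open>f\<close> is the conjunction of countably
  many conditions, that the orbit meets the ball of radius \<open>1 / (m + 1)\<close> around \<open>d\<close> with respect to
  the \<open>m\<close>-th compact set, where \<open>d\<close> ranges over a countable dense set. By mixing, each condition
  defines a dense open set.
\<close>

theorem convolution_operator_hypercyclic:
  fixes L :: "('e::complex_lcs \<Rightarrow> complex) \<Rightarrow> 'e \<Rightarrow> complex"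
  assumes appr: "finite_rank_approximation (continuous_dual :: ('e \<Rightarrow> complex) set)"
    and appr': "finite_rank_approximation (\<Psi> :: ('e \<Rightarrow> complex) set)" and \<Psi>: "countable \<Psi>"
    and K: "compact_exhaustion (K :: nat \<Rightarrow> 'e set)"
    and L: "convolution_operator L" and nontriv: "nontrivial_operator L"
  shows "hypercyclic compact_open_topology L"
proof -
  obtain D :: "('e \<Rightarrow> complex) set" where D: "countable D" "D \<subseteq> \<H>"
    "\<And>f. f \<in> \<H> \<Longrightarrow> approximable D f"
    by (rule countable_dense_polynomials[OF appr' \<Psi>]) (rule that)
  have cK: "compact (K m)" for m using K by (simp add: compact_exhaustion_def)
  have cont: "continuous_map compact_open_topology compact_open_topology (L ^^ n)" for n
  proof (induction n)
    case (Suc n)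
    have "continuous_map compact_open_topology compact_open_topology L"
      using L by (simp add: convolution_operator_def)
    from continuous_map_compose[OF Suc this] show ?case by (simp only: funpow.simps)
  qed simp
  define V where "V d m = {g \<in> \<H>. \<exists>s<1 / real (Suc m). \<forall>x\<in>K m. cmod (g x - d x) \<le> s}"
    for d :: "'e \<Rightarrow> complex" and m
  define G where "G p = (\<Union>n. {f \<in> \<H>. (L ^^ n) f \<in> V (fst p) (snd p)})" for p
  have op: "openin compact_open_topology (G p)" for p
    unfolding G_def
  proof (intro openin_Union, safe)
    fix n
    show "openin compact_open_topology {f \<in> \<H>. (L ^^ n) f \<in> V (fst p) (snd p)}"
      using openin_continuous_map_preimage[OF cont[of n] openin_uniformly_close[OF cK[of "snd p"], where \<epsilon> = "1 / real (Suc (snd p))" and f = "fst p"]]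
      unfolding V_def topspace_compact_open_topology .
  qed
  have dense: "approximable (G p) f" if p: "p \<in> D \<times> UNIV" and f: "f \<in> \<H>" for p f
    unfolding approximable_def
  proof (intro allI impI)
    fix C :: "'e set" and \<epsilon> :: real assume C: "compact C" and eps: "\<epsilon> > 0"
    obtain d m where dm: "p = (d, m)" "d \<in> D" using p by auto
    (* The factor 2 leaves the slack that the definition of \<open>V\<close> demands. *)
    define \<epsilon>' where "\<epsilon>' = min \<epsilon> (1 / (2 * real (Suc m)))"
    have \<epsilon>': "\<epsilon>' > 0" using eps by (simp add: \<epsilon>'_def)
    have dH: "d \<in> \<H>" using dm(2) D(2) by blast
    have "compact (C \<union> K m)" using C cK by (rule compact_Un)
    from convolution_operator_mixing_quantitative[OF appr L nontriv f dH this \<epsilon>']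
    obtain n u where u: "u \<in> \<H>" "\<forall>x\<in>C \<union> K m. cmod (u x - f x) < \<epsilon>'"
      "\<forall>x\<in>C \<union> K m. cmod ((L ^^ n) u x - d x) < \<epsilon>'"
      unfolding eventually_sequentially by blast
    have "(L ^^ n) u \<in> \<H>"
      by (rule continuous_linear_operatorD(1)[OF convolution_operator_iterate[OF L] u(1)])
    moreover have "1 / (2 * real (Suc m)) < 1 / real (Suc m)"
      by (simp add: field_simps)
    moreover have "\<forall>x\<in>K m. cmod ((L ^^ n) u x - d x) \<le> 1 / (2 * real (Suc m))"
      using u(3) by (auto simp: \<epsilon>'_def intro: less_imp_le)
    ultimately have "(L ^^ n) u \<in> V d m"
      unfolding V_def by blast
    then have "u \<in> G p" using u(1) by (auto simp: G_def dm(1))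
    moreover have "\<forall>x\<in>C. cmod (u x - f x) < \<epsilon>" using u(2) by (auto simp: \<epsilon>'_def)
    ultimately show "\<exists>g\<in>G p. \<forall>x\<in>C. cmod (g x - f x) < \<epsilon>" by blast
  qed
  have "compact {0::'e}" by simp
  then obtain d where "d \<in> D"
    by (rule approximableD[OF D(3)[OF holomorphic_functions_const] _ zero_less_one])
  then have ne: "D \<times> (UNIV :: nat set) \<noteq> {}" by blast
  have cnt: "countable (D \<times> (UNIV :: nat set))" using D(1) by simp
  have "\<exists>f. \<forall>j. f \<in> G (from_nat_into (D \<times> UNIV) j)"
    by (rule compact_open_baire[OF K op dense[OF from_nat_into[OF ne]]])
  then obtain f where f: "\<And>j. f \<in> G (from_nat_into (D \<times> UNIV) j)" by blast
  have fG: "f \<in> G p" if "p \<in> D \<times> UNIV" for p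
    using f[of "to_nat_on (D \<times> UNIV) p"] from_nat_into_to_nat_on[OF cnt that] by simp
  have fH: "f \<in> \<H>" using subsetD[OF openin_subset[OF op] f[of 0]] by simp
  have orbit: "(L ^^ n) f \<in> \<H>" for n
    by (rule continuous_linear_operatorD(1)[OF convolution_operator_iterate[OF L] fH])
  have "h \<in> compact_open_topology closure_of (range (\<lambda>n. (L ^^ n) f))" if h: "h \<in> \<H>" for h
    unfolding in_closure_of
  proof (intro conjI allI impI)
    show "h \<in> topspace compact_open_topology" using h by simp
    fix T assume "h \<in> T \<and> openin compact_open_topology T"
    then have T: "openin compact_open_topology T" "h \<in> T" by auto
    obtain C \<epsilon> where C: "compact C" "\<epsilon> > 0"
      "\<And>g. g \<in> \<H> \<Longrightarrow> \<forall>x\<in>C. cmod (g x - h x) < \<epsilon> \<Longrightarrow> g \<in> T"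
      by (rule compact_open_nbhd[OF T]) (rule that)
    have eps2: "\<epsilon> / 2 > 0" using C(2) by simp
    obtain k where k: "C \<subseteq> K k" by (rule compact_exhaustion_absorbs[OF K C(1)])
    obtain d where d: "d \<in> D" "\<And>x. x \<in> C \<Longrightarrow> cmod (d x - h x) < \<epsilon> / 2"
      by (rule approximableD[OF D(3)[OF h] C(1) eps2]) (rule that)
    obtain m0 where m0: "inverse (real (Suc m0)) < \<epsilon> / 2"
      using reals_Archimedean[OF eps2] by blast
    define m where "m = max k m0"
    have "1 / real (Suc m) \<le> inverse (real (Suc m0))"
      by (simp add: m_def inverse_eq_divide frac_le)
    with m0 have m: "1 / real (Suc m) < \<epsilon> / 2" by linarith
    have "f \<in> G (d, m)" using d(1) by (intro fG) auto
    then obtain n s where n: "s < 1 / real (Suc m)" "\<And>x. x \<in> K m \<Longrightarrow> cmod ((L ^^ n) f x - d x) \<le> s"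
      by (auto simp: G_def V_def)
    have "K k \<subseteq> K m" by (rule compact_exhaustion_mono[OF K]) (simp add: m_def)
    have "cmod ((L ^^ n) f x - h x) < \<epsilon>" if "x \<in> C" for x
    proof -
      have "x \<in> K m" using that k \<open>K k \<subseteq> K m\<close> by blast
      then show ?thesis
        using n(2)[of x] d(2)[OF that] n(1) m norm_triangle_ineq[of "(L ^^ n) f x - d x" "d x - h x"] by simp
    qed
    then have "(L ^^ n) f \<in> T" by (intro C(3) orbit) blast
    then show "\<exists>y. y \<in> range (\<lambda>n. (L ^^ n) f) \<and> y \<in> T" by blast
  qed
  then have "compact_open_topology closure_of (range (\<lambda>n. (L ^^ n) f)) = topspace compact_open_topology"
    using closure_of_subset_topspace[of compact_open_topology "range (\<lambda>n. (L ^^ n) f)"] by auto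
  then show ?thesis
    unfolding hypercyclic_def using fH by auto
qed

section \<open>Seminorms and nuclear expansions\<close>

lemma complex_seminormD:
  assumes "complex_seminorm p"
  shows "p (x + y) \<le> p x + p y" "p (scaleC c x) = cmod c * p x"
  using assms by (auto simp: complex_seminorm_def)

lemma complex_seminorm_minus: "complex_seminorm p \<Longrightarrow> p (- x) = p x"
  using complex_seminormD(2)[of p "-1" x] by simp

lemma complex_seminorm_nonneg: 
  assumes "complex_seminorm p" shows "p x \<ge> 0"
proof -
  have "p 0 = 0" using complex_seminormD(2)[OF assms, of 0 0] by simp
  then show ?thesis
    using complex_seminormD(1)[OF assms, of x "- x"] complex_seminorm_minus[OF assms, of x] by simp
qed

lemma complex_seminorm_continuous:
  fixes p :: "'a::complex_lcs \<Rightarrow> real"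
  assumes p: "complex_seminorm p"
    and small: "\<And>\<epsilon>. \<epsilon> > 0 \<Longrightarrow> \<exists>N. open N \<and> 0 \<in> N \<and> (\<forall>x\<in>N. p x < \<epsilon>)"
  shows "continuous_on UNIV p"
  unfolding continuous_on_def
proof (intro ballI tendstoI)
  fix x :: 'a and \<epsilon> :: real assume "\<epsilon> > 0"
  from small[OF this] obtain N where N: "open N" "0 \<in> N" "\<forall>x\<in>N. p x < \<epsilon>"
    by (elim exE conjE)
  have "continuous_on UNIV (\<lambda>y. y - x)" by (intro continuous_intros)
  then have "open ((\<lambda>y. y - x) -` N)" using N(1) by (rule open_vimage[rotated])
  then have "\<forall>\<^sub>F y in at x. y \<in> (\<lambda>y. y - x) -` N"
    by (rule eventually_at_in_open') (simp add: N(2))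
  then show "\<forall>\<^sub>F y in at x within UNIV. dist (p y) (p x) < \<epsilon>"
  proof eventually_elim
    case (elim y)
    have "p y \<le> p (y - x) + p x" "p x \<le> p (x - y) + p y"
      using complex_seminormD(1)[OF p, of "y - x" x] complex_seminormD(1)[OF p, of "x - y" y] by auto
    moreover have "p (x - y) = p (y - x)"
      using complex_seminorm_minus[OF p, of "y - x"] by simp
    moreover have "p (y - x) < \<epsilon>" using N(3) elim by simp
    ultimately show ?case by (simp add: dist_real_def abs_if)
  qed
qed

text \<open>
  The Minkowski functional of a convex neighbourhood of 0 need not be compatible with complex
  scalars. It is therefore formed for the subset \<open>B\<close> of the points whose product with the closed
  unit disc stays in the neighbourhood; \<open>B\<close> is convex and balanced, and it is still a neighbourhood
  of 0 by compactness of the disc.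
\<close>

lemma seminorm_in_neighbourhood:
  fixes U :: "'a::complex_lcs set"
  assumes U: "open U" "0 \<in> U"
  obtains p where "complex_seminorm p" "continuous_on UNIV p" "\<And>x. p x < 1 \<Longrightarrow> x \<in> U"
proof -
  obtain V where V: "open V" "convex V" "0 \<in> V" "V \<subseteq> U"
    using locally_convex_convex[OF U] by blast
  define B where "B = {x. \<forall>c. cmod c \<le> 1 \<longrightarrow> scaleC c x \<in> V}"
  have Bsub: "B \<subseteq> V" 
  proof
    fix x assume "x \<in> B"
    then have "cmod 1 \<le> 1 \<longrightarrow> scaleC 1 x \<in> V" unfolding B_def by blast
    then show "x \<in> V" by simp
  qed
  have Bbal: "scaleC c x \<in> B" if "cmod c \<le> 1" "x \<in> B" for c x
    using that by (auto simp: B_def scaleC_scaleC norm_mult mult_le_one)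
  have Bconv: "convex B"
  proof (rule convexI)
    fix x y and u v :: real
    assume xy: "x \<in> B" "y \<in> B" and uv: "0 \<le> u" "0 \<le> v" "u + v = 1"
    have "scaleC c (scaleR u x + scaleR v y) \<in> V" if c: "cmod c \<le> 1" for c
    proof -
      have "scaleR u (scaleC c x) + scaleR v (scaleC c y) \<in> V"
        using xy c by (intro convexD[OF V(2)] uv) (auto simp: B_def)
      then show ?thesis
        by (simp add: scaleC_add_right scaleR_scaleC scaleC_scaleC mult.commute)
    qed
    then show "scaleR u x + scaleR v y \<in> B" by (simp add: B_def)
  qed
  have "open ((\<lambda>z. scaleC (snd z) (fst z)) -` V)"
    by (intro open_vimage V(1) continuous_on_scaleC continuous_intros)
  moreover have "{0} \<times> cball 0 1 \<subseteq> (\<lambda>z. scaleC (snd z) (fst z)) -` V"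
    using V(3) by auto
  ultimately have "\<exists>X. 0 \<in> X \<and> open X \<and> X \<times> cball 0 1 \<subseteq> (\<lambda>z. scaleC (snd z) (fst z)) -` V"
    by (rule Elementary_Topology.tube_lemma[OF compact_cball])
  then obtain X where X: "0 \<in> X" "open X" "X \<times> cball 0 1 \<subseteq> (\<lambda>z. scaleC (snd z) (fst z)) -` V"
    by blast
  have XB: "X \<subseteq> B" using X(3) by (auto simp: B_def subset_iff)
  define M where "M x = {r. r > 0 \<and> scaleR (inverse r) x \<in> B}" for x
  define p where "p x = Inf (M x)" for x
  have near: "open {x. scaleR r x \<in> X}" "0 \<in> {x. scaleR r x \<in> X}" for r
  proof -
    have "continuous_on UNIV (\<lambda>x::'a. scaleR r x)"
      unfolding scaleR_scaleC by (intro continuous_on_scaleC continuous_intros)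
    then show "open {x. scaleR r x \<in> X}"
      using open_vimage[OF X(2)] by (simp add: vimage_def)
    show "0 \<in> {x. scaleR r x \<in> X}" using X(1) by simp
  qed
  have Mne: "M x \<noteq> {}" for x
  proof -
    have "continuous_on UNIV (\<lambda>r::real. scaleR r x)"
      unfolding scaleR_scaleC by (intro continuous_on_scaleC continuous_intros)
    then have "open ((\<lambda>r::real. scaleR r x) -` X)" using X(2) by (rule open_vimage[rotated])
    moreover have "0 \<in> (\<lambda>r::real. scaleR r x) -` X" using X(1) by simp
    ultimately obtain e where e: "e > 0" "ball 0 e \<subseteq> (\<lambda>r::real. scaleR r x) -` X"
      using open_contains_ball by blast
    have "e / 2 \<in> ball 0 e" using e(1) by simp
    then have "scaleR (e / 2) x \<in> B" using e(2) XB by blast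
    then have "2 / e \<in> M x" using e(1) by (simp add: M_def)
    then show ?thesis by blast
  qed
  have Mbdd: "bdd_below (M x)" for x by (rule bdd_belowI[of _ 0]) (auto simp: M_def)
  have pM: "p x \<le> r" if "r \<in> M x" for r x
    unfolding p_def using that Mbdd by (rule cInf_lower)
  have pG: "t \<le> p x" if "\<And>r. r \<in> M x \<Longrightarrow> t \<le> r" for t x
    unfolding p_def using that by (intro cInf_greatest Mne)
  have p0: "p x \<ge> 0" for x by (rule pG) (auto simp: M_def)
  have Mup: "s \<in> M x" if "r \<in> M x" "r \<le> s" for r s x
  proof -
    have r: "r > 0" "scaleR (inverse r) x \<in> B" using that by (auto simp: M_def)
    have "scaleC (of_real (r / s)) (scaleR (inverse r) x) \<in> B"
      using r that(2) by (intro Bbal) (auto simp: norm_divide)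
    then show ?thesis using r that(2) by (simp add: M_def scaleR_scaleC scaleC_scaleC field_simps flip: of_real_mult)
  qed
  have padd: "p (x + y) \<le> p x + p y" for x y
  proof -
    have sum: "p (x + y) \<le> r + s" if r: "r \<in> M x" and s: "s \<in> M y" for r s
    proof (rule pM)
      have rs: "r > 0" "s > 0" using r s by (auto simp: M_def)
      have "scaleR (r / (r + s)) (scaleR (inverse r) x) + scaleR (s / (r + s)) (scaleR (inverse s) y) \<in> B"
        using r s rs by (intro convexD[OF Bconv]) (auto simp: M_def add_divide_distrib[symmetric])
      then have "scaleR (inverse (r + s)) (x + y) \<in> B"
        using rs by (simp add: scaleR_add_right inverse_eq_divide)
      then show "r + s \<in> M (x + y)" using rs by (simp add: M_def)
    qed
    have "p (x + y) - s \<le> p x" if s: "s \<in> M y" for s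
      by (rule pG) (use sum[OF _ s] in \<open>simp add: diff_le_eq\<close>)
    then have "p (x + y) - p x \<le> p y"
      by (intro pG) (simp add: algebra_simps)
    then show ?thesis by simp
  qed
  have pscale_le: "p (scaleC c x) \<le> cmod c * p x" for c x
  proof (cases "c = 0")
    case True
    have "0 \<in> B" using XB X(1) by blast
    then have "p 0 \<le> r" if "r > 0" for r using that by (intro pM) (simp add: M_def)
    then have "p 0 \<le> 0" by (rule field_le_epsilon[where y = 0, simplified])
    then show ?thesis using True by simp
  next
    case False
    then have c: "cmod c > 0" by simp
    have "p (scaleC c x) / cmod c \<le> p x"
    proof (rule pG)
      fix r assume r: "r \<in> M x"
      then have r0: "r > 0" by (simp add: M_def)
      (* Only the phase of \<open>c\<close> acts on \<open>B\<close>, and \<open>B\<close> is balanced. *)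
      have "scaleC (c / of_real (cmod c)) (scaleR (inverse r) x) \<in> B"
        using r c by (intro Bbal) (auto simp: M_def norm_divide)
      then have "scaleR (inverse (cmod c * r)) (scaleC c x) \<in> B"
        using c r0 by (simp add: scaleR_scaleC scaleC_scaleC field_simps)
      then have "cmod c * r \<in> M (scaleC c x)" using c r0 by (simp add: M_def)
      from pM[OF this] show "p (scaleC c x) / cmod c \<le> r" using c by (simp add: field_simps)
    qed
    then show ?thesis using c by (simp add: field_simps)
  qed
  have pscale: "p (scaleC c x) = cmod c * p x" for c x
  proof (cases "c = 0")
    case True
    then show ?thesis using pscale_le[of c x] p0[of "scaleC c x"] by simp
  next
    case False
    have "p x = p (scaleC (inverse c) (scaleC c x))" using False by (simp add: scaleC_scaleC scaleC_one)
    also have "\<dots> \<le> cmod (inverse c) * p (scaleC c x)" by (rule pscale_le)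
    finally have "p x \<le> inverse (cmod c) * p (scaleC c x)" by (simp only: norm_inverse)
    then have "cmod c * p x \<le> p (scaleC c x)" using False by (simp add: field_simps)
    then show ?thesis using pscale_le[of c x] by simp
  qed
  have p: "complex_seminorm p" using padd pscale by (simp add: complex_seminorm_def)
  have "continuous_on UNIV p"
  proof (rule complex_seminorm_continuous[OF p])
    fix \<epsilon> :: real assume eps: "\<epsilon> > 0"
    have "p x \<le> \<epsilon> / 2" if "scaleR (inverse (\<epsilon> / 2)) x \<in> X" for x
      using that XB eps by (intro pM) (auto simp: M_def)
    then show "\<exists>N. open N \<and> 0 \<in> N \<and> (\<forall>x\<in>N. p x < \<epsilon>)"
      using near[of "inverse (\<epsilon> / 2)"] eps
      by (intro exI[of _ "{x. scaleR (inverse (\<epsilon> / 2)) x \<in> X}"]) fastforce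
  qed
  moreover have "x \<in> U" if "p x < 1" for x
  proof -
    have "\<exists>r\<in>M x. r < 1" using that Mne Mbdd by (simp add: p_def cInf_less_iff)
    then obtain r where "r \<in> M x" "r < 1" by blast
    then have "1 \<in> M x" by (intro Mup[of r x 1]) auto
    then show ?thesis using Bsub V(4) by (auto simp: M_def)
  qed
  ultimately show thesis using that p by blast
qed

lemma complex_seminorm_sum:
  "(\<And>i. i \<in> I \<Longrightarrow> complex_seminorm (p i)) \<Longrightarrow> complex_seminorm (\<lambda>x. \<Sum>i\<in>I. p i x)"
  unfolding complex_seminorm_def by (auto simp: sum_distrib_left sum.distrib[symmetric] intro!: sum_mono)

lemma fundamental_seminorms:
  assumes "first_countable (euclidean :: 'a::complex_lcs topology)"
  obtains p :: "nat \<Rightarrow> 'a::complex_lcs \<Rightarrow> real" where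
    "\<And>n. complex_seminorm (p n)" "\<And>n. continuous_on UNIV (p n)" "\<And>n x. p n x \<le> p (Suc n) x"
    "\<And>W. open W \<Longrightarrow> 0 \<in> W \<Longrightarrow> \<exists>n. \<forall>x. p n x < 1 \<longrightarrow> x \<in> W"
proof -
  obtain \<B> :: "'a set set" where \<B>: "countable \<B>" "\<forall>V\<in>\<B>. open V"
    "\<forall>U. open U \<and> 0 \<in> U \<longrightarrow> (\<exists>V\<in>\<B>. 0 \<in> V \<and> V \<subseteq> U)"
    using assms unfolding first_countable_def by (auto dest: spec[of _ "0::'a"])
  define \<B>' where "\<B>' = {V\<in>\<B>. 0 \<in> V}"
  have cnt: "countable \<B>'" using \<B>(1) by (simp add: \<B>'_def)
  have ne: "\<B>' \<noteq> {}" using \<B>(3)[rule_format, of UNIV] by (auto simp: \<B>'_def)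
  define U where "U = from_nat_into \<B>'"
  have U: "open (U i)" "0 \<in> U i" for i
    using from_nat_into[OF ne, of i] \<B>(2) by (auto simp: \<B>'_def U_def)
  have "\<exists>s. complex_seminorm s \<and> continuous_on UNIV s \<and> (\<forall>x. s x < 1 \<longrightarrow> x \<in> U i)" for i
    by (rule seminorm_in_neighbourhood[OF U]) blast
  then obtain s where s: "\<And>i. complex_seminorm (s i)" "\<And>i. continuous_on UNIV (s i)"
    "\<And>i x. s i x < 1 \<Longrightarrow> x \<in> U i" by metis
  define p where "p n x = (\<Sum>i\<le>n. s i x)" for n x
  show thesis
  proof (rule that[of p])
    show "complex_seminorm (p n)" for n
      unfolding p_def by (intro complex_seminorm_sum s)
    show "continuous_on UNIV (p n)" for n
      unfolding p_def by (intro continuous_intros s)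
    show "p n x \<le> p (Suc n) x" for n x
      using complex_seminorm_nonneg[OF s(1), of "Suc n" x] by (simp add: p_def)
    fix W :: "'a set" assume W: "open W" "0 \<in> W"
    then obtain V where V: "V \<in> \<B>" "0 \<in> V" "V \<subseteq> W" using \<B>(3) by blast
    then have "V \<in> \<B>'" by (simp add: \<B>'_def)
    then obtain n where n: "U n = V" using from_nat_into_to_nat_on[OF cnt] unfolding U_def by blast
    have "s n x \<le> p n x" for x
      unfolding p_def by (rule member_le_sum) (auto intro: complex_seminorm_nonneg s)
    then show "\<exists>n. \<forall>x. p n x < 1 \<longrightarrow> x \<in> W"
      using s(3)[of n] n V(3) by (intro exI[of _ n]) (meson order.strict_trans1 subsetD)
  qed
qed

lemma linear_functional_bounded_by_seminorm_continuous:
  fixes \<phi> :: "'a::complex_lcs \<Rightarrow> complex"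
  assumes \<phi>: "linear_functional \<phi>" and q: "continuous_on UNIV q" "complex_seminorm q" and le: "\<And>x. cmod (\<phi> x) \<le> q x"
  shows "continuous_on UNIV \<phi>"
  unfolding continuous_on_def
proof (intro ballI tendstoI)
  fix x :: 'a and \<epsilon> :: real assume eps: "\<epsilon> > 0"
  have lin: "\<phi> (x + y) = \<phi> x + \<phi> y" "\<phi> (scaleC c x) = c * \<phi> x" for x y c
    using \<phi> by (auto simp: linear_functional_iff)
  have "\<phi> y - \<phi> x = \<phi> (y - x)" for y
    using lin(1)[of "y - x" x] by simp
  then have le': "cmod (\<phi> y - \<phi> x) \<le> q (y - x)" for y using le by simp
  have q0: "q 0 = 0" using complex_seminormD(2)[OF q(2), of 0 0] by simp
  have "continuous_on UNIV (\<lambda>y. q (y - x))"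
    by (rule continuous_on_compose2[OF q(1)]) (auto intro!: continuous_intros)
  then have "open {y. q (y - x) < \<epsilon>}"
    by (intro open_Collect_less continuous_intros)
  then have "\<forall>\<^sub>F y in at x. y \<in> {y. q (y - x) < \<epsilon>}"
    by (rule eventually_at_in_open') (simp add: q0 eps)
  then show "\<forall>\<^sub>F y in at x within UNIV. dist (\<phi> y) (\<phi> x) < \<epsilon>"
    by eventually_elim (use le' in \<open>auto simp: dist_norm intro: order.strict_trans1\<close>)
qed

lemma linear_functional_cmod_seminorm:
  "linear_functional \<phi> \<Longrightarrow> complex_seminorm (\<lambda>x. cmod (\<phi> x))"
  by (auto simp: linear_functional_iff complex_seminorm_def norm_mult norm_triangle_ineq)

lemma linear_functional_sum:
  assumes "linear_functional h"
  shows "h (\<Sum>k\<in>I. scaleC (c k) (y k)) = (\<Sum>k\<in>I. c k * h (y k))"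
proof -
  have h: "h (x + y) = h x + h y" "h (scaleC c x) = c * h x" for x y c
    using assms by (auto simp: linear_functional_iff)
  have "h 0 = 0" using h(2)[of 0 0] by simp
  then show ?thesis by (induction I rule: infinite_finite_induct) (auto simp: h)
qed

lemma linear_functional_diff:
  assumes "linear_functional h"
  shows "h (x - y) = h x - h y"
proof -
  have "h (x - y + y) = h (x - y) + h y" using assms unfolding linear_functional_iff by blast
  then show ?thesis by simp
qed

lemma bounded_lcs_seminorm_bound:
  assumes B: "bounded_lcs B" and q: "continuous_on UNIV q" "complex_seminorm q"
  obtains C where "C > 0" "\<And>v. v \<in> B \<Longrightarrow> q v \<le> C"
proof -
  have q0: "q 0 = 0" using complex_seminormD(2)[OF q(2), of 0 0] by simp
  have "open {x. q x < 1}" by (intro open_Collect_less q continuous_intros)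
  moreover have "0 \<in> {x. q x < 1}" by (simp add: q0)
  ultimately have "\<exists>s>0. \<forall>c. cmod c \<ge> s \<longrightarrow> B \<subseteq> scaleC c ` {x. q x < 1}"
    using B unfolding bounded_lcs_def by blast
  then obtain s where s: "s > 0" "\<And>c. cmod c \<ge> s \<Longrightarrow> B \<subseteq> scaleC c ` {x. q x < 1}" by blast
  show thesis
  proof (rule that[OF s(1)])
    fix v assume "v \<in> B"
    then obtain x where "v = scaleC (of_real s) x" "q x < 1" using s(2)[of "of_real s"] s(1) by auto
    then show "q v \<le> s" using s(1) by (simp add: complex_seminormD(2)[OF q(2)] mult_le_cancel_left1)
  qed
qed

lemma seminorm_bound_bounded_lcs:
  fixes B :: "'a::complex_lcs set"
  assumes fund: "\<And>W. open W \<Longrightarrow> 0 \<in> W \<Longrightarrow> \<exists>n. \<forall>x. p n x < 1 \<longrightarrow> x \<in> W"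
    and p: "\<And>n. complex_seminorm (p n)"
    and bd: "\<And>n. \<exists>C. \<forall>v\<in>B. p n v \<le> C"
  shows "bounded_lcs B"
  unfolding bounded_lcs_def
proof (intro allI impI)
  fix U :: "'a set" assume "open U \<and> 0 \<in> U"
  then obtain n where n: "\<And>x. p n x < 1 \<Longrightarrow> x \<in> U" using fund by blast
  obtain C where C: "\<And>v. v \<in> B \<Longrightarrow> p n v \<le> C" using bd[of n] by blast
  have "B \<subseteq> scaleC c ` U" if c: "cmod c \<ge> \<bar>C\<bar> + 1" for c
  proof
    fix v assume v: "v \<in> B"
    have c0: "c \<noteq> 0" using c by auto
    have "p n (scaleC (inverse c) v) = p n v / cmod c"
      by (simp add: complex_seminormD(2)[OF p] norm_inverse divide_inverse mult.commute)
    also have "\<dots> < 1" using C[OF v] c c0 by (simp add: divide_less_eq)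
    finally have "scaleC (inverse c) v \<in> U" by (rule n)
    then show "v \<in> scaleC c ` U"
      using c0 by (intro image_eqI[of _ _ "scaleC (inverse c) v"]) (auto simp: scaleC_scaleC scaleC_one)
  qed
  then show "\<exists>s>0. \<forall>c. cmod c \<ge> s \<longrightarrow> B \<subseteq> scaleC c ` U"
    by (intro exI[of _ "\<bar>C\<bar> + 1"]) auto
qed

text \<open>
  Nuclearity in the form that is used for the dual: functionals \<open>h\<close> dominated by a multiple of \<open>p\<close> are expanded into
  the series \<open>\<Sum>k. h (y k) \<theta> k\<close>, whose remainders are small in the dual norm of a larger seminorm \<open>q\<close>,
  with a rate \<open>T\<close> that does not depend on \<open>h\<close>. It results from applying \<open>h\<close> to the nuclear
  representation of the canonical map from the local space of \<open>q\<close> to that of \<open>p\<close>; \<open>T N\<close> is the \<open>N\<close>-th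
  tail of the absolutely convergent series of coefficients.
\<close>

lemma nuclear_expansion:
  fixes p :: "'f::complex_lcs \<Rightarrow> real"
  assumes nuc: "nuclear_space TYPE('f)" and p: "complex_seminorm p" "continuous_on UNIV p"
  obtains q y \<theta> T where "complex_seminorm q" "continuous_on UNIV q"
    "\<And>k::nat. linear_functional (\<theta> k)" "\<And>k. continuous_on UNIV (\<theta> k)" "T \<longlonglongrightarrow> (0::real)"
    "\<And>h v N K. linear_functional h \<Longrightarrow> K \<ge> 0 \<Longrightarrow> \<forall>v. cmod (h v) \<le> K * p v \<Longrightarrow>
       cmod (h v - (\<Sum>k<N. \<theta> k v * h (y k))) \<le> K * T N * q v"
proof -
  from nuc p have "\<exists>q. complex_seminorm q \<and> continuous_on UNIV q \<and> (\<forall>x. p x \<le> q x) \<and> nuclear_map q p (\<lambda>x. x)"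
    by (simp add: nuclear_space_def)
  then obtain q where q: "complex_seminorm q" "continuous_on UNIV q" "nuclear_map q p (\<lambda>x. x)" by blast
  from q(3) obtain c \<phi> y where cs: "summable (\<lambda>n. cmod (c n))"
    and \<phi>: "\<And>n. linear_functional (\<phi> n)" "\<And>n x. cmod (\<phi> n x) \<le> q x"
    and y: "\<And>n. p (y n) \<le> 1"
    and lim: "\<And>x. (\<lambda>N. p (x - (\<Sum>n<N. scaleC (c n * \<phi> n x) (y n)))) \<longlonglongrightarrow> 0"
    unfolding nuclear_map_def by blast
  define \<theta> where "\<theta> k v = c k * \<phi> k v" for k v
  define T where "T N = (\<Sum>k. cmod (c (k + N)))" for N
  have \<theta>lin: "linear_functional (\<theta> k)" for k
    using \<phi>(1)[of k] by (auto simp: linear_functional_iff \<theta>_def algebra_simps)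
  show thesis
  proof (rule that[of q \<theta> T y])
    show "continuous_on UNIV (\<theta> k)" for k
    proof -
      have "continuous_on UNIV (\<phi> k)"
        by (rule linear_functional_bounded_by_seminorm_continuous[OF \<phi>(1) q(2,1) \<phi>(2)])
      then show ?thesis unfolding \<theta>_def by (intro continuous_intros)
    qed
    show "T \<longlonglongrightarrow> 0"
      unfolding T_def using suminf_exist_split2[OF cs] .
    fix h :: "'f \<Rightarrow> complex" and v N and K :: real
    assume h: "linear_functional h" and K: "K \<ge> 0" and le: "\<forall>v. cmod (h v) \<le> K * p v"
    define r where "r M = h v - (\<Sum>k<M. \<theta> k v * h (y k))" for M
    have r: "r \<longlonglongrightarrow> 0"
    proof (rule Lim_null_comparison)
      have "r M = h (v - (\<Sum>k<M. scaleC (\<theta> k v) (y k)))" for M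
        by (simp add: r_def linear_functional_diff[OF h] linear_functional_sum[OF h])
      then show "\<forall>\<^sub>F M in sequentially. norm (r M) \<le> K * p (v - (\<Sum>k<M. scaleC (\<theta> k v) (y k)))"
        using le by (intro always_eventually) auto
      show "(\<lambda>M. K * p (v - (\<Sum>k<M. scaleC (\<theta> k v) (y k)))) \<longlonglongrightarrow> 0"
        using tendsto_mult[OF tendsto_const[of K] lim[of v]] by (simp add: \<theta>_def)
    qed
    have bd: "cmod (r N) \<le> cmod (r (M + N)) + K * T N * q v" for M
    proof -
      have "r N - r (M + N) = (\<Sum>k<M. \<theta> (k + N) v * h (y (k + N)))"
        unfolding r_def by (induction M) auto
      moreover have "cmod (\<Sum>k<M. \<theta> (k + N) v * h (y (k + N))) \<le> (\<Sum>k<M. cmod (c (k + N)) * (q v * K))"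
      proof (rule sum_norm_le)
        fix k
        have "cmod (h (y (k + N))) \<le> K * p (y (k + N))" using le by blast
        also have "\<dots> \<le> K * 1" using y K by (intro mult_left_mono)
        finally show "cmod (\<theta> (k + N) v * h (y (k + N))) \<le> cmod (c (k + N)) * (q v * K)"
          unfolding \<theta>_def norm_mult mult.assoc using \<phi>(2)[of "k + N" v]
          by (intro mult_left_mono mult_mono) (auto simp: complex_seminorm_nonneg[OF q(1)])
      qed
      moreover have "(\<Sum>k<M. cmod (c (k + N)) * (q v * K)) \<le> T N * (q v * K)"
        unfolding sum_distrib_right[symmetric] T_def
        using cs K by (intro mult_right_mono sum_le_suminf summable_ignore_initial_segment)
           (auto simp: complex_seminorm_nonneg[OF q(1)])
      ultimately have "cmod (r N - r (M + N)) \<le> K * T N * q v" by (simp add: mult_ac)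
      then show ?thesis using norm_triangle_ineq[of "r (M + N)" "r N - r (M + N)"] by simp
    qed
    have "(\<lambda>M. cmod (r (M + N)) + K * T N * q v) \<longlonglongrightarrow> 0 + K * T N * q v"
      by (intro tendsto_intros tendsto_norm_zero LIMSEQ_ignore_initial_segment r)
    then have "cmod (r N) \<le> 0 + K * T N * q v"
      by (rule LIMSEQ_le_const) (use bd in blast)
    then show "cmod (h v - (\<Sum>k<N. \<theta> k v * h (y k))) \<le> K * T N * q v"
      by (simp add: r_def)
  qed (auto intro: q \<theta>lin)
qed

section \<open>Strong duals of metrizable nuclear spaces\<close>

text \<open>
  A space \<open>'e\<close> identified by \<open>J\<close> with the strong dual of a nuclear space \<open>'f\<close> whose topology is
  given by an increasing sequence of seminorms \<open>p\<close>.
\<close>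

locale metrizable_nuclear_dual =
  fixes J :: "'e::complex_lcs \<Rightarrow> 'f::complex_lcs \<Rightarrow> complex" and p :: "nat \<Rightarrow> 'f \<Rightarrow> real"
  assumes J_add: "J (x + y) = (\<lambda>v. J x v + J y v)"
    and J_scaleC: "J (scaleC c x) = (\<lambda>v. c * J x v)"
    and J_homeomorphic: "homeomorphic_map euclidean strong_dual J"
    and p_seminorm: "complex_seminorm (p n)"
    and p_continuous: "continuous_on UNIV (p n)"
    and p_Suc: "p n v \<le> p (Suc n) v"
    and p_fundamental: "open W \<Longrightarrow> 0 \<in> W \<Longrightarrow> \<exists>n. \<forall>x. p n x < 1 \<longrightarrow> x \<in> W"
    and nuclear: "nuclear_space TYPE('f)"
begin

lemma p_mono: "m \<le> n \<Longrightarrow> p m v \<le> p n v"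
  by (rule lift_Suc_mono_le[of "\<lambda>n. p n v"]) (rule p_Suc)

lemma p_nonneg: "p n v \<ge> 0"
  by (rule complex_seminorm_nonneg[OF p_seminorm])

lemma J_dual: "linear_functional (J x) \<and> continuous_on UNIV (J x)"
proof -
  have "J ` UNIV = {\<phi>. linear_functional \<phi> \<and> continuous_on UNIV \<phi>}"
    using homeomorphic_imp_surjective_map[OF J_homeomorphic] by (simp add: strong_dual_def)
  then show ?thesis by blast
qed

lemmas J_linear = J_dual[THEN conjunct1] and J_continuous = J_dual[THEN conjunct2]

lemma J_surj:
  assumes "linear_functional \<phi>" "continuous_on UNIV \<phi>"
  obtains x where "J x = \<phi>"
proof -
  have "J ` UNIV = {\<phi>. linear_functional \<phi> \<and> continuous_on UNIV \<phi>}"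
    using homeomorphic_imp_surjective_map[OF J_homeomorphic] by (simp add: strong_dual_def)
  then have "\<phi> \<in> range J" using assms by simp
  then show thesis using that by auto
qed

lemma J_inj: "J x = J y \<Longrightarrow> x = y"
  using homeomorphic_imp_injective_map[OF J_homeomorphic] by (auto dest: injD)

lemma J_diff: "J (x - y) v = J x v - J y v"
  using fun_cong[OF J_add[of "x - y" y], of v] by simp

lemma bounded_lcs_seminorms: "(\<And>n. \<exists>C. \<forall>v\<in>B. p n v \<le> C) \<Longrightarrow> bounded_lcs B"
  by (rule seminorm_bound_bounded_lcs[of p, OF p_fundamental p_seminorm])

lemma finite_seminorm_bound:
  assumes "finite B" shows "\<exists>C. \<forall>v\<in>B. p n v \<le> C"
proof (intro exI ballI)
  fix v assume "v \<in> B"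
  then show "p n v \<le> (\<Sum>v\<in>B. p n v)" using assms by (intro member_le_sum) (auto intro: p_nonneg)
qed

lemma bounded_lcs_finite:
  assumes "finite (B :: 'f set)" shows "bounded_lcs B"
  by (rule bounded_lcs_seminorms[OF finite_seminorm_bound[OF assms]])

lemma open_strong:
  assumes "open U" "x \<in> U"
  obtains B \<epsilon> where "bounded_lcs B" "\<epsilon> > 0" "\<And>y. \<forall>v\<in>B. cmod (J y v - J x v) < \<epsilon> \<Longrightarrow> y \<in> U"
proof -
  have "openin strong_dual (J ` U)"
    using homeomorphic_map_openness[OF J_homeomorphic] assms(1) by simp
  moreover have "J x \<in> J ` U" using assms(2) by simp
  ultimately obtain \<F> \<epsilon> where F: "finite \<F>" "\<F> \<subseteq> {B. bounded_lcs B}" "\<epsilon> > 0"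
    "{\<psi> \<in> {\<phi>. linear_functional \<phi> \<and> continuous_on UNIV \<phi>}. \<forall>v\<in>\<Union>\<F>. cmod (\<psi> v - J x v) < \<epsilon>} \<subseteq> J ` U"
    unfolding strong_dual_def openin_uniform_convergence_topology by meson
  have "bounded_lcs (\<Union>\<F>)"
  proof (rule bounded_lcs_seminorms)
    fix n
    have "\<exists>C. \<forall>v\<in>B. p n v \<le> C" if "B \<in> \<F>" for B
    proof -
      have B: "bounded_lcs B" using that F(2) by blast
      obtain C where "C > 0" "\<And>v. v \<in> B \<Longrightarrow> p n v \<le> C"
        by (rule bounded_lcs_seminorm_bound[OF B p_continuous p_seminorm, of n]) (rule that)
      then show ?thesis by blast
    qed
    then have "\<forall>B\<in>\<F>. \<exists>C. \<forall>v\<in>B. p n v \<le> C" by blast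
    then obtain C where C: "\<And>B v. B \<in> \<F> \<Longrightarrow> v \<in> B \<Longrightarrow> p n v \<le> C B" by metis
    have "p n v \<le> (\<Sum>B\<in>\<F>. \<bar>C B\<bar>)" if v: "v \<in> \<Union>\<F>" for v
    proof -
      obtain B where B: "B \<in> \<F>" "v \<in> B" using v by blast
      have "\<bar>C B\<bar> \<le> (\<Sum>B\<in>\<F>. \<bar>C B\<bar>)" using B F(1) by (intro member_le_sum) auto
      then show ?thesis using C[OF B] by linarith
    qed
    then show "\<exists>C. \<forall>v\<in>\<Union>\<F>. p n v \<le> C" by blast
  qed
  then show thesis
  proof (rule that[OF _ F(3)])
    fix y assume "\<forall>v\<in>\<Union>\<F>. cmod (J y v - J x v) < \<epsilon>"
    then have "J y \<in> J ` U" using F(4) J_dual by blast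
    then show "y \<in> U" using J_inj by blast
  qed
qed

lemma strong_open:
  assumes "\<And>x. x \<in> U \<Longrightarrow> \<exists>B \<epsilon>. bounded_lcs B \<and> \<epsilon> > 0 \<and> (\<forall>y. (\<forall>v\<in>B. cmod (J y v - J x v) < \<epsilon>) \<longrightarrow> y \<in> U)"
  shows "open U"
proof -
  have "openin strong_dual (J ` U)"
    unfolding strong_dual_def openin_uniform_convergence_topology
  proof (intro conjI ballI)
    show "J ` U \<subseteq> {\<phi>. linear_functional \<phi> \<and> continuous_on UNIV \<phi>}" using J_dual by blast
    fix f assume "f \<in> J ` U"
    then obtain x where x: "x \<in> U" "f = J x" by blast
    obtain B \<epsilon> where B: "bounded_lcs B" "\<epsilon> > 0" "\<And>y. \<forall>v\<in>B. cmod (J y v - J x v) < \<epsilon> \<Longrightarrow> y \<in> U"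
      using assms[OF x(1)] by (elim exE conjE) blast
    have "\<psi> \<in> J ` U" if \<psi>: "linear_functional \<psi>" "continuous_on UNIV \<psi>" "\<forall>v\<in>B. cmod (\<psi> v - J x v) < \<epsilon>" for \<psi>
    proof -
      obtain y where y: "J y = \<psi>" by (rule J_surj[OF \<psi>(1,2)])
      then have "y \<in> U" using \<psi>(3) by (intro B(3)) simp
      then show ?thesis using y by blast
    qed
    then show "\<exists>\<F> \<epsilon>. finite \<F> \<and> \<F> \<subseteq> {B. bounded_lcs B} \<and> 0 < \<epsilon> \<and>
       {\<psi> \<in> {\<phi>. linear_functional \<phi> \<and> continuous_on UNIV \<phi>}. \<forall>v\<in>\<Union>\<F>. cmod (\<psi> v - f v) < \<epsilon>} \<subseteq> J ` U"
      using B(1,2) x(2) by (intro exI[of _ "{B}"] exI[of _ \<epsilon>]) auto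
  qed
  then show ?thesis using homeomorphic_map_openness[OF J_homeomorphic, of U] by simp
qed

lemma evaluation_continuous: "continuous_on S (\<lambda>x. J x v)"
proof -
  have "open ((\<lambda>x. J x v) -` A)" if A: "open A" for A
  proof (rule strong_open)
    fix x assume "x \<in> (\<lambda>x. J x v) -` A"
    then obtain \<epsilon> where "\<epsilon> > 0" "ball (J x v) \<epsilon> \<subseteq> A" using A open_contains_ball by blast
    then show "\<exists>B \<epsilon>. bounded_lcs B \<and> \<epsilon> > 0 \<and> (\<forall>y. (\<forall>w\<in>B. cmod (J y w - J x w) < \<epsilon>) \<longrightarrow> y \<in> (\<lambda>x. J x v) -` A)"
      by (intro exI[of _ "{v}"] exI[of _ \<epsilon>] conjI bounded_lcs_finite) (auto simp: dist_norm norm_minus_commute subset_iff)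
  qed
  then have "continuous_on UNIV (\<lambda>x. J x v)"
    unfolding continuous_on_open_vimage[OF open_UNIV] by simp
  then show ?thesis by (rule continuous_on_subset) simp
qed

lemma evaluation_dual: "(\<lambda>x. J x v) \<in> continuous_dual"
  by (simp add: continuous_dual_iff evaluation_continuous J_add J_scaleC)

text \<open>
  The polars of the neighbourhoods \<open>{v. n \<cdot> p n v \<le> 1}\<close>. The factor \<open>n\<close> makes them a fundamental
  sequence of equicontinuous sets, and reduces the zeroth one to the origin.
\<close>

definition polar :: "nat \<Rightarrow> 'e set"
  where "polar n = {x. \<forall>v. cmod (J x v) \<le> real n * p n v}"

lemma polar_mono:
  assumes mn: "m \<le> n" shows "polar m \<subseteq> polar n"
  unfolding polar_def
proof (intro Collect_mono impI allI)
  fix x v assume x: "\<forall>v. cmod (J x v) \<le> real m * p m v"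
  have "cmod (J x v) \<le> real m * p m v" using x by blast
  also have "\<dots> \<le> real n * p n v"
    using mn by (intro mult_mono p_mono p_nonneg) auto
  finally show "cmod (J x v) \<le> real n * p n v" .
qed

lemma polar_union: "\<exists>n. x \<in> polar n"
proof -
  define W where "W = {v. cmod (J x v) < 1}"
  have J0: "J x 0 = 0" using linear_functional_diff[OF J_linear, of x 0 0] by simp
  have "open W" "0 \<in> W"
    unfolding W_def by (auto intro!: open_Collect_less continuous_intros J_continuous simp: J0)
  then obtain n where n: "\<And>v. p n v < 1 \<Longrightarrow> cmod (J x v) < 1"
    using p_fundamental[of W] by (auto simp: W_def)
  have "cmod (J x v) \<le> p n v" for v
  proof (rule dense_ge)
    fix s assume s: "p n v < s"
    then have s0: "s > 0" using p_nonneg[of n v] by linarith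
    define c where "c = complex_of_real (inverse s)"
    have c: "cmod c = inverse s" unfolding c_def norm_of_real using s0 by simp
    have "p n (scaleC c v) < 1"
      using s s0 by (simp add: complex_seminormD(2)[OF p_seminorm] c field_simps)
    from n[OF this] have "inverse s * cmod (J x v) < 1"
      using J_linear[of x] by (simp add: linear_functional_iff norm_mult c)
    then show "cmod (J x v) \<le> s" using s0 by (simp add: field_simps)
  qed
  also have "p n v \<le> real (Suc n) * p (Suc n) v" for v
    using p_Suc[of n v] p_nonneg[of "Suc n" v] by (simp add: distrib_right add_increasing2)
  finally have "x \<in> polar (Suc n)" by (simp add: polar_def)
  then show ?thesis by blast
qed

lemma polar_seminorm:
  "complex_seminorm (\<lambda>v. real n * p n v)" "continuous_on UNIV (\<lambda>v. real n * p n v)"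
  using p_seminorm[of n] p_continuous[of n]
  by (auto simp: complex_seminorm_def distrib_left[symmetric] intro!: mult_left_mono continuous_intros)

text \<open>
  The theorem of Alaoglu and Bourbaki gives compactness in the topology of pointwise convergence,
  by Tychonoff's theorem. On the polar this topology is the strong one: by the nuclear expansion, a
  functional in the polar is determined on a bounded set, up to a small error, by its values at
  finitely many points \<open>y k\<close>.
\<close>

lemma polar_compact: "compact (polar n)"
proof -
  define pp where "pp v = real n * p n v" for v
  have pp: "complex_seminorm pp" "continuous_on UNIV pp"
    unfolding pp_def by (rule polar_seminorm)+
  obtain q y \<theta> T where q: "complex_seminorm q" "continuous_on UNIV q"
    and \<theta>: "\<And>k::nat. linear_functional (\<theta> k)" "\<And>k. continuous_on UNIV (\<theta> k)" and T: "T \<longlonglongrightarrow> (0::real)"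
    and expand: "\<And>h v N K. linear_functional h \<Longrightarrow> K \<ge> 0 \<Longrightarrow> \<forall>v. cmod (h v) \<le> K * pp v \<Longrightarrow>
       cmod (h v - (\<Sum>k<N. \<theta> k v * h (y k))) \<le> K * T N * q v"
    by (rule nuclear_expansion[OF nuclear pp]) (rule that)
  define Q where "Q = {f. linear_functional f \<and> (\<forall>v. cmod (f v) \<le> pp v)}"
  have coord: "continuous_on UNIV (\<lambda>f::'f \<Rightarrow> complex. f v)" for v
    by (rule continuous_on_product_coordinates)
  have "compactin (product_topology (\<lambda>i. euclidean) UNIV) (PiE UNIV (\<lambda>v. cball (0::complex) (pp v)))"
    unfolding compactin_PiE by simp
  then have "compact (PiE UNIV (\<lambda>v. cball (0::complex) (pp v)))"
    by (simp add: euclidean_product_topology)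
  moreover have "closed {f::'f \<Rightarrow> complex. linear_functional f}"
    unfolding linear_functional_iff
    by (intro closed_Collect_conj closed_Collect_all closed_Collect_eq continuous_intros coord)
  ultimately have "compact (PiE UNIV (\<lambda>v. cball (0::complex) (pp v)) \<inter> {f. linear_functional f})"
    by (rule compact_Int_closed)
  also have "PiE UNIV (\<lambda>v. cball (0::complex) (pp v)) \<inter> {f. linear_functional f} = Q"
    by (auto simp: Q_def PiE_def Pi_def)
  finally have Q: "compact Q" .
  define j where "j = inv J"
  have jJ: "j (J x) = x" for x
    unfolding j_def by (rule inv_f_f) (auto intro: injI J_inj)
  have QJ: "\<exists>x. f = J x" if "f \<in> Q" for f
  proof -
    have f: "linear_functional f" "\<And>v. cmod (f v) \<le> pp v" using that by (auto simp: Q_def)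
    have "continuous_on UNIV f"
      using f polar_seminorm unfolding pp_def
      by (intro linear_functional_bounded_by_seminorm_continuous)
    from J_surj[OF f(1) this] show ?thesis by metis
  qed
  have "continuous_on Q j"
    unfolding continuous_on_topological
  proof (intro ballI allI impI)
    fix f U assume f: "f \<in> Q" and U: "open U" "j f \<in> U"
    obtain x where x: "f = J x" using QJ[OF f] by blast
    then have "x \<in> U" using U(2) jJ by simp
    obtain B \<epsilon> where B: "bounded_lcs B" "\<epsilon> > 0" "\<And>z. \<forall>v\<in>B. cmod (J z v - J x v) < \<epsilon> \<Longrightarrow> z \<in> U"
      by (rule open_strong[OF U(1) \<open>x \<in> U\<close>]) (rule that)
    obtain C where C: "C > 0" "\<And>v. v \<in> B \<Longrightarrow> q v \<le> C"
      by (rule bounded_lcs_seminorm_bound[OF B(1) q(2,1)]) (rule that)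
    have "(\<lambda>N. 2 * \<bar>T N\<bar> * C) \<longlonglongrightarrow> 2 * \<bar>0\<bar> * C" by (intro tendsto_intros T)
    then have "\<forall>\<^sub>F N in sequentially. 2 * \<bar>T N\<bar> * C < \<epsilon> / 2"
      using B(2) by (intro order_tendstoD) auto
    then obtain N where N: "2 * \<bar>T N\<bar> * C < \<epsilon> / 2"
      unfolding eventually_sequentially by blast
    have "\<exists>D. D > 0 \<and> (\<forall>v\<in>B. cmod (\<theta> k v) \<le> D)" for k
      by (rule bounded_lcs_seminorm_bound[OF B(1) _ linear_functional_cmod_seminorm[OF \<theta>(1)], of k])
        (auto intro!: continuous_intros \<theta>)
    then obtain D where D: "\<And>k. D k > 0" "\<And>k v. v \<in> B \<Longrightarrow> cmod (\<theta> k v) \<le> D k" by metis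
    define M where "M = (\<Sum>k<N. D k)"
    have M: "M \<ge> 0" unfolding M_def by (intro sum_nonneg less_imp_le D)
    (* With this \<open>\<delta>\<close> the first \<open>N\<close> terms contribute at most \<open>\<epsilon> / 2\<close> on \<open>B\<close>, like the remainder;
       adding 1 avoids a division by 0. *)
    define \<delta> where "\<delta> = \<epsilon> / (2 * (M + 1))"
    have \<delta>: "\<delta> > 0" using B(2) M by (simp add: \<delta>_def)
    have "open (\<Inter>k<N. {g. cmod (g (y k) - f (y k)) < \<delta>})"
      by (intro open_INT finite_lessThan ballI open_Collect_less continuous_intros coord)
    moreover have "f \<in> (\<Inter>k<N. {g. cmod (g (y k) - f (y k)) < \<delta>})" using \<delta> by simp
    moreover have "j g \<in> U" if g: "g \<in> Q" "g \<in> (\<Inter>k<N. {g. cmod (g (y k) - f (y k)) < \<delta>})" for g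
    proof -
      obtain z where z: "g = J z" using QJ[OF g(1)] by blast
      define h where "h v = g v - f v" for v
      have h: "linear_functional h"
        using f g(1) by (auto simp: Q_def linear_functional_iff h_def algebra_simps)
      have h2: "\<forall>v. cmod (h v) \<le> 2 * pp v"
      proof
        fix v
        have "cmod (g v) \<le> pp v" "cmod (f v) \<le> pp v" using f g(1) by (auto simp: Q_def)
        then show "cmod (h v) \<le> 2 * pp v"
          using norm_triangle_ineq4[of "g v" "f v"] by (simp add: h_def)
      qed
      have "cmod (h v) < \<epsilon>" if v: "v \<in> B" for v
      proof -
        have "cmod (h v - (\<Sum>k<N. \<theta> k v * h (y k))) \<le> 2 * T N * q v"
          by (rule expand[OF h _ h2]) simp
        also have "\<dots> \<le> 2 * \<bar>T N\<bar> * C"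
          using C(2)[OF v] by (rule mult_mono[rotated]) (auto simp: complex_seminorm_nonneg[OF q(1)])
        finally have "cmod (h v - (\<Sum>k<N. \<theta> k v * h (y k))) < \<epsilon> / 2" using N by simp
        moreover have "cmod (\<Sum>k<N. \<theta> k v * h (y k)) \<le> (\<Sum>k<N. D k * \<delta>)"
        proof (rule sum_norm_le)
          fix k assume "k \<in> {..<N}"
          then have "cmod (h (y k)) \<le> \<delta>" using g(2) by (auto simp: h_def intro: less_imp_le)
          then show "cmod (\<theta> k v * h (y k)) \<le> D k * \<delta>"
            unfolding norm_mult using D(2)[OF v] D(1)[of k] by (intro mult_mono) auto
        qed
        moreover have "(\<Sum>k<N. D k * \<delta>) \<le> \<epsilon> / 2"
        proof -
          have "(\<Sum>k<N. D k * \<delta>) = M * \<delta>" by (simp add: M_def sum_distrib_right)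
          also have "\<dots> \<le> (M + 1) * \<delta>" using \<delta> by (intro mult_right_mono) auto
          also have "\<dots> = \<epsilon> / 2" using M by (simp add: \<delta>_def field_simps)
          finally show ?thesis .
        qed
        ultimately show ?thesis
          using norm_triangle_ineq[of "h v - (\<Sum>k<N. \<theta> k v * h (y k))" "\<Sum>k<N. \<theta> k v * h (y k)"] by simp
      qed
      then have "z \<in> U" by (intro B(3)) (simp add: h_def x z)
      then show ?thesis using z jJ by simp
    qed
    ultimately show "\<exists>A. open A \<and> f \<in> A \<and> (\<forall>g\<in>Q. g \<in> A \<longrightarrow> j g \<in> U)" by blast
  qed
  then have "compact (j ` Q)" using Q by (rule compact_continuous_image)
  also have "j ` Q = polar n"
  proof
    show "j ` Q \<subseteq> polar n"
    proof
      fix x assume "x \<in> j ` Q"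
      then obtain f where f: "f \<in> Q" "x = j f" by blast
      obtain z where "f = J z" using QJ[OF f(1)] by blast
      then show "x \<in> polar n" using f jJ by (auto simp: Q_def polar_def pp_def)
    qed
    show "polar n \<subseteq> j ` Q"
    proof
      fix x assume "x \<in> polar n"
      then have "J x \<in> Q" using J_linear by (simp add: Q_def polar_def pp_def)
      then show "x \<in> j ` Q" using jJ[of x] by (metis image_eqI)
    qed
  qed
  finally show ?thesis .
qed

lemma polar_closed: "closed (polar n)"
  by (rule compact_imp_closed[OF polar_compact])

text \<open>
  The theorem of Banach and Dieudonne. Given \<open>a\<close> outside \<open>C\<close>, a bounded set \<open>B\<close> is constructed whose
  polar, translated to \<open>a\<close>, avoids \<open>C\<close>. It is a union of finite sets \<open>G n\<close>, chosen so that the polar of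
  \<open>G n\<close> avoids the part of \<open>C\<close> in the translated \<open>n\<close>-th polar \<open>R n\<close>. As the \<open>n\<close>-th polar is the polar
  of \<open>V n\<close>, the points of \<open>V n\<close> together with those of \<open>G n\<close> exclude all points of the compact set
  \<open>C \<inter> R (n + 1)\<close>, and finitely many of them suffice. The new points are taken from the shrinking
  neighbourhoods \<open>V n\<close>, and so \<open>B\<close> is bounded.
\<close>

lemma closed_if_closed_in_polars:
  assumes C: "\<And>n. closed (C \<inter> polar n)"
  shows "closed C"
  unfolding closed_def
proof (rule strong_open)
  fix a assume a: "a \<in> - C"
  define R where "R n = {y. y - a \<in> polar n}" for n
  define V where "V n = {v. real n * p n v \<le> 1}" for n
  define F where "F v = {y. cmod (J (y - a) v) \<le> 1}" for v
  have Fclosed: "closed (F v)" for v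
    unfolding F_def J_diff by (intro closed_Collect_le continuous_intros evaluation_continuous)
  have RF: "y \<in> R n" if "\<forall>v\<in>V n. y \<in> F v" for y n
  proof -
    have "cmod (J (y - a) v) \<le> real n * p n v" for v
    proof (rule dense_ge)
      fix s assume s: "real n * p n v < s"
      then have s0: "s > 0" using p_nonneg[of n v] by (meson mult_nonneg_nonneg of_nat_0_le_iff order.strict_trans1)
      define c where "c = complex_of_real (inverse s)"
      have c: "cmod c = inverse s" unfolding c_def norm_of_real using s0 by simp
      have "scaleC c v \<in> V n"
        using s s0 by (simp add: V_def complex_seminormD(2)[OF p_seminorm] c field_simps)
      then have "cmod (J (y - a) (scaleC c v)) \<le> 1" using that by (simp add: F_def)
      then have "inverse s * cmod (J (y - a) v) \<le> 1"
        using J_linear[of "y - a"] by (simp add: linear_functional_iff norm_mult c)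
      then show "cmod (J (y - a) v) \<le> s" using s0 by (simp add: field_simps)
    qed
    then show ?thesis by (simp add: R_def polar_def)
  qed
  have CR: "compact (C \<inter> R n)" for n
  proof -
    obtain m where m: "a \<in> polar m" using polar_union by blast
    have "R n \<subseteq> polar (n + m)"
    proof
      fix y assume y: "y \<in> R n"
      have "cmod (J y v) \<le> real (n + m) * p (n + m) v" for v
      proof -
        have "J y v = J (y - a) v + J a v" by (simp add: J_diff)
        then have "cmod (J y v) \<le> cmod (J (y - a) v) + cmod (J a v)" by (simp add: norm_triangle_ineq)
        also have "\<dots> \<le> real n * p n v + real m * p m v"
          using y m by (intro add_mono) (auto simp: R_def polar_def)
        also have "\<dots> \<le> real n * p (n + m) v + real m * p (n + m) v"
          by (intro add_mono mult_left_mono p_mono) auto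
        finally show ?thesis by (simp add: distrib_right)
      qed
      then show "y \<in> polar (n + m)" by (simp add: polar_def)
    qed
    moreover have "closed (R n)"
    proof -
      have "closed ((\<lambda>y. y - a) -` polar n)"
        by (intro closed_vimage polar_closed continuous_intros)
      then show ?thesis by (simp add: R_def vimage_def)
    qed
    moreover have "compact (C \<inter> polar (n + m))"
      using closed_Int_compact[OF C[of "n + m"] polar_compact[of "n + m"]] by (simp add: Int_assoc)
    ultimately have "compact ((C \<inter> polar (n + m)) \<inter> R n)" by (intro compact_Int_closed[of "C \<inter> polar (n + m)"])
    also have "(C \<inter> polar (n + m)) \<inter> R n = C \<inter> R n" using \<open>R n \<subseteq> polar (n + m)\<close> by blast
    finally show ?thesis .
  qed
  have "\<exists>G. \<forall>n. (finite (G n) \<and> C \<inter> R n \<inter> (\<Inter>v\<in>G n. F v) = {}) \<and> (G n \<subseteq> G (Suc n) \<and> G (Suc n) \<subseteq> G n \<union> V n)"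
  proof (rule dependent_nat_choice)
    have "y = a" if "y \<in> R 0" for y
    proof -
      have "J (y - a) v = 0" for v using that by (simp add: R_def polar_def)
      then have "J y = J a" by (auto simp: J_diff fun_eq_iff)
      then show ?thesis by (rule J_inj)
    qed
    then have "C \<inter> R 0 = {}" using a by blast
    then show "\<exists>G. finite G \<and> C \<inter> R 0 \<inter> (\<Inter>v\<in>G. F v) = {}" by (intro exI[of _ "{}"]) simp
  next
    fix G n assume G: "finite G \<and> C \<inter> R n \<inter> (\<Inter>v\<in>G. F v) = {}"
    have empty: "C \<inter> R (Suc n) \<inter> (\<Inter>v\<in>G \<union> V n. F v) = {}"
    proof (rule equals0I)
      fix y assume "y \<in> C \<inter> R (Suc n) \<inter> (\<Inter>v\<in>G \<union> V n. F v)"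
      then have y: "y \<in> C" "\<forall>v\<in>G \<union> V n. y \<in> F v" by simp_all
      have "y \<in> R n" using y(2) by (intro RF) simp
      with y have "y \<in> C \<inter> R n \<inter> (\<Inter>v\<in>G. F v)" by simp
      then show False using G by simp
    qed
    have "\<exists>I'. finite I' \<and> I' \<subseteq> G \<union> V n \<and> C \<inter> R (Suc n) \<inter> (\<Inter>v\<in>I'. F v) = {}"
    proof (rule ccontr)
      assume none: "\<not> ?thesis"
      have "C \<inter> R (Suc n) \<inter> (\<Inter>v\<in>G \<union> V n. F v) \<noteq> {}"
      proof (rule compact_imp_fip_image[OF CR])
        show "closed (F v)" for v by (rule Fclosed)
        show "C \<inter> R (Suc n) \<inter> (\<Inter>v\<in>I'. F v) \<noteq> {}" if I': "finite I'" "I' \<subseteq> G \<union> V n" for I'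
        proof
          assume "C \<inter> R (Suc n) \<inter> (\<Inter>v\<in>I'. F v) = {}"
          with I' have "\<exists>I'. finite I' \<and> I' \<subseteq> G \<union> V n \<and> C \<inter> R (Suc n) \<inter> (\<Inter>v\<in>I'. F v) = {}"
            by (intro exI[of _ I'] conjI)
          with none show False by contradiction
        qed
      qed
      then show False using empty by contradiction
    qed
    then obtain I' where I': "finite I'" "I' \<subseteq> G \<union> V n" "C \<inter> R (Suc n) \<inter> (\<Inter>v\<in>I'. F v) = {}"
      by (elim exE conjE)
    show "\<exists>G'. (finite G' \<and> C \<inter> R (Suc n) \<inter> (\<Inter>v\<in>G'. F v) = {}) \<and> G \<subseteq> G' \<and> G' \<subseteq> G \<union> V n"
      using G I' by (intro exI[of _ "G \<union> I'"]) blast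
  qed
  then obtain G where G0: "\<forall>n. (finite (G n) \<and> C \<inter> R n \<inter> (\<Inter>v\<in>G n. F v) = {}) \<and> (G n \<subseteq> G (Suc n) \<and> G (Suc n) \<subseteq> G n \<union> V n)"
    by (elim exE)
  have G: "finite (G n)" "C \<inter> R n \<inter> (\<Inter>v\<in>G n. F v) = {}" "G (Suc n) \<subseteq> G n \<union> V n" for n
    using spec[OF G0, of n] by simp_all
  define B where "B = (\<Union>n. G n)"
  have bdd: "bounded_lcs B"
  proof (rule bounded_lcs_seminorms)
    fix m
    (* All points that are added after stage \<open>m + 1\<close> lie in some \<open>V n\<close> with \<open>n \<ge> max m 1\<close>. The bound is
       \<open>m + 1\<close> because \<open>V 0\<close> is the whole space. *)
    have sub: "G n \<subseteq> (\<Union>i\<le>Suc m. G i) \<union> {v. p m v \<le> 1}" for n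
    proof (induction n)
      case 0
      show ?case by blast
    next
      case (Suc n)
      show ?case
      proof (cases "Suc n \<le> Suc m")
        case False
        have n: "n \<ge> 1" using False by simp
        have "V n \<subseteq> {v. p m v \<le> 1}"
        proof
          fix v assume v: "v \<in> V n"
          have "p m v \<le> p n v" using False by (intro p_mono) simp
          also have "\<dots> \<le> real n * p n v" using n p_nonneg[of n v] by (simp add: mult_le_cancel_right1)
          finally show "v \<in> {v. p m v \<le> 1}" using v by (simp add: V_def)
        qed
        then show ?thesis using G(3)[of n] Suc by blast
      next
        case True
        then show ?thesis by blast
      qed
    qed
    obtain C' where C': "\<forall>v\<in>(\<Union>i\<le>Suc m. G i). p m v \<le> C'"
      using finite_seminorm_bound[of "\<Union>i\<le>Suc m. G i" m] G(1) by auto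
    have "p m v \<le> max C' 1" if "v \<in> B" for v
      using that sub C' by (fastforce simp: B_def)
    then show "\<exists>C. \<forall>v\<in>B. p m v \<le> C" by blast
  qed
  moreover have "y \<in> - C" if y: "\<forall>v\<in>B. cmod (J y v - J a v) < 1" for y
  proof
    assume "y \<in> C"
    obtain n where "y - a \<in> polar n" using polar_union by blast
    then have "y \<in> R n" by (simp add: R_def)
    moreover have "y \<in> (\<Inter>v\<in>G n. F v)"
      using y by (auto simp: B_def F_def J_diff intro: less_imp_le)
    ultimately show False using \<open>y \<in> C\<close> G(2)[of n] by blast
  qed
  ultimately show "\<exists>B \<epsilon>. bounded_lcs B \<and> \<epsilon> > 0 \<and> (\<forall>y. (\<forall>v\<in>B. cmod (J y v - J a v) < \<epsilon>) \<longrightarrow> y \<in> - C)"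
    by (intro exI[of _ B] exI[of _ 1]) auto
qed

text \<open>
  This uses the Banach-Dieudonne theorem in place of the uniform boundedness principle. If \<open>C\<close>
  were in no polar, a sequence of points of \<open>C\<close> outside the respective polars would meet each polar
  in a finite set; so all its subsets would be closed, contradicting compactness of \<open>C\<close>.
\<close>

lemma compact_subset_polar:
  assumes C: "compact C"
  shows "\<exists>n. C \<subseteq> polar n"
proof (rule ccontr)
  assume "\<not> ?thesis"
  then have "\<forall>n. \<exists>x. x \<in> C \<and> x \<notin> polar n" by blast
  then obtain x where x: "\<And>n. x n \<in> C" "\<And>n. x n \<notin> polar n" by metis
  have closed: "closed S" if S: "S \<subseteq> range x" for S
  proof (rule closed_if_closed_in_polars)
    fix n
    have "S \<inter> polar n \<subseteq> x ` {..<n}"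
    proof
      fix z assume z: "z \<in> S \<inter> polar n"
      then obtain i where i: "z = x i" using S by blast
      have "i < n" using z x(2)[of i] polar_mono[of n i] i by (meson IntD2 not_le subsetD)
      then show "z \<in> x ` {..<n}" using i by blast
    qed
    then have "finite (S \<inter> polar n)" by (rule finite_subset) simp
    then show "closed (S \<inter> polar n)" by (rule finite_imp_closed)
  qed
  have "infinite (range x)"
  proof
    assume fin: "finite (range x)"
    obtain N where N: "\<And>z. z \<in> polar (N z)" using polar_union by metis
    have "x i \<in> polar (\<Sum>z\<in>range x. N z)" for i
    proof -
      have "N (x i) \<le> (\<Sum>z\<in>range x. N z)" using fin by (intro member_le_sum) auto
      then show ?thesis using N polar_mono by blast
    qed
    then show False using x(2) by blast
  qed
  then obtain l where l: "l islimpt range x"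
    using Heine_Borel_imp_Bolzano_Weierstrass[OF C, of "range x"] x(1) by blast
  then have "l islimpt (range x - {l})"
    by (simp add: islimpt_def) blast
  moreover have "closed (range x - {l})" by (rule closed) blast
  ultimately show False using closed_limpt by blast
qed

lemma polar_compact_exhaustion: "compact_exhaustion polar"
  unfolding compact_exhaustion_def
proof (intro conjI allI impI)
  fix f :: "'e \<Rightarrow> complex" assume f: "\<forall>n. continuous_on (polar n) f"
  show "continuous_on UNIV f"
    unfolding continuous_on_closed_vimage[OF closed_UNIV]
  proof (intro allI impI)
    fix B :: "complex set" assume B: "closed B"
    have "closed (f -` B)"
    proof (rule closed_if_closed_in_polars)
      fix n
      have "continuous_on (polar n) f" using f by blast
      then show "closed (f -` B \<inter> polar n)"
        using B unfolding continuous_on_closed_vimage[OF polar_closed] by blast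
    qed
    then show "closed (f -` B \<inter> UNIV)" by simp
  qed
qed (auto intro: polar_compact compact_subset_polar subsetD[OF polar_mono[OF le_SucI[OF order.refl]]])

text \<open>
  The partial sums of the nuclear expansion are operators of finite rank on the dual. They
  converge uniformly on the polar, and each polar contributes countably many functionals, the
  evaluations at the points \<open>y k\<close>.
\<close>

lemma countable_finite_rank_approximation:
  obtains \<Psi> :: "('e \<Rightarrow> complex) set" where "countable \<Psi>" "finite_rank_approximation \<Psi>"
proof -
  have ex: "\<exists>y. \<forall>U. open U \<longrightarrow> 0 \<in> U \<longrightarrow>
      (\<exists>(N::nat) e. \<forall>x\<in>polar n. (\<Sum>k<N. scaleC (J x (y k)) (e k)) - x \<in> U)" for n
  proof -
    define pp where "pp v = real n * p n v" for v
  have pp: "complex_seminorm pp" "continuous_on UNIV pp"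
    unfolding pp_def by (rule polar_seminorm)+
    obtain q y \<theta> T where q: "complex_seminorm q" "continuous_on UNIV q"
      and \<theta>: "\<And>k::nat. linear_functional (\<theta> k)" "\<And>k. continuous_on UNIV (\<theta> k)" and T: "T \<longlonglongrightarrow> (0::real)"
      and expand: "\<And>h v N K. linear_functional h \<Longrightarrow> K \<ge> 0 \<Longrightarrow> \<forall>v. cmod (h v) \<le> K * pp v \<Longrightarrow>
         cmod (h v - (\<Sum>k<N. \<theta> k v * h (y k))) \<le> K * T N * q v"
      by (rule nuclear_expansion[OF nuclear pp]) (rule that)
    have "\<exists>x. J x = \<theta> k" for k by (rule J_surj[OF \<theta>]) blast
    then obtain e where e: "\<And>k. J (e k) = \<theta> k" by metis
    have J_sum: "J (\<Sum>k<N. scaleC (c k) (e k)) v = (\<Sum>k<N. c k * \<theta> k v)" for c v and N :: nat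
    proof (induction N)
      case 0
      have "J (0 - 0) v = 0" unfolding J_diff by simp
      then show ?case by simp
    next
      case (Suc N)
      then show ?case by (simp add: J_add J_scaleC e)
    qed
    show ?thesis
    proof (intro exI[of _ y] allI impI)
      fix U :: "'e set" assume U: "open U" "0 \<in> U"
      obtain B \<epsilon> where B: "bounded_lcs B" "\<epsilon> > 0" "\<And>z. \<forall>v\<in>B. cmod (J z v - J 0 v) < \<epsilon> \<Longrightarrow> z \<in> U"
        by (rule open_strong[OF U]) (rule that)
      obtain C where C: "C > 0" "\<And>v. v \<in> B \<Longrightarrow> q v \<le> C"
        by (rule bounded_lcs_seminorm_bound[OF B(1) q(2,1)]) (rule that)
      have "(\<lambda>N. \<bar>T N\<bar> * C) \<longlonglongrightarrow> \<bar>0\<bar> * C" by (intro tendsto_intros T)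
      then have "\<forall>\<^sub>F N in sequentially. \<bar>T N\<bar> * C < \<epsilon>"
        using B(2) by (intro order_tendstoD) auto
      then obtain N where N: "\<bar>T N\<bar> * C < \<epsilon>"
        unfolding eventually_sequentially by blast
      have J0: "J 0 v = 0" for v using J_diff[of 0 0 v] by simp
      have "(\<Sum>k<N. scaleC (J x (y k)) (e k)) - x \<in> U" if x: "x \<in> polar n" for x
      proof (rule B(3), rule ballI)
        fix v assume v: "v \<in> B"
        have "cmod (J ((\<Sum>k<N. scaleC (J x (y k)) (e k)) - x) v - J 0 v)
            = cmod (J x v - (\<Sum>k<N. \<theta> k v * J x (y k)))"
          by (simp add: J_diff J_sum J0 norm_minus_commute mult.commute)
        also have "\<dots> \<le> 1 * T N * q v"
          using x by (intro expand J_linear) (auto simp: polar_def pp_def)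
        also have "\<dots> \<le> \<bar>T N\<bar> * C"
          using C(2)[OF v] by (auto intro!: mult_mono simp: complex_seminorm_nonneg[OF q(1)])
        finally show "cmod (J ((\<Sum>k<N. scaleC (J x (y k)) (e k)) - x) v - J 0 v) < \<epsilon>" using N by simp
      qed
      then show "\<exists>(N::nat) e. \<forall>x\<in>polar n. (\<Sum>k<N. scaleC (J x (y k)) (e k)) - x \<in> U" by blast
    qed
  qed
  then have "\<forall>n. \<exists>y. \<forall>U. open U \<longrightarrow> 0 \<in> U \<longrightarrow>
      (\<exists>(N::nat) e. \<forall>x\<in>polar n. (\<Sum>k<N. scaleC (J x (y k)) (e k)) - x \<in> U)" by blast
  then obtain Y where Y: "\<And>n U. open U \<Longrightarrow> 0 \<in> U \<Longrightarrow>
      \<exists>(N::nat) e. \<forall>x\<in>polar n. (\<Sum>k<N. scaleC (J x (Y n k)) (e k)) - x \<in> U"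
    unfolding choice_iff by blast
  define \<Psi> where "\<Psi> = (\<lambda>(n, k). \<lambda>x. J x (Y n k)) ` UNIV"
  show thesis
  proof (rule that[of \<Psi>])
    show "countable \<Psi>" unfolding \<Psi>_def by (intro countable_image countableI_type)
    show "finite_rank_approximation \<Psi>"
      unfolding finite_rank_approximation_def
    proof (intro conjI allI impI)
      show "\<Psi> \<subseteq> continuous_dual" by (auto simp: \<Psi>_def evaluation_dual)
      fix K U :: "'e set" assume K: "compact K" and U: "open U" "0 \<in> U"
      obtain n where n: "K \<subseteq> polar n" using compact_subset_polar[OF K] by blast
      obtain N :: nat and e where Ne: "\<forall>x\<in>polar n. (\<Sum>k<N. scaleC (J x (Y n k)) (e k)) - x \<in> U"
        using Y[OF U, of n] by blast
      show "\<exists>(N::nat) \<psi> e. (\<forall>k. \<psi> k \<in> \<Psi>) \<and> (\<forall>x\<in>K. (\<Sum>k<N. scaleC (\<psi> k x) (e k)) - x \<in> U)"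
      proof (intro exI conjI allI ballI)
        show "(\<lambda>x. J x (Y n k)) \<in> \<Psi>" for k by (auto simp: \<Psi>_def)
        show "(\<Sum>k<N. scaleC (J x (Y n k)) (e k)) - x \<in> U" if "x \<in> K" for x
          using Ne n that by blast
      qed
    qed
  qed
qed

end

lemma finite_rank_approximation_continuous_dual:
  fixes \<Psi> :: "('e::complex_lcs \<Rightarrow> complex) set"
  assumes "finite_rank_approximation \<Psi>"
  shows "finite_rank_approximation (continuous_dual :: ('e \<Rightarrow> complex) set)"
  unfolding finite_rank_approximation_def
proof (intro conjI order.refl allI impI)
  fix K U :: "'e set" assume KU: "compact K" "open U" "0 \<in> U"
  have "\<exists>(N::nat) \<psi> e. (\<forall>k. \<psi> k \<in> \<Psi>) \<and> (\<forall>x\<in>K. (\<Sum>k<N. scaleC (\<psi> k x) (e k)) - x \<in> U)"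
    using assms KU by (simp add: finite_rank_approximation_def)
  then obtain N :: nat and \<psi> e where "\<forall>k. \<psi> k \<in> \<Psi>" "\<forall>x\<in>K. (\<Sum>k<N. scaleC (\<psi> k x) (e k)) - x \<in> U"
    by (elim exE conjE)
  moreover have "\<Psi> \<subseteq> continuous_dual" using assms by (simp add: finite_rank_approximation_def)
  ultimately show "\<exists>(N::nat) \<psi> e. (\<forall>k. \<psi> k \<in> continuous_dual) \<and> (\<forall>x\<in>K. (\<Sum>k<N. scaleC (\<psi> k x) (e k)) - x \<in> U)"
    by (intro exI[of _ N] exI[of _ \<psi>] exI[of _ e]) auto
qed

theorem theorem3p1:
  fixes L :: "('e::complex_lcs \<Rightarrow> complex) \<Rightarrow> ('e \<Rightarrow> complex)"
  assumes "DFN_space TYPE('e) TYPE('f::complex_lcs)"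
    and "convolution_operator L"
    and "nontrivial_operator L"
  shows "mixing compact_open_topology L \<and> hypercyclic compact_open_topology L"
proof -
  obtain J :: "'e \<Rightarrow> 'f \<Rightarrow> complex" where J: "\<And>x y. J (x + y) = (\<lambda>v. J x v + J y v)"
    "\<And>c x. J (scaleC c x) = (\<lambda>v. c * J x v)" "homeomorphic_map euclidean strong_dual J"
    using assms(1) unfolding DFN_space_def by blast
  have "first_countable (euclidean :: 'f topology)"
    using assms(1) metrizable_imp_first_countable by (auto simp: DFN_space_def frechet_space_def)
  then obtain p :: "nat \<Rightarrow> 'f \<Rightarrow> real" where p: "\<And>n. complex_seminorm (p n)" "\<And>n. continuous_on UNIV (p n)"
    "\<And>n x. p n x \<le> p (Suc n) x" "\<And>W. open W \<Longrightarrow> 0 \<in> W \<Longrightarrow> \<exists>n. \<forall>x. p n x < 1 \<longrightarrow> x \<in> W"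
    by (rule fundamental_seminorms) (rule that)
  interpret metrizable_nuclear_dual J p
    using J p assms(1) by unfold_locales (auto simp: DFN_space_def)
  obtain \<Psi> :: "('e \<Rightarrow> complex) set" where \<Psi>: "countable \<Psi>" "finite_rank_approximation \<Psi>"
    by (rule countable_finite_rank_approximation)
  note appr = finite_rank_approximation_continuous_dual[OF \<Psi>(2)]
  show ?thesis
    using convolution_operator_mixing[OF appr assms(2,3)]
      convolution_operator_hypercyclic[OF appr \<Psi>(2,1) polar_compact_exhaustion assms(2,3)] by blast
qed

end
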